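(* There is a universal constant $c>0$ such that the following holds. Consider the class $\mathcal{P}_{OSS}^{Gauss}$ of data-generating mechanisms described in the context, with parameters satisfying $C_X\ge\sqrt{8\lambda_+/3}$, $\kappa_\epsilon\ge105^{1/4}$, $\lambda_-<\lambda_+$ and $p\ge2$. Assume that there exist $\rho\in(0,1)$ and $C_\rho>0$ such that for all distinct $(g,h)\in[L]^2$, $\rho n_{\mathcal L}\le h_g\le C_\rho\rho n_{\mathcal L}$ and $\rho^2n_{\mathcal L}\le n_{g,h}\le C_\rho\rho^2n_{\mathcal L}$. Further suppose that $$\rho n_{\mathcal L}\ge p\max\left\{\frac12,\frac{R^2}{4B^2\lambda_-}\right\}\quad\text{and}\quad\max\left\{\frac{N+\rho^2n_{\mathcal L}}{B^2},\frac{\rho^2n_{\mathcal L}}{R^2}\right\}\ge p\,\frac{\min\{1,\lambda_+^2\}}{2B^2(\lambda_+-\lambda_-)^2}.$$ Then $$\inf_{\hat\beta\in\hat\Theta_{OSS}}\sup_{P\in\mathcal{P}_{OSS}^{Gauss}}\mathbb{E}\left[\|\hat\beta-\beta^*(P)\|_2^2\right]\ge c\left(\frac{1}{C_\rho\lambda_-}\frac{R^2p}{\rho n_{\mathcal L}}+\frac{\min\{\lambda_+^{-2},1\}}{C_\rho}\min\left\{\frac{B^2p}{N+\rho^2n_{\mathcal L}},\frac{R^2p}{\rho^2n_{\mathcal L}}\right\}\right).$$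
   Context: Data model: $(X,Y)\in\mathbb{R}^p\times\mathbb{R}$ with $X\sim P_X$, $\Sigma=\mathbb{E}[XX^T]$, and $Y=X^T\beta^*+\epsilon$ with $\beta^*\in\mathbb{R}^p$, $\mathbb{E}[\epsilon|X]=0$, $\mathrm{Var}[\epsilon|X]=\sigma^2$. Write $[a]=\{1,\ldots,a\}$. There are $K$ fixed missingness patterns with observed sets $O_k\subseteq[p]$, $\cup_kO_k=[p]$. The labelled data consist, independently over $k\in[K]$, of $n_k$ i.i.d. copies of $(X_{O_k},Y)$, $n_{\mathcal L}=\sum_kn_k$; in addition there are $N\ge0$ unlabelled i.i.d. copies of $X$, independent of the labelled data. The modalities $L_1,\dots,L_L$ form the partition of $[p]$ with the smallest number $L$ of parts such that each $O_k$ is a union of parts; $h_g=\sum_kn_k\mathbb{1}_{\{L_g\subseteq O_k\}}$ and $n_{g,h}=\sum_kn_k\mathbb{1}_{\{L_g\cup L_h\subseteq O_k\}}$. Class: fix $R,B>0$, $0<\lambda_-\le\lambda_+$, $\chi\in(0,1]$, $C\ge1$, $\kappa_\epsilon\ge1$, $C_X>0$. $\mathcal{P}_{OSS}$ is the set of distributions of the full data on $\mathcal X=\prod_{k=1}^K(\mathbb{R}^{|O_k|+1})^{n_k}\times(\mathbb{R}^p)^N$ that arise when $Y=X^T\beta^*+\epsilon$ with $\mathbb{E}[\epsilon|X]=0$ and $\mathrm{Var}[\epsilon|X]=\sigma^2$, and the data consist, independently over $k\in[K]$, of $n_k$ i.i.d. copies of $(X_{O_k},Y)$ together with $N$ independent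 unlabelled i.i.d. copies of $X$, such that: $\mathbb{P}(|X^T\theta|\le t\sqrt{\theta^T\Sigma\theta})\le(Ct)^\chi$ for all $\theta\ne0$, $t>0$; $\|X\|_{\psi_2}\le C_X$; $\lambda_-\le\lambda_{\min}(\Sigma)\le\lambda_{\max}(\Sigma)\le\lambda_+$ (smallest and largest eigenvalues); $\|\beta^*\|_2\le B$; $\sigma\le R$; $\mathbb{E}[\epsilon^8]^{1/4}\le\kappa_\epsilon\sigma^2$. $\mathcal{P}_{OSS}^{Gauss}$ is the subset with $X\sim N(0,\Sigma)$, $\epsilon\sim N(0,\sigma^2)$ and $\epsilon$ independent of $X$. $\beta^*(P)$ denotes the regression parameter of the mechanism $P$. $\hat\Theta_{OSS}$ is the set of functions $\hat\beta:\mathcal X\to\mathbb{R}^p$ such that $x\mapsto\|\hat\beta(x)-\beta^*(P)\|_2$ is (Borel) measurable for every $P\in\mathcal{P}_{OSS}$; the expectation is over data drawn from $P$. Here $\|Z\|_{\psi_2}=\inf\{c>0:\mathbb{E}e^{Z^2/c^2}\le2\}$ for scalar $Z$ and $\|X\|_{\psi_2}=\sup_{\|u\|_2=1}\|u^TX\|_{\psi_2}$ for vectors.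
   Formalization: The formal theorem assumes at least two modalities (L ≥ 2); for L = 1 the condition on distinct (g,h) is vacuous, so C_ρ could be taken arbitrarily small and the bound would exceed the risk B² of the zero estimator. *)

theory Defs
  imports
    "HOL-Probability.Probability"
    "HOL-Library.Disjoint_Sets"
    "Jordan_Normal_Form.Spectral_Radius"
begin

text \<open>
  The constant in the theorem must not depend on the dimension, so the dimension is quantified
  inside the statement and cannot be a type. A vector indexed by a finite set \<open>A\<close> of naturals is an
  element of \<open>space (vec_space A)\<close>, that is, a function that is \<open>undefined\<close> outside \<open>A\<close>; the
  index set \<open>[p]\<close> becomes \<open>{..<p}\<close>. As \<open>A\<close> is finite, the product sigma-algebra is the Borel one.
\<close>

type_synonym rvec = "nat \<Rightarrow> real"

definition vec_space :: "nat set \<Rightarrow> rvec measure" where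
  "vec_space A = PiM A (\<lambda>_. borel)"

abbreviation Rp :: "nat \<Rightarrow> rvec measure" where
  "Rp p \<equiv> vec_space {..<p}"

definition dot :: "nat \<Rightarrow> rvec \<Rightarrow> rvec \<Rightarrow> real" where
  "dot p u v = (\<Sum>i<p. u i * v i)"

definition norm2 :: "nat \<Rightarrow> rvec \<Rightarrow> real" where
  "norm2 p v = L2_set v {..<p}"

definition quad_form :: "nat \<Rightarrow> real mat \<Rightarrow> rvec \<Rightarrow> real" where
  "quad_form p S u = (\<Sum>i<p. \<Sum>j<p. u i * S $$ (i, j) * u j)"

definition lambda_min :: "real mat \<Rightarrow> real" where
  "lambda_min S = Min (spectrum S)"

definition lambda_max :: "real mat \<Rightarrow> real" where
  "lambda_max S = Max (spectrum S)"

text \<open>Extended-valued, so that the infimum over the empty set is infinite.\<close>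

definition psi2_norm :: "'w measure \<Rightarrow> ('w \<Rightarrow> real) \<Rightarrow> ennreal" where
  "psi2_norm M Z =
     (INF c\<in>{c::real. 0 < c \<and> (\<integral>\<^sup>+ w. ennreal (exp ((Z w)\<^sup>2 / c\<^sup>2)) \<partial>M) \<le> 2}. ennreal c)"

definition psi2_norm_vec :: "nat \<Rightarrow> 'w measure \<Rightarrow> ('w \<Rightarrow> rvec) \<Rightarrow> ennreal" where
  "psi2_norm_vec p M X =
     (SUP u\<in>{u \<in> space (Rp p). norm2 p u = 1}. psi2_norm M (\<lambda>w. dot p u (X w)))"

text \<open>The law \<open>N(0, v)\<close>, where \<open>v \<ge> 0\<close> is the variance; it is a point mass if \<open>v = 0\<close>.\<close>

definition centred_normal :: "real \<Rightarrow> real measure" where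
  "centred_normal v =
     (if v = 0 then return borel 0 else density lborel (normal_density 0 (sqrt v)))"

text \<open>\<open>X \<sim> N(0, S)\<close>: every linear form \<open>u\<^sup>T X\<close> has law \<open>N(0, u\<^sup>T S u)\<close>.\<close>

definition centred_normal_vec :: "nat \<Rightarrow> real mat \<Rightarrow> 'w measure \<Rightarrow> ('w \<Rightarrow> rvec) \<Rightarrow> bool" where
  "centred_normal_vec p S M X \<longleftrightarrow>
     (\<forall>u \<in> space (Rp p).
        distr M borel (\<lambda>w. dot p u (X w)) = centred_normal (quad_form p S u))"

text \<open>
  A mechanism consists of the joint law of \<open>(X, \<epsilon>)\<close>, the regression parameter and the noise
  level. The response is \<open>Y = X\<^sup>T \<beta> + \<epsilon>\<close>.
\<close>

record mechanism =
  law :: "(rvec \<times> real) measure"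
  beta :: rvec
  noise_sd :: real

definition Sigma_mat :: "nat \<Rightarrow> mechanism \<Rightarrow> real mat" where
  "Sigma_mat p P = mat p p (\<lambda>(i, j). \<integral> w. fst w i * fst w j \<partial>law P)"

definition sigma_X :: "nat \<Rightarrow> mechanism \<Rightarrow> (rvec \<times> real) measure" where
  "sigma_X p P = vimage_algebra (space (law P)) fst (Rp p)"

definition cond_mean_X :: "nat \<Rightarrow> mechanism \<Rightarrow> (rvec \<times> real \<Rightarrow> real) \<Rightarrow> rvec \<times> real \<Rightarrow> real" where
  "cond_mean_X p P f = real_cond_exp (law P) (sigma_X p P) f"

definition cond_var_X :: "nat \<Rightarrow> mechanism \<Rightarrow> (rvec \<times> real \<Rightarrow> real) \<Rightarrow> rvec \<times> real \<Rightarrow> real" where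
  "cond_var_X p P f = cond_mean_X p P (\<lambda>w. (f w - cond_mean_X p P f w)\<^sup>2)"

text \<open>
  The Bochner integral of a non-integrable function is 0, hence the explicit integrability of
  \<open>\<epsilon>\<^sup>8\<close>; it entails the integrability of \<open>\<epsilon>\<close> and \<open>\<epsilon>\<^sup>2\<close>. All entries of \<open>X X\<^sup>T\<close> are
  integrable by the bound on the sub-Gaussian norm.
\<close>

definition P_OSS ::
  "nat \<Rightarrow> real \<Rightarrow> real \<Rightarrow> real \<Rightarrow> real \<Rightarrow> real \<Rightarrow> real \<Rightarrow> real \<Rightarrow> real \<Rightarrow> mechanism set" where
  "P_OSS p R B lm lp chi C kappa CX = {P.
     prob_space (law P) \<and> sets (law P) = sets (Rp p \<Otimes>\<^sub>M borel) \<and>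
     beta P \<in> space (Rp p) \<and> 0 \<le> noise_sd P \<and>
     integrable (law P) (\<lambda>w. snd w ^ 8) \<and>
     (AE w in law P. cond_mean_X p P snd w = 0) \<and>
     (AE w in law P. cond_var_X p P snd w = (noise_sd P)\<^sup>2) \<and>
     (\<forall>\<theta> \<in> space (Rp p). \<forall>t>0. (\<exists>i<p. \<theta> i \<noteq> 0) \<longrightarrow>
        measure (law P) {w \<in> space (law P).
            \<bar>dot p (fst w) \<theta>\<bar> \<le> t * sqrt (quad_form p (Sigma_mat p P) \<theta>)}
          \<le> (C * t) powr chi) \<and>
     psi2_norm_vec p (law P) fst \<le> ennreal CX \<and>
     lm \<le> lambda_min (Sigma_mat p P) \<and>
     lambda_min (Sigma_mat p P) \<le> lambda_max (Sigma_mat p P) \<and>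
     lambda_max (Sigma_mat p P) \<le> lp \<and>
     norm2 p (beta P) \<le> B \<and>
     noise_sd P \<le> R \<and>
     root 4 (\<integral> w. snd w ^ 8 \<partial>law P) \<le> kappa * (noise_sd P)\<^sup>2}"

definition P_OSS_Gauss ::
  "nat \<Rightarrow> real \<Rightarrow> real \<Rightarrow> real \<Rightarrow> real \<Rightarrow> real \<Rightarrow> real \<Rightarrow> real \<Rightarrow> real \<Rightarrow> mechanism set" where
  "P_OSS_Gauss p R B lm lp chi C kappa CX = {P \<in> P_OSS p R B lm lp chi C kappa CX.
     centred_normal_vec p (Sigma_mat p P) (law P) fst \<and>
     distr (law P) borel snd = centred_normal ((noise_sd P)\<^sup>2) \<and>
     prob_space.indep_set (law P) (sets (sigma_X p P))
       (sets (vimage_algebra (space (law P)) snd borel))}"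

text \<open>
  Pattern \<open>k < K\<close> has observed set \<open>Obs k\<close> and \<open>n k\<close> labelled observations. A data point is a
  pair of the labelled data, indexed by \<open>k\<close> and then by the observation, and the unlabelled data.
\<close>

type_synonym full_data = "(nat \<Rightarrow> nat \<Rightarrow> rvec \<times> real) \<times> (nat \<Rightarrow> rvec)"

definition labelled_law :: "nat \<Rightarrow> nat set \<Rightarrow> mechanism \<Rightarrow> (rvec \<times> real) measure" where
  "labelled_law p A P = distr (law P) (vec_space A \<Otimes>\<^sub>M borel)
     (\<lambda>(x, e). (restrict x A, dot p x (beta P) + e))"

definition unlabelled_law :: "nat \<Rightarrow> mechanism \<Rightarrow> rvec measure" where
  "unlabelled_law p P = distr (law P) (Rp p) fst"

definition data_space ::
  "nat \<Rightarrow> nat \<Rightarrow> (nat \<Rightarrow> nat set) \<Rightarrow> (nat \<Rightarrow> nat) \<Rightarrow> nat \<Rightarrow> full_data measure" where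
  "data_space p K Obs n N =
     PiM {..<K} (\<lambda>k. PiM {..<n k} (\<lambda>_. vec_space (Obs k) \<Otimes>\<^sub>M borel))
       \<Otimes>\<^sub>M PiM {..<N} (\<lambda>_. Rp p)"

definition data_law ::
  "nat \<Rightarrow> nat \<Rightarrow> (nat \<Rightarrow> nat set) \<Rightarrow> (nat \<Rightarrow> nat) \<Rightarrow> nat \<Rightarrow> mechanism \<Rightarrow> full_data measure" where
  "data_law p K Obs n N P =
     PiM {..<K} (\<lambda>k. PiM {..<n k} (\<lambda>_. labelled_law p (Obs k) P))
       \<Otimes>\<^sub>M PiM {..<N} (\<lambda>_. unlabelled_law p P)"

definition loss :: "nat \<Rightarrow> rvec \<Rightarrow> rvec \<Rightarrow> real" where
  "loss p b b' = norm2 p (\<lambda>i. b i - b' i)"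

definition estimators ::
  "nat \<Rightarrow> nat \<Rightarrow> (nat \<Rightarrow> nat set) \<Rightarrow> (nat \<Rightarrow> nat) \<Rightarrow> nat \<Rightarrow> mechanism set
     \<Rightarrow> (full_data \<Rightarrow> rvec) set" where
  "estimators p K Obs n N \<P> = {b \<in> space (data_space p K Obs n N) \<rightarrow> space (Rp p).
     \<forall>P\<in>\<P>. (\<lambda>x. loss p (b x) (beta P)) \<in> borel_measurable (data_space p K Obs n N)}"

definition risk ::
  "nat \<Rightarrow> nat \<Rightarrow> (nat \<Rightarrow> nat set) \<Rightarrow> (nat \<Rightarrow> nat) \<Rightarrow> nat
     \<Rightarrow> (full_data \<Rightarrow> rvec) \<Rightarrow> mechanism \<Rightarrow> ennreal" where
  "risk p K Obs n N b P =
     (\<integral>\<^sup>+ x. ennreal ((loss p (b x) (beta P))\<^sup>2) \<partial>data_law p K Obs n N P)"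

definition compatible_partition ::
  "nat \<Rightarrow> nat \<Rightarrow> (nat \<Rightarrow> nat set) \<Rightarrow> nat set set \<Rightarrow> bool" where
  "compatible_partition p K Obs Q \<longleftrightarrow>
     partition_on {..<p} Q \<and> (\<forall>k<K. \<exists>Q'\<subseteq>Q. Obs k = \<Union>Q')"

text \<open>The modalities are represented by the set of their parts, so \<open>L\<close> is \<open>card Ls\<close>.\<close>

definition modalities ::
  "nat \<Rightarrow> nat \<Rightarrow> (nat \<Rightarrow> nat set) \<Rightarrow> nat set set \<Rightarrow> bool" where
  "modalities p K Obs Ls \<longleftrightarrow> compatible_partition p K Obs Ls \<and>
     (\<forall>Q. compatible_partition p K Obs Q \<longrightarrow> card Ls \<le> card Q)"

definition n_lab :: "nat \<Rightarrow> (nat \<Rightarrow> nat) \<Rightarrow> nat" where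
  "n_lab K n = (\<Sum>k<K. n k)"

definition h_count :: "nat \<Rightarrow> (nat \<Rightarrow> nat set) \<Rightarrow> (nat \<Rightarrow> nat) \<Rightarrow> nat set \<Rightarrow> nat" where
  "h_count K Obs n G = (\<Sum>k<K. if G \<subseteq> Obs k then n k else 0)"

definition pair_count ::
  "nat \<Rightarrow> (nat \<Rightarrow> nat set) \<Rightarrow> (nat \<Rightarrow> nat) \<Rightarrow> nat set \<Rightarrow> nat set \<Rightarrow> nat" where
  "pair_count K Obs n G H = (\<Sum>k<K. if G \<union> H \<subseteq> Obs k then n k else 0)"

end

theory Submission
  imports Defs
begin

text \<open>
  The bound is the sum of two rates, and each of them already holds for a finite family of Gaussian
  mechanisms indexed by the subsets of a set \<open>J\<close> of coordinates. The mechanism of \<open>S\<close> has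
  \<open>\<beta>\<^sub>j = \<plusminus> d\<close> for \<open>j \<in> J\<close>, the sign telling whether \<open>j \<in> S\<close>. If putting \<open>j\<close> into \<open>S\<close> moves
  the law of the whole data set by a Kullback-Leibler divergence of at most \<open>\<kappa>\<close>, then no estimator
  can recognise that sign, and it loses of order \<open>d\<^sup>2 exp (-\<kappa>)\<close> in coordinate \<open>j\<close>. Summed over \<open>J\<close>
  this is Assouad's lemma (\<open>assouad\<close>).

  The divergence is never computed from the densities of the observed vectors. All samples are
  written as functions of a standard Gaussian vector \<open>z = (z\<^sub>0, \<dots>, z\<^sub>p)\<close>, whose last coordinate
  drives the noise. A sample that does not reveal the sign of \<open>j\<close> turns into its counterpart under
  the substitution \<open>z\<^sub>j \<leadsto> - z\<^sub>j\<close>, which preserves the Gaussian law, or does not depend on the sign at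
  all; its divergence is zero. A sample that does reveal it turns into its counterpart under a
  shear, in which two coordinates are moved by \<open>d z\<^sub>j\<close> and \<open>e z\<^sub>j\<close>; this has a density whose expected
  logarithm is \<open>-(d\<^sup>2 + e\<^sup>2)/2\<close> (\<open>distr_gauss_shear\<close>, \<open>kl_close_shear\<close>). Bounds of this type pass to
  images and to product measures, and so to the data set.

  The first rate comes from isotropic covariates, \<open>\<Sigma> = \<lambda>\<^sub>- I\<close>. If coordinate \<open>j\<close> is missing, then
  \<open>\<beta>\<^sub>j X\<^sub>j\<close> acts as symmetric noise, so only the samples that contain \<open>j\<close> are informative, and they
  number at most \<open>C\<^sub>\<rho> \<rho> n\<close> (\<open>complete_case_lower_bound\<close>).

  The second rate comes from a covariance that has to be learned. A coordinate \<open>i0\<close> in a small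
  modality has covariance \<open>\<mp> t\<close> with each \<open>j\<close> outside of that modality, and \<open>\<beta>\<^sub>j = \<plusminus> t \<beta>\<^sub>i\<^sub>0 / v\<close> is
  chosen so that \<open>Y\<close> is uncorrelated with \<open>X\<^sub>j\<close>. Then \<open>Y\<close> is a function of \<open>z\<^sub>i\<^sub>0\<close> and the noise alone,
  and the sign of \<open>\<beta>\<^sub>j\<close> is visible only in samples that contain both \<open>i0\<close> and \<open>j\<close>: the unlabelled
  ones and at most \<open>C\<^sub>\<rho> \<rho>\<^sup>2 n\<close> labelled ones (\<open>cross_covariance_lower_bound\<close>). The conditions of the
  theorem make room for the perturbation: \<open>\<Sigma>\<close> has the extreme eigenvalues \<open>v \<plusminus> t \<surd>(card J)\<close>, which
  must stay in \<open>[\<lambda>\<^sub>-, \<lambda>\<^sub>+]\<close> for the midpoint \<open>v\<close>.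
\<close>


section \<open>Experiments at bounded Kullback-Leibler divergence\<close>

text \<open>
  In applications \<open>\<mu>\<close> and \<open>\<nu>\<close> are laws of observations, and \<open>T\<close> computes an observation from a
  source of randomness \<open>M\<close>. The likelihood ratio \<open>f\<close> is taken on the source and not on the
  observations. The number \<open>- \<integral> ln f \<partial>M\<close> is the divergence of the two laws of the source; it
  dominates the one of \<open>\<mu>\<close> from \<open>\<nu>\<close>, and it is much easier to compute.
\<close>

definition kl_close :: "'a measure \<Rightarrow> real \<Rightarrow> 'b measure \<Rightarrow> 'b measure \<Rightarrow> bool" where
  "kl_close M \<kappa> \<mu> \<nu> \<longleftrightarrow> prob_space M \<and>
     (\<exists>T f. T \<in> measurable M \<mu> \<and> f \<in> borel_measurable M \<and> (\<forall>x. 0 < f x) \<and>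
        (\<integral>\<^sup>+ x. ennreal (f x) \<partial>M) = 1 \<and>
        integrable M (\<lambda>x. ln (f x)) \<and> - (\<integral> x. ln (f x) \<partial>M) \<le> \<kappa> \<and>
        \<mu> = distr M \<mu> T \<and> \<nu> = distr (density M (\<lambda>x. ennreal (f x))) \<mu> T)"

lemma prob_space_density_one:
  assumes "f \<in> borel_measurable M" "(\<integral>\<^sup>+ x. f x \<partial>M) = 1"
  shows "prob_space (density M f)"
  using assms by (intro prob_spaceI) (simp add: emeasure_density cong: nn_integral_cong)

lemma PiM_distr_family:
  fixes M :: "'i \<Rightarrow> 'a measure" and N :: "'i \<Rightarrow> 'b measure"
  assumes I: "finite I" and M: "\<And>i. prob_space (M i)"
    and T[measurable]: "\<And>i. T i \<in> measurable (M i) (N i)"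
  shows "PiM I (\<lambda>i. distr (M i) (N i) (T i)) = distr (PiM I M) (PiM I N) (\<lambda>x. \<lambda>i\<in>I. T i (x i))"
proof -
  interpret P: product_prob_space M by (intro product_prob_spaceI M)
  interpret Q: product_prob_space "\<lambda>i. distr (M i) (N i) (T i)"
    by (intro product_prob_spaceI prob_space.prob_space_distr M T)
  have [measurable]: "(\<lambda>x. \<lambda>i\<in>I. T i (x i)) \<in> measurable (PiM I M) (PiM I N)"
    by (intro measurable_restrict) simp
  have "distr (PiM I M) (PiM I N) (\<lambda>x. \<lambda>i\<in>I. T i (x i)) = PiM I (\<lambda>i. distr (M i) (N i) (T i))"
  proof (rule Q.PiM_eqI[OF I])
    show "sets (distr (PiM I M) (PiM I N) (\<lambda>x. \<lambda>i\<in>I. T i (x i))) =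
        sets (Pi\<^sub>M I (\<lambda>i. distr (M i) (N i) (T i)))"
      by (simp cong: sets_PiM_cong)
    fix A assume A: "\<And>i. i \<in> I \<Longrightarrow> A i \<in> sets (distr (M i) (N i) (T i))"
    then have A': "\<And>i. i \<in> I \<Longrightarrow> A i \<in> sets (N i)" by simp
    have "(\<lambda>x. \<lambda>i\<in>I. T i (x i)) -` Pi\<^sub>E I A \<inter> space (PiM I M)
        = Pi\<^sub>E I (\<lambda>i. T i -` A i \<inter> space (M i))"
      by (auto simp: space_PiM PiE_iff)
    then show "emeasure (distr (PiM I M) (PiM I N) (\<lambda>x. \<lambda>i\<in>I. T i (x i))) (Pi\<^sub>E I A)
        = (\<Prod>i\<in>I. emeasure (distr (M i) (N i) (T i)) (A i))"
      using A' I
      by (subst emeasure_distr) (auto intro!: sets_PiM_I_finite prod.cong P.emeasure_PiM[THEN trans]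
          simp: emeasure_distr)
  qed
  then show ?thesis by simp
qed

lemma PiM_density_family:
  fixes M :: "'i \<Rightarrow> 'a measure" and f :: "'i \<Rightarrow> 'a \<Rightarrow> ennreal"
  assumes I: "finite I" and M: "\<And>i. prob_space (M i)"
    and f[measurable]: "\<And>i. f i \<in> borel_measurable (M i)"
    and f1: "\<And>i. (\<integral>\<^sup>+ x. f i x \<partial>M i) = 1"
  shows "PiM I (\<lambda>i. density (M i) (f i)) = density (PiM I M) (\<lambda>x. \<Prod>i\<in>I. f i (x i))"
proof -
  interpret P: product_prob_space M by (intro product_prob_spaceI M)
  interpret Q: product_prob_space "\<lambda>i. density (M i) (f i)"
    by (intro product_prob_spaceI prob_space_density_one f f1)
  have "density (PiM I M) (\<lambda>x. \<Prod>i\<in>I. f i (x i)) = PiM I (\<lambda>i. density (M i) (f i))"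
  proof (rule Q.PiM_eqI[OF I])
    show "sets (density (PiM I M) (\<lambda>x. \<Prod>i\<in>I. f i (x i))) = sets (Pi\<^sub>M I (\<lambda>i. density (M i) (f i)))"
      by (simp cong: sets_PiM_cong)
    fix A assume A: "\<And>i. i \<in> I \<Longrightarrow> A i \<in> sets (density (M i) (f i))"
    then have A'[measurable]: "\<And>i. i \<in> I \<Longrightarrow> A i \<in> sets (M i)" by simp
    have [measurable]: "Pi\<^sub>E I A \<in> sets (PiM I M)" using I A' by (intro sets_PiM_I_finite)
    have ind: "(\<Prod>i\<in>I. f i (x i)) * indicator (Pi\<^sub>E I A) x = (\<Prod>i\<in>I. f i (x i) * indicator (A i) (x i))"
      if "x \<in> space (PiM I M)" for x
    proof (cases "x \<in> Pi\<^sub>E I A")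
      case True then show ?thesis by (auto simp: PiE_iff intro!: prod.cong)
    next
      case False
      with that obtain i where "i \<in> I" "x i \<notin> A i" by (auto simp: space_PiM PiE_iff)
      then have "(\<Prod>i\<in>I. f i (x i) * indicator (A i) (x i)) = 0"
        using I by (intro prod_zero) (auto intro!: bexI[of _ i])
      with False show ?thesis by simp
    qed
    have "emeasure (density (PiM I M) (\<lambda>x. \<Prod>i\<in>I. f i (x i))) (Pi\<^sub>E I A)
        = (\<integral>\<^sup>+ x. (\<Prod>i\<in>I. f i (x i) * indicator (A i) (x i)) \<partial>PiM I M)"
      by (subst emeasure_density) (auto intro!: nn_integral_cong simp: ind)
    also have "\<dots> = (\<Prod>i\<in>I. \<integral>\<^sup>+ x. f i x * indicator (A i) x \<partial>M i)"
      by (rule P.product_nn_integral_prod[OF I]) measurable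
    also have "\<dots> = (\<Prod>i\<in>I. emeasure (density (M i) (f i)) (A i))"
      by (intro prod.cong) (auto simp: emeasure_density)
    finally show "emeasure (density (PiM I M) (\<lambda>x. \<Prod>i\<in>I. f i (x i))) (Pi\<^sub>E I A)
        = (\<Prod>i\<in>I. emeasure (density (M i) (f i)) (A i))" .
  qed
  then show ?thesis by simp
qed

text \<open>
  Divergences add up over independent samples: the product of the likelihood ratios is a likelihood
  ratio for the product of the sources, and its logarithm is a sum.
\<close>

lemma kl_close_PiM:
  fixes M :: "'i \<Rightarrow> 'a measure" and \<mu> \<nu> :: "'i \<Rightarrow> 'b measure"
  assumes I: "finite I" and cl: "\<And>i. kl_close (M i) (\<kappa> i) (\<mu> i) (\<nu> i)"
  shows "kl_close (PiM I M) (\<Sum>i\<in>I. \<kappa> i) (PiM I \<mu>) (PiM I \<nu>)"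
proof -
  have M: "prob_space (M i)" for i using cl by (simp add: kl_close_def)
  have "\<exists>T f. T \<in> measurable (M i) (\<mu> i) \<and> f \<in> borel_measurable (M i) \<and> (\<forall>x. 0 < f x) \<and>
        (\<integral>\<^sup>+ x. ennreal (f x) \<partial>M i) = 1 \<and>
        integrable (M i) (\<lambda>x. ln (f x)) \<and> - (\<integral> x. ln (f x) \<partial>M i) \<le> \<kappa> i \<and>
        \<mu> i = distr (M i) (\<mu> i) T \<and> \<nu> i = distr (density (M i) (\<lambda>x. ennreal (f x))) (\<mu> i) T" for i
    using cl[of i] by (simp add: kl_close_def)
  then obtain T f where
    T[measurable]: "\<And>i. T i \<in> measurable (M i) (\<mu> i)"
    and f[measurable]: "\<And>i. f i \<in> borel_measurable (M i)"
    and fpos: "\<And>i x. 0 < f i x"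
    and f1: "\<And>i. (\<integral>\<^sup>+ x. ennreal (f i x) \<partial>M i) = 1"
    and fint: "\<And>i. integrable (M i) (\<lambda>x. ln (f i x))"
    and fk: "\<And>i. - (\<integral> x. ln (f i x) \<partial>M i) \<le> \<kappa> i"
    and mu: "\<And>i. \<mu> i = distr (M i) (\<mu> i) (T i)"
    and nu: "\<And>i. \<nu> i = distr (density (M i) (\<lambda>x. ennreal (f i x))) (\<mu> i) (T i)"
    by metis
  interpret P: product_prob_space M by (intro product_prob_spaceI M)
  define F where "F x = (\<Prod>i\<in>I. f i (x i))" for x
  define TT where "TT x = (\<lambda>i\<in>I. T i (x i))" for x
  have [measurable]: "F \<in> borel_measurable (PiM I M)" unfolding F_def by measurable
  have [measurable]: "TT \<in> measurable (PiM I M) (PiM I \<mu>)"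
    unfolding TT_def by (intro measurable_restrict) simp
  have Fe: "ennreal (F x) = (\<Prod>i\<in>I. ennreal (f i (x i)))" for x
    using fpos less_imp_le unfolding F_def by (subst prod_ennreal) auto
  have F1: "(\<integral>\<^sup>+ x. ennreal (F x) \<partial>PiM I M) = 1"
    unfolding Fe by (subst P.product_nn_integral_prod[OF I]) (auto simp: f1)
  have lnF: "ln (F x) = (\<Sum>i\<in>I. ln (f i (x i)))" for x
    unfolding F_def using I fpos by (intro ln_prod) (auto simp: less_imp_neq[THEN not_sym])
  have comp: "distr (PiM I M) (M i) (\<lambda>x. x i) = M i" if "i \<in> I" for i
    using P.PiM_component that by simp
  have int: "integrable (PiM I M) (\<lambda>x. ln (f i (x i)))" if "i \<in> I" for i
    using that integrable_distr[of "\<lambda>x. x i" "PiM I M" "M i" "\<lambda>x. ln (f i x)"] fint[of i] comp[OF that]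
    by simp
  have val: "(\<integral> x. ln (f i (x i)) \<partial>PiM I M) = (\<integral> x. ln (f i x) \<partial>M i)" if "i \<in> I" for i
    using that integral_distr[of "\<lambda>x. x i" "PiM I M" "M i" "\<lambda>x. ln (f i x)"] comp[OF that]
    by simp
  show ?thesis unfolding kl_close_def
  proof (intro conjI exI[of _ TT] exI[of _ F])
    show "prob_space (PiM I M)" by (intro prob_space_PiM M)
    show "\<forall>x. 0 < F x" using fpos by (auto simp: F_def intro!: prod_pos)
    show "integrable (PiM I M) (\<lambda>x. ln (F x))" unfolding lnF using int by auto
    have "(\<integral> x. ln (F x) \<partial>PiM I M) = (\<Sum>i\<in>I. \<integral> x. ln (f i x) \<partial>M i)"
      unfolding lnF using int val by (subst Bochner_Integration.integral_sum) auto
    then show "- (\<integral> x. ln (F x) \<partial>PiM I M) \<le> (\<Sum>i\<in>I. \<kappa> i)"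
      using fk by (simp add: sum_negf[symmetric] sum_mono)
    have "PiM I \<mu> = PiM I (\<lambda>i. distr (M i) (\<mu> i) (T i))" using mu by (intro PiM_cong) auto
    also have "\<dots> = distr (PiM I M) (PiM I \<mu>) TT"
      unfolding TT_def[abs_def] by (rule PiM_distr_family[OF I M T])
    finally show "PiM I \<mu> = distr (PiM I M) (PiM I \<mu>) TT" .
    have T': "T i \<in> measurable (density (M i) (\<lambda>x. ennreal (f i x))) (\<mu> i)" for i by simp
    have "PiM I \<nu> = PiM I (\<lambda>i. distr (density (M i) (\<lambda>x. ennreal (f i x))) (\<mu> i) (T i))"
      using nu by (intro PiM_cong) auto
    also have "\<dots> = distr (PiM I (\<lambda>i. density (M i) (\<lambda>x. ennreal (f i x)))) (PiM I \<mu>) TT"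
      unfolding TT_def[abs_def]
      by (rule PiM_distr_family[OF I _ T']) (intro prob_space_density_one, auto simp: f1)
    also have "PiM I (\<lambda>i. density (M i) (\<lambda>x. ennreal (f i x)))
        = density (PiM I M) (\<lambda>x. ennreal (F x))"
      unfolding Fe by (rule PiM_density_family[OF I M]) (auto simp: f1)
    finally show "PiM I \<nu> = distr (density (PiM I M) (\<lambda>x. ennreal (F x))) (PiM I \<mu>) TT" .
  qed (use F1 in auto)
qed

lemma kl_close_prob_space:
  assumes "kl_close M \<kappa> \<mu> \<nu>"
  shows "prob_space \<mu>" "prob_space \<nu>"
proof -
  from assms obtain T f where *: "prob_space M" "T \<in> measurable M \<mu>" "f \<in> borel_measurable M"
    "(\<integral>\<^sup>+ x. ennreal (f x) \<partial>M) = 1" "\<mu> = distr M \<mu> T"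
    "\<nu> = distr (density M (\<lambda>x. ennreal (f x))) \<mu> T" unfolding kl_close_def by blast
  show "prob_space \<mu>" by (subst *(5)) (rule prob_space.prob_space_distr[OF *(1,2)])
  have "prob_space (density M (\<lambda>x. ennreal (f x)))" using *(3,4) by (intro prob_space_density_one) auto
  from prob_space.prob_space_distr[OF this, of T \<mu>] show "prob_space \<nu>"
    by (subst *(6)) (use *(2) in simp)
qed

lemma kl_close_pair:
  assumes "kl_close M1 \<kappa>1 \<mu>1 \<nu>1" "kl_close M2 \<kappa>2 \<mu>2 \<nu>2"
  shows "kl_close (M1 \<Otimes>\<^sub>M M2) (\<kappa>1 + \<kappa>2) (\<mu>1 \<Otimes>\<^sub>M \<mu>2) (\<nu>1 \<Otimes>\<^sub>M \<nu>2)"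
proof -
  from assms(1) obtain T1 f1 where M1: "prob_space M1"
    and T1[measurable]: "T1 \<in> measurable M1 \<mu>1"
    and f1[measurable]: "f1 \<in> borel_measurable M1"
    and pos1: "\<And>x. 0 < f1 x" and one1: "(\<integral>\<^sup>+ x. ennreal (f1 x) \<partial>M1) = 1"
    and int1: "integrable M1 (\<lambda>x. ln (f1 x))" and k1: "- (\<integral> x. ln (f1 x) \<partial>M1) \<le> \<kappa>1"
    and mu1: "\<mu>1 = distr M1 \<mu>1 T1" and nu1: "\<nu>1 = distr (density M1 (\<lambda>x. ennreal (f1 x))) \<mu>1 T1"
    unfolding kl_close_def by blast
  from assms(2) obtain T2 f2 where M2: "prob_space M2"
    and T2[measurable]: "T2 \<in> measurable M2 \<mu>2"
    and f2[measurable]: "f2 \<in> borel_measurable M2"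
    and pos2: "\<And>x. 0 < f2 x" and one2: "(\<integral>\<^sup>+ x. ennreal (f2 x) \<partial>M2) = 1"
    and int2: "integrable M2 (\<lambda>x. ln (f2 x))" and k2: "- (\<integral> x. ln (f2 x) \<partial>M2) \<le> \<kappa>2"
    and mu2: "\<mu>2 = distr M2 \<mu>2 T2" and nu2: "\<nu>2 = distr (density M2 (\<lambda>x. ennreal (f2 x))) \<mu>2 T2"
    unfolding kl_close_def by blast
  interpret M1: prob_space M1 by fact
  interpret M2: prob_space M2 by fact
  interpret pair_prob_space M1 M2 ..
  have d1: "prob_space (density M1 (\<lambda>x. ennreal (f1 x)))"
    and d2: "prob_space (density M2 (\<lambda>x. ennreal (f2 x)))"
    using one1 one2 by (auto intro!: prob_space_density_one)
  interpret D1: prob_space "density M1 (\<lambda>x. ennreal (f1 x))" by fact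
  interpret D2: prob_space "density M2 (\<lambda>x. ennreal (f2 x))" by fact
  have p2: "prob_space \<mu>2" "prob_space \<nu>2"
    using kl_close_prob_space[OF assms(2)] by auto
  define F where "F z = f1 (fst z) * f2 (snd z)" for z
  define TT where "TT z = (T1 (fst z), T2 (snd z))" for z
  have [measurable]: "F \<in> borel_measurable (M1 \<Otimes>\<^sub>M M2)" unfolding F_def by measurable
  have [measurable]: "TT \<in> measurable (M1 \<Otimes>\<^sub>M M2) (\<mu>1 \<Otimes>\<^sub>M \<mu>2)" unfolding TT_def by measurable
  have lnF: "ln (F z) = ln (f1 (fst z)) + ln (f2 (snd z))" for z
    using pos1[of "fst z"] pos2[of "snd z"] by (simp add: F_def ln_mult)
  have c1: "distr (M1 \<Otimes>\<^sub>M M2) M1 fst = M1" by (rule M2.distr_pair_fst)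
  have c2: "distr (M1 \<Otimes>\<^sub>M M2) M2 snd = M2"
  proof (rule measure_eqI)
    fix A assume "A \<in> sets (distr (M1 \<Otimes>\<^sub>M M2) M2 snd)"
    then have A: "A \<in> sets M2" by simp
    have "snd -` A \<inter> space (M1 \<Otimes>\<^sub>M M2) = space M1 \<times> A"
      using sets.sets_into_space[OF A] by (auto simp: space_pair_measure)
    with A show "emeasure (distr (M1 \<Otimes>\<^sub>M M2) M2 snd) A = emeasure M2 A"
      by (simp add: emeasure_distr M2.emeasure_pair_measure_Times M1.emeasure_space_1)
  qed simp
  have i1: "integrable (M1 \<Otimes>\<^sub>M M2) (\<lambda>z. ln (f1 (fst z)))"
    using integrable_distr[of fst "M1 \<Otimes>\<^sub>M M2" M1 "\<lambda>x. ln (f1 x)"] int1 c1 by simp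
  have i2: "integrable (M1 \<Otimes>\<^sub>M M2) (\<lambda>z. ln (f2 (snd z)))"
    using integrable_distr[of snd "M1 \<Otimes>\<^sub>M M2" M2 "\<lambda>x. ln (f2 x)"] int2 c2 by simp
  have v1: "(\<integral>z. ln (f1 (fst z)) \<partial>(M1 \<Otimes>\<^sub>M M2)) = (\<integral>x. ln (f1 x) \<partial>M1)"
    using integral_distr[of fst "M1 \<Otimes>\<^sub>M M2" M1 "\<lambda>x. ln (f1 x)"] c1 by simp
  have v2: "(\<integral>z. ln (f2 (snd z)) \<partial>(M1 \<Otimes>\<^sub>M M2)) = (\<integral>x. ln (f2 x) \<partial>M2)"
    using integral_distr[of snd "M1 \<Otimes>\<^sub>M M2" M2 "\<lambda>x. ln (f2 x)"] c2 by simp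
  have Fe: "ennreal (F z) = ennreal (f1 (fst z)) * ennreal (f2 (snd z))" for z
    using pos1 pos2 by (simp add: F_def ennreal_mult less_imp_le)
  have dens: "density M1 (\<lambda>x. ennreal (f1 x)) \<Otimes>\<^sub>M density M2 (\<lambda>x. ennreal (f2 x))
      = density (M1 \<Otimes>\<^sub>M M2) (\<lambda>z. ennreal (F z))"
    by (subst pair_measure_density)
       (auto simp: Fe case_prod_beta' M2.sigma_finite_measure_axioms D2.sigma_finite_measure_axioms)
  have TTeq: "TT = (\<lambda>(x, y). (T1 x, T2 y))" by (auto simp: TT_def)
  show ?thesis unfolding kl_close_def
  proof (intro conjI exI[of _ TT] exI[of _ F])
    show "prob_space (M1 \<Otimes>\<^sub>M M2)" by (rule prob_space_pair[OF M1 M2])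
    show "\<forall>x. 0 < F x" using pos1 pos2 by (simp add: F_def)
    show "(\<integral>\<^sup>+ z. ennreal (F z) \<partial>(M1 \<Otimes>\<^sub>M M2)) = 1"
    proof -
      interpret DD: pair_prob_space "density M1 (\<lambda>x. ennreal (f1 x))" "density M2 (\<lambda>x. ennreal (f2 x))" ..
      have "emeasure (density (M1 \<Otimes>\<^sub>M M2) (\<lambda>z. ennreal (F z))) (space (M1 \<Otimes>\<^sub>M M2)) = 1"
        using DD.emeasure_space_1 unfolding dens by simp
      then show ?thesis by (simp add: emeasure_density cong: nn_integral_cong)
    qed
    show "integrable (M1 \<Otimes>\<^sub>M M2) (\<lambda>z. ln (F z))" unfolding lnF using i1 i2 by simp
    show "- (\<integral> z. ln (F z) \<partial>(M1 \<Otimes>\<^sub>M M2)) \<le> \<kappa>1 + \<kappa>2"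
      unfolding lnF using i1 i2 v1 v2 k1 k2 by simp
    have s: "sigma_finite_measure (distr M2 \<mu>2 T2)"
      unfolding mu2[symmetric] by (rule prob_space_imp_sigma_finite[OF p2(1)])
    show "\<mu>1 \<Otimes>\<^sub>M \<mu>2 = distr (M1 \<Otimes>\<^sub>M M2) (\<mu>1 \<Otimes>\<^sub>M \<mu>2) TT"
      using pair_measure_distr[OF T1 T2 s] unfolding TTeq mu1[symmetric] mu2[symmetric] .
    have s': "sigma_finite_measure (distr (density M2 (\<lambda>x. ennreal (f2 x))) \<mu>2 T2)"
      unfolding nu2[symmetric] by (rule prob_space_imp_sigma_finite[OF p2(2)])
    have "T1 \<in> measurable (density M1 (\<lambda>x. ennreal (f1 x))) \<mu>1"
      "T2 \<in> measurable (density M2 (\<lambda>x. ennreal (f2 x))) \<mu>2" by simp_all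
    from pair_measure_distr[OF this s']
    show "\<nu>1 \<Otimes>\<^sub>M \<nu>2 = distr (density (M1 \<Otimes>\<^sub>M M2) (\<lambda>z. ennreal (F z))) (\<mu>1 \<Otimes>\<^sub>M \<mu>2) TT"
      unfolding TTeq dens nu1[symmetric] nu2[symmetric] .
  qed auto
qed

text \<open>
  The two-point method, with \<open>u\<close> and \<open>v\<close> the losses under the two hypotheses. As \<open>\<nu>\<close> has the
  likelihood ratio \<open>f\<close>, the sum of the risks is at least \<open>c \<integral> min 1 f\<close>. The integral is bounded by
  \<open>exp (-\<kappa>) / 2\<close> in the manner of Bretagnolle and Huber: since \<open>min 1 f \<cdot> max 1 f = f\<close> and
  \<open>\<integral> max 1 f \<le> 2\<close>, the Cauchy-Schwarz inequality compares it with the affinity \<open>\<integral> \<surd>f\<close>, and Jensen's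
  inequality bounds the affinity below by \<open>exp (\<integral> ln f / 2)\<close>.
\<close>

lemma kl_close_two_point:
  assumes "kl_close M \<kappa> \<mu> \<nu>"
    and u[measurable]: "u \<in> borel_measurable \<mu>" and v[measurable]: "v \<in> borel_measurable \<mu>"
    and nn: "\<And>x. 0 \<le> u x" "\<And>x. 0 \<le> v x" and c: "0 \<le> c" "\<And>x. x \<in> space \<mu> \<Longrightarrow> c \<le> u x + v x"
  shows "ennreal (c / 2 * exp (- \<kappa>)) \<le> (\<integral>\<^sup>+ x. ennreal (u x) \<partial>\<mu>) + (\<integral>\<^sup>+ x. ennreal (v x) \<partial>\<nu>)"
proof -
  from assms(1) obtain T f where M: "prob_space M"
    and T[measurable]: "T \<in> measurable M \<mu>"
    and f[measurable]: "f \<in> borel_measurable M"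
    and pos: "\<And>x. 0 < f x" and one: "(\<integral>\<^sup>+ x. ennreal (f x) \<partial>M) = 1"
    and int: "integrable M (\<lambda>x. ln (f x))" and k: "- (\<integral> x. ln (f x) \<partial>M) \<le> \<kappa>"
    and mu: "\<mu> = distr M \<mu> T" and nu: "\<nu> = distr (density M (\<lambda>x. ennreal (f x))) \<mu> T"
    unfolding kl_close_def by blast
  interpret prob_space M by fact
  have fint: "integrable M f"
    using one pos by (intro integrableI_nonneg) (auto simp: less_imp_le)
  have fI: "(\<integral>x. f x \<partial>M) = 1"
    using nn_integral_eq_integral[OF fint] one pos by (simp add: less_imp_le ennreal_eq_1)
  have mint: "integrable M (\<lambda>x. min 1 (f x))"
    using pos by (intro integrable_const_bound[of _ 1]) (auto simp: less_imp_le)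
  have Mint: "integrable M (\<lambda>x. max 1 (f x))"
    using fint by auto
  have mm: "min 1 (f x) + max 1 (f x) = 1 + f x" for x by simp
  have "(\<integral>x. min 1 (f x) \<partial>M) + (\<integral>x. max 1 (f x) \<partial>M) = (\<integral>x. 1 + f x \<partial>M)"
    using mint Mint by (subst Bochner_Integration.integral_add[symmetric]) (auto simp: mm)
  also have "\<dots> = 2" using fint fI by (subst Bochner_Integration.integral_add) (auto simp: prob_space)
  finally have sum2: "(\<integral>x. min 1 (f x) \<partial>M) + (\<integral>x. max 1 (f x) \<partial>M) = 2" .
  define m where "m = (\<integral>x. min 1 (f x) \<partial>M)"
  have m0: "0 \<le> m" unfolding m_def using pos by (intro integral_nonneg_AE) (auto simp: less_imp_le)
  define L where "L = (\<integral>x. ln (f x) \<partial>M)"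
  have key: "exp L / 2 \<le> m"
  proof -
    define s where "s = exp (L / 2)"
    have sp: "0 < s" by (simp add: s_def)
    \<comment> \<open>Both inequalities at once, pointwise: the tangent of \<open>exp\<close> at \<open>L / 2\<close> replaces Jensen's
      inequality, and the weighted arithmetic-geometric mean inequality replaces Cauchy-Schwarz.\<close>
    have pt: "2 * s * (1 + (ln (f x) - L) / 2) \<le> t * min 1 (f x) + max 1 (f x) / t" if t: "0 < t" for x t
    proof -
      have "1 + (ln (f x) - L) / 2 \<le> exp ((ln (f x) - L) / 2)" by (rule exp_ge_add_one_self)
      then have "s * (1 + (ln (f x) - L) / 2) \<le> s * exp ((ln (f x) - L) / 2)"
        using sp by (intro mult_left_mono) auto
      also have "\<dots> = exp (ln (f x) / 2)"
        unfolding s_def exp_add[symmetric] by (simp add: field_simps)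
      also have "\<dots> = sqrt (f x)" using pos[of x] by (simp add: ln_sqrt[symmetric])
      finally have 1: "2 * s * (1 + (ln (f x) - L) / 2) \<le> 2 * sqrt (f x)" by simp
      have "sqrt (f x) = sqrt (t * min 1 (f x)) * sqrt (max 1 (f x) / t)"
        using t pos[of x] by (simp add: real_sqrt_mult[symmetric] min_def max_def)
      moreover have "0 \<le> (sqrt (t * min 1 (f x)) - sqrt (max 1 (f x) / t))\<^sup>2" by simp
      ultimately have "2 * sqrt (f x) \<le> t * min 1 (f x) + max 1 (f x) / t"
        using t pos[of x] by (simp add: power2_diff less_imp_le)
      with 1 show ?thesis by simp
    qed
    have t: "2 * s \<le> t * m + (2 - m) / t" if "0 < t" for t
    proof -
      have "(\<integral>x. 2 * s * (1 + (ln (f x) - L) / 2) \<partial>M)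
          \<le> (\<integral>x. t * min 1 (f x) + max 1 (f x) / t \<partial>M)"
        using pt[OF that] int mint Mint by (intro integral_mono) auto
      also have "\<dots> = t * m + (2 - m) / t"
        using mint Mint sum2 by (simp add: m_def)
      also have "(\<integral>x. 2 * s * (1 + (ln (f x) - L) / 2) \<partial>M) = 2 * s"
        using int by (simp add: L_def prob_space)
      finally show ?thesis .
    qed
    \<comment> \<open>This weight is nearly optimal and keeps the inequality linear in \<open>m\<close>.\<close>
    have "2 * s \<le> 2 / s * m + (2 - m) / (2 / s)" using sp by (intro t) simp
    moreover have "(2 - m) / (2 / s) = s - m * s / 2" using sp by (simp add: field_simps)
    moreover have "0 \<le> m * s" using m0 sp by simp
    moreover have "2 / s * m = 2 * m / s" by simp
    ultimately have "s \<le> 2 * m / s" by linarith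
    then have "s * s \<le> 2 * m" using sp by (simp add: field_simps)
    moreover have "s * s = exp L" unfolding s_def exp_add[symmetric] by simp
    ultimately show ?thesis by simp
  qed
  have "exp (- \<kappa>) \<le> exp L" using k by (simp add: L_def)
  with key have "exp (- \<kappa>) / 2 \<le> m" by linarith
  then have "ennreal (c / 2 * exp (- \<kappa>)) \<le> ennreal (c * m)"
    using c(1) mult_left_mono[of "exp (- \<kappa>) / 2" m c] by (intro ennreal_leI) simp
  also have "\<dots> = (\<integral>\<^sup>+ x. ennreal (c * min 1 (f x)) \<partial>M)"
    using c(1) pos mint by (subst nn_integral_eq_integral) (auto simp: m_def less_imp_le)
  also have "\<dots> \<le> (\<integral>\<^sup>+ x. ennreal (u (T x)) + ennreal (f x) * ennreal (v (T x)) \<partial>M)"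
  proof (intro nn_integral_mono)
    fix x assume "x \<in> space M"
    then have "T x \<in> space \<mu>" by (rule measurable_space[OF T])
    then have "c \<le> u (T x) + v (T x)" by (rule c(2))
    then have "c * min 1 (f x) \<le> (u (T x) + v (T x)) * min 1 (f x)"
      using pos[of x] by (intro mult_right_mono) auto
    also have "\<dots> = u (T x) * min 1 (f x) + v (T x) * min 1 (f x)" by (simp add: distrib_right)
    also have "\<dots> \<le> u (T x) * 1 + v (T x) * f x"
      using nn by (intro add_mono mult_left_mono) auto
    finally show "ennreal (c * min 1 (f x)) \<le> ennreal (u (T x)) + ennreal (f x) * ennreal (v (T x))"
      using nn pos[of x] by (simp add: ennreal_mult[symmetric] ennreal_plus[symmetric] ennreal_leI less_imp_le mult.commute del: ennreal_plus)
  qed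
  also have "\<dots> = (\<integral>\<^sup>+ x. ennreal (u (T x)) \<partial>M) + (\<integral>\<^sup>+ x. ennreal (f x) * ennreal (v (T x)) \<partial>M)"
    by (rule nn_integral_add) auto
  also have "(\<integral>\<^sup>+ x. ennreal (u (T x)) \<partial>M) = (\<integral>\<^sup>+ x. ennreal (u x) \<partial>\<mu>)"
    by (subst mu, subst nn_integral_distr) auto
  also have "(\<integral>\<^sup>+ x. ennreal (f x) * ennreal (v (T x)) \<partial>M) = (\<integral>\<^sup>+ x. ennreal (v x) \<partial>\<nu>)"
    by (subst nu, subst nn_integral_distr) (auto simp: nn_integral_density)
  finally show ?thesis .
qed

section \<open>Standard Gaussian vectors\<close>

definition std_normal :: "real measure" where
  "std_normal = density lborel (\<lambda>x. ennreal (std_normal_density x))"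

text \<open>
  A standard Gaussian vector is the common source of randomness of one sample.
\<close>

definition gauss :: "nat \<Rightarrow> rvec measure" where
  "gauss m = PiM {..<m} (\<lambda>_. std_normal)"

lemma prob_space_std_normal: "prob_space std_normal"
  unfolding std_normal_def by (rule prob_space_normal_density) simp

lemma sets_std_normal[measurable_cong, simp]: "sets std_normal = sets borel"
  by (simp add: std_normal_def)

lemma space_std_normal[simp]: "space std_normal = UNIV"
  by (simp add: std_normal_def)

lemma sets_gauss[measurable_cong]: "sets (gauss m) = sets (Rp m)"
  unfolding gauss_def vec_space_def by (intro sets_PiM_cong) auto

lemma space_gauss: "space (gauss m) = space (Rp m)"
  by (rule sets_eq_imp_space_eq[OF sets_gauss])

lemma prob_space_gauss: "prob_space (gauss m)"
  unfolding gauss_def by (intro prob_space_PiM prob_space_std_normal)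

lemma component_measurable_gauss[measurable (raw)]:
  "i < m \<Longrightarrow> (\<lambda>z. z i) \<in> borel_measurable (gauss m)"
  unfolding gauss_def
  using measurable_component_singleton[of i "{..<m}" "\<lambda>_. std_normal"] by simp

lemma has_integral_std_normal_even:
  "has_bochner_integral std_normal (\<lambda>x. x ^ (2 * k)) (fact (2 * k) / (2 ^ k * fact k))"
  unfolding std_normal_def
  using std_normal_moment_even[of k]
  by (intro has_bochner_integral_density) auto

lemma has_integral_std_normal_1: "has_bochner_integral std_normal (\<lambda>x. x) 0"
  unfolding std_normal_def
  using std_normal_moment_odd[of 0]
  by (intro has_bochner_integral_density) auto

lemma centred_normal_eq_distr:
  assumes "0 \<le> v"
  shows "centred_normal v = distr std_normal borel (\<lambda>x. sqrt v * x)"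
proof (cases "v = 0")
  case True
  interpret prob_space std_normal by (rule prob_space_std_normal)
  show ?thesis using True by (simp add: centred_normal_def distr_const)
next
  case False
  interpret prob_space std_normal by (rule prob_space_std_normal)
  have "distributed std_normal lborel (\<lambda>x. x) (\<lambda>x. ennreal (std_normal_density x))"
    unfolding distributed_def by (simp add: std_normal_def distr_id2)
  from normal_density_affine[OF this, of "sqrt v" 0]
  have "distr std_normal lborel (\<lambda>x. sqrt v * x) = density lborel (normal_density 0 (sqrt v))"
    using assms False by (simp add: distributed_def)
  moreover have "distr std_normal lborel (\<lambda>x. sqrt v * x) = distr std_normal borel (\<lambda>x. sqrt v * x)"
    by (rule distr_cong) auto
  ultimately show ?thesis using False by (simp add: centred_normal_def)
qed

lemma gauss_component: "i < m \<Longrightarrow> distr (gauss m) std_normal (\<lambda>z. z i) = std_normal"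
  unfolding gauss_def
  using distr_PiM_component[of "{..<m}" "\<lambda>_. std_normal" i] prob_space_std_normal by simp

lemma indep_vars_gauss: "prob_space.indep_vars (gauss m) (\<lambda>_. borel) (\<lambda>i z. z i) {..<m}"
proof (cases "m = 0")
  case True
  then show ?thesis
    by (simp add: prob_space.indep_vars_def[OF prob_space_gauss] prob_space.indep_sets_def[OF prob_space_gauss])
next
  case False
  interpret prob_space "gauss m" by (rule prob_space_gauss)
  have c: "distr (gauss m) borel (\<lambda>z. z i) = std_normal" if "i < m" for i
    using gauss_component[OF that] by (simp cong: distr_cong)
  have "distr (gauss m) (PiM {..<m} (\<lambda>_. borel)) (\<lambda>x. \<lambda>i\<in>{..<m}. x i)
      = distr (gauss m) (gauss m) (\<lambda>x. x)"
    by (rule distr_cong)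
      (auto simp: gauss_def space_PiM PiE_iff extensional_restrict sets_gauss[unfolded vec_space_def]
        intro!: sets_PiM_cong)
  also have "\<dots> = gauss m" by (rule distr_id2) simp
  also have "\<dots> = PiM {..<m} (\<lambda>i. distr (gauss m) borel (\<lambda>z. z i))"
    unfolding gauss_def by (rule PiM_cong) (use c in \<open>auto simp: gauss_def\<close>)
  finally show ?thesis
    using False by (subst indep_vars_iff_distr_eq_PiM') (auto simp: lessThan_empty_iff)
qed

text \<open>
  Coefficients that vanish have to be separated: they contribute a point mass, which is not a
  normal density, and the sum may even be constant.
\<close>

lemma distr_gauss_linear:
  "distr (gauss m) borel (\<lambda>z. \<Sum>l<m. a l * z l) = centred_normal (\<Sum>l<m. (a l)\<^sup>2)"
proof -
  interpret prob_space "gauss m" by (rule prob_space_gauss)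
  define I where "I = {l\<in>{..<m}. a l \<noteq> 0}"
  have I: "finite I" "I \<subseteq> {..<m}" by (auto simp: I_def)
  have s1: "(\<Sum>l<m. a l * z l) = (\<Sum>l\<in>I. a l * z l)" for z
    by (rule sum.mono_neutral_right) (auto simp: I_def)
  have s2: "(\<Sum>l<m. (a l)\<^sup>2) = (\<Sum>l\<in>I. (a l)\<^sup>2)"
    by (rule sum.mono_neutral_right) (auto simp: I_def)
  show ?thesis
  proof (cases "I = {}")
    case True
    then show ?thesis by (simp add: s1 s2 distr_const centred_normal_def)
  next
    case False
    have ind: "indep_vars (\<lambda>_. borel) (\<lambda>l z. a l * z l) I"
      using indep_vars_compose2[OF indep_vars_subset[OF indep_vars_gauss I(2)], of "\<lambda>l x. a l * x" "\<lambda>_. borel"]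
      by simp
    have "distributed (gauss m) lborel (\<lambda>z. a l * z l) (normal_density 0 \<bar>a l\<bar>)" if "l \<in> I" for l
    proof -
      have l: "l < m" "a l \<noteq> 0" using that by (auto simp: I_def)
      have "distr (gauss m) lborel (\<lambda>z. z l) = distr (gauss m) std_normal (\<lambda>z. z l)"
        by (rule distr_cong) auto
      also have "\<dots> = std_normal" by (rule gauss_component[OF l(1)])
      finally have "distributed (gauss m) lborel (\<lambda>z. z l) (\<lambda>x. ennreal (std_normal_density x))"
        using l by (simp add: distributed_def std_normal_def)
      from normal_density_affine[OF this, of "a l" 0] l show ?thesis by simp
    qed
    then have "distributed (gauss m) lborel (\<lambda>z. \<Sum>l\<in>I. a l * z l)
        (normal_density (\<Sum>l\<in>I. 0) (sqrt (\<Sum>l\<in>I. \<bar>a l\<bar>\<^sup>2)))"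
      using False I ind by (intro sum_indep_normal) (auto simp: I_def)
    then have "distr (gauss m) lborel (\<lambda>z. \<Sum>l\<in>I. a l * z l) = density lborel (normal_density 0 (sqrt (\<Sum>l\<in>I. (a l)\<^sup>2)))"
      by (simp add: distributed_def)
    moreover have "distr (gauss m) lborel (\<lambda>z. \<Sum>l\<in>I. a l * z l) = distr (gauss m) borel (\<lambda>z. \<Sum>l\<in>I. a l * z l)"
      by (rule distr_cong) auto
    moreover have "(\<Sum>l\<in>I. (a l)\<^sup>2) \<noteq> 0"
      using False I by (subst sum_nonneg_eq_0_iff) (auto simp: I_def)
    ultimately show ?thesis by (simp add: s1 s2 centred_normal_def)
  qed
qed

lemma centred_normal_second_moment:
  assumes "0 \<le> v"
  shows "has_bochner_integral (centred_normal v) (\<lambda>x. x\<^sup>2) v"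
proof -
  have "has_bochner_integral std_normal (\<lambda>x. (sqrt v * x)\<^sup>2) v"
    using has_bochner_integral_mult_right[OF has_integral_std_normal_even[of 1], of v] assms
    by (simp add: power_mult_distrib)
  moreover have "(\<lambda>x. sqrt v * x) \<in> borel_measurable std_normal"
    by (subst measurable_cong_sets[OF sets_std_normal refl]) measurable
  ultimately show ?thesis
    unfolding centred_normal_eq_distr[OF assms]
    by (intro has_bochner_integral_distr) auto
qed

lemma gauss_linear_square:
  "has_bochner_integral (gauss m) (\<lambda>z. (\<Sum>l<m. a l * z l)\<^sup>2) (\<Sum>l<m. (a l)\<^sup>2)"
proof -
  have "has_bochner_integral (distr (gauss m) borel (\<lambda>z. \<Sum>l<m. a l * z l)) (\<lambda>x. x\<^sup>2) (\<Sum>l<m. (a l)\<^sup>2)"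
    unfolding distr_gauss_linear by (rule centred_normal_second_moment) (simp add: sum_nonneg)
  moreover have "(\<lambda>z. \<Sum>l<m. a l * z l) \<in> borel_measurable (gauss m)" by measurable
  ultimately show ?thesis
    unfolding has_bochner_integral_iff by (simp add: integrable_distr_eq integral_distr)
qed

text \<open>Polarisation of the second moment of a linear form.\<close>

lemma gauss_linear_product:
  "has_bochner_integral (gauss m) (\<lambda>z. (\<Sum>l<m. a l * z l) * (\<Sum>l<m. b l * z l)) (\<Sum>l<m. a l * b l)"
proof -
  have "has_bochner_integral (gauss m)
      (\<lambda>z. (1/4) * ((\<Sum>l<m. (a l + b l) * z l)\<^sup>2 - (\<Sum>l<m. (a l - b l) * z l)\<^sup>2))
      ((1/4) * ((\<Sum>l<m. (a l + b l)\<^sup>2) - (\<Sum>l<m. (a l - b l)\<^sup>2)))"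
    by (intro has_bochner_integral_mult_right has_bochner_integral_diff gauss_linear_square)
  moreover have "(1/4) * ((\<Sum>l<m. (a l + b l) * z l)\<^sup>2 - (\<Sum>l<m. (a l - b l) * z l)\<^sup>2)
      = (\<Sum>l<m. a l * z l) * (\<Sum>l<m. b l * z l)" for z
    by (simp add: distrib_right left_diff_distrib sum.distrib sum_subtractf power2_eq_square algebra_simps)
  moreover have "(1/4) * ((\<Sum>l<m. (a l + b l)\<^sup>2) - (\<Sum>l<m. (a l - b l)\<^sup>2)) = (\<Sum>l<m. a l * b l)"
    unfolding sum_subtractf[symmetric] sum_distrib_left
    by (intro sum.cong) (auto simp: power2_eq_square algebra_simps)
  ultimately show ?thesis by simp
qed

lemma gauss_component_product:
  assumes "i < m" "j < m"
  shows "has_bochner_integral (gauss m) (\<lambda>z. z i * z j) (if i = j then 1 else 0)"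
proof -
  have e: "(\<Sum>l<m. (if l = i then 1 else 0) * z l) = z i" if "i < m" for i and z :: rvec
  proof -
    have "(\<Sum>l<m. (if l = i then 1 else 0) * z l) = (\<Sum>l<m. if i = l then z l else 0)"
      by (intro sum.cong) auto
    then show ?thesis using that by (simp add: sum.delta)
  qed
  show ?thesis
    using gauss_linear_product[of m "\<lambda>l. if l = i then 1 else 0" "\<lambda>l. if l = j then 1 else 0"] assms
    by (simp add: e)
qed

lemma nn_integral_std_normal_shift:
  assumes [measurable]: "g \<in> borel_measurable borel"
  shows "(\<integral>\<^sup>+ y. g (y + c) \<partial>std_normal) = (\<integral>\<^sup>+ y. g y * ennreal (exp (c * y - c\<^sup>2 / 2)) \<partial>std_normal)"
proof -
  have eq: "std_normal_density (y - c) = std_normal_density y * exp (c * y - c\<^sup>2 / 2)" for y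
    by (simp add: std_normal_density_def exp_add[symmetric] power2_diff field_simps)
  have "(\<integral>\<^sup>+ y. g (y + c) \<partial>std_normal) = (\<integral>\<^sup>+ y. ennreal (std_normal_density y) * g (y + c) \<partial>lborel)"
    unfolding std_normal_def by (subst nn_integral_density) auto
  also have "\<dots> = (\<integral>\<^sup>+ y. ennreal (std_normal_density (y - c)) * g y \<partial>lborel)"
    by (subst nn_integral_real_affine[of "\<lambda>y. ennreal (std_normal_density (y - c)) * g y" 1 c])
       (auto simp: add.commute)
  also have "\<dots> = (\<integral>\<^sup>+ y. ennreal (std_normal_density y) * (g y * ennreal (exp (c * y - c\<^sup>2 / 2))) \<partial>lborel)"
    by (intro nn_integral_cong) (simp add: eq ennreal_mult' mult_ac)
  also have "\<dots> = (\<integral>\<^sup>+ y. g y * ennreal (exp (c * y - c\<^sup>2 / 2)) \<partial>std_normal)"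
    unfolding std_normal_def by (subst nn_integral_density) auto
  finally show ?thesis .
qed

lemma measurable_gauss_upd[measurable (raw)]:
  assumes "i < m" and f: "f \<in> borel_measurable M" and g: "g \<in> measurable M (gauss m)"
  shows "(\<lambda>x. (g x)(i := f x)) \<in> measurable M (gauss m)"
proof -
  have "(\<lambda>x. (g x)(i := f x)) \<in> measurable M (PiM (insert i {..<m}) (\<lambda>_. std_normal))"
    using f g unfolding gauss_def by (intro measurable_fun_upd[where J="{..<m}"]) auto
  moreover have "insert i {..<m} = {..<m}" using assms(1) by auto
  ultimately show ?thesis by (simp add: gauss_def)
qed

text \<open>
  As \<open>h\<close> does not depend on coordinate \<open>i\<close>, Fubini's theorem reduces this change of variables to a
  translation of the line by a constant.
\<close>

lemma nn_integral_gauss_shift: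
  assumes i: "i < m" and g[measurable]: "g \<in> borel_measurable (gauss m)"
    and h[measurable]: "h \<in> borel_measurable (gauss m)" and hi: "\<And>x y. h (x(i := y)) = h x"
  shows "(\<integral>\<^sup>+ x. g (x(i := x i + h x)) \<partial>gauss m)
    = (\<integral>\<^sup>+ x. g x * ennreal (exp (h x * x i - (h x)\<^sup>2 / 2)) \<partial>gauss m)"
proof -
  interpret product_prob_space "\<lambda>_::nat. std_normal" by (intro product_prob_spaceI prob_space_std_normal)
  define I where "I = {..<m} - {i}"
  have I: "finite I" "i \<notin> I" "insert i I = {..<m}" using i by (auto simp: I_def)
  have G: "gauss m = PiM (insert i I) (\<lambda>_. std_normal)" by (simp add: I gauss_def)
  have [measurable]: "(\<lambda>x. g (x(i := x i + h x))) \<in> borel_measurable (gauss m)"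
    using i by measurable
  have gm: "(\<lambda>y. g (x(i := y))) \<in> borel_measurable borel" if "x \<in> space (PiM I (\<lambda>_. std_normal))" for x
  proof -
    have "(\<lambda>y. x(i := y)) \<in> measurable borel (gauss m)"
      unfolding G using that by (intro measurable_fun_upd[where J=I]) auto
    then show ?thesis by measurable
  qed
  have "(\<integral>\<^sup>+ x. g (x(i := x i + h x)) \<partial>gauss m)
      = (\<integral>\<^sup>+ x. \<integral>\<^sup>+ y. g (x(i := y + h x)) \<partial>std_normal \<partial>PiM I (\<lambda>_. std_normal))"
    unfolding G by (subst product_nn_integral_insert[OF I(1,2)]) (simp_all add: G[symmetric] hi)
  also have "\<dots> = (\<integral>\<^sup>+ x. \<integral>\<^sup>+ y. g (x(i := y)) * ennreal (exp (h x * y - (h x)\<^sup>2 / 2)) \<partial>std_normal \<partial>PiM I (\<lambda>_. std_normal))"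
    by (intro nn_integral_cong nn_integral_std_normal_shift gm)
  also have "\<dots> = (\<integral>\<^sup>+ x. g x * ennreal (exp (h x * x i - (h x)\<^sup>2 / 2)) \<partial>gauss m)"
    unfolding G using i by (subst product_nn_integral_insert[OF I(1,2)]) (simp_all add: G[symmetric] hi)
  finally show ?thesis .
qed

text \<open>
  Changing the sign of one parameter amounts to moving the source by such a map: index \<open>j\<close> belongs
  to the parameter, \<open>i\<close> to a covariate whose covariance with covariate \<open>j\<close> changes, and \<open>k\<close> to the
  noise of the response.
\<close>

definition shear :: "nat \<Rightarrow> nat \<Rightarrow> nat \<Rightarrow> real \<Rightarrow> real \<Rightarrow> rvec \<Rightarrow> rvec" where
  "shear j i k d e z = z(i := z i + d * z j, k := z k + e * z j)"

lemma measurable_shear[measurable]: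
  assumes "i < m" "j < m" "k < m"
  shows "shear j i k d e \<in> measurable (gauss m) (gauss m)"
proof -
  have 1: "(\<lambda>z. z(i := z i + d * z j)) \<in> measurable (gauss m) (gauss m)"
    using assms by (intro measurable_gauss_upd) auto
  have "(\<lambda>z. (z(i := z i + d * z j))(k := z k + e * z j)) \<in> measurable (gauss m) (gauss m)"
    using assms 1 by (intro measurable_gauss_upd) auto
  then show ?thesis by (simp add: shear_def[abs_def])
qed

lemma distr_gauss_shear:
  assumes "i < m" "j < m" "k < m" "i \<noteq> j" "k \<noteq> j" "i \<noteq> k"
  shows "distr (gauss m) (gauss m) (shear j i k d e)
    = density (gauss m) (\<lambda>z. ennreal (exp (d * z j * z i - (d * z j)\<^sup>2 / 2 + (e * z j * z k - (e * z j)\<^sup>2 / 2))))"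
    (is "?L = density _ (\<lambda>z. ennreal (?f z))")
proof (rule measure_eqI)
  note [measurable] = measurable_shear[OF assms(1-3)]
  fix A assume "A \<in> sets ?L"
  then have A[measurable]: "A \<in> sets (gauss m)" by simp
  have [measurable]: "(\<lambda>z. z j) \<in> borel_measurable (gauss m)" "(\<lambda>z. z i) \<in> borel_measurable (gauss m)"
    "(\<lambda>z. z k) \<in> borel_measurable (gauss m)" using assms by auto
  define F where "F z = ennreal (exp (d * z j * z i - (d * z j)\<^sup>2 / 2))" for z :: rvec
  have [measurable]: "F \<in> borel_measurable (gauss m)" unfolding F_def by measurable
  have upd: "(\<lambda>z. z(k := z k + e * z j)) \<in> measurable (gauss m) (gauss m)"
    using assms by (intro measurable_gauss_upd) auto
  have [measurable]: "(\<lambda>z. indicator A (z(k := z k + e * z j)) :: ennreal) \<in> borel_measurable (gauss m)"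
    using measurable_compose[OF upd, of "indicator A :: rvec \<Rightarrow> ennreal"] by simp
  have "emeasure ?L A = (\<integral>\<^sup>+ z. indicator A (shear j i k d e z) \<partial>gauss m)"
    using nn_integral_distr[of "shear j i k d e" "gauss m" "gauss m" "indicator A"] by simp
  also have "\<dots> = (\<integral>\<^sup>+ z. (\<lambda>z. indicator A (z(k := z k + e * z j))) (z(i := z i + d * z j)) \<partial>gauss m)"
    using assms by (simp add: shear_def)
  also have "\<dots> = (\<integral>\<^sup>+ z. indicator A (z(k := z k + e * z j)) * F z \<partial>gauss m)"
    unfolding F_def using assms by (intro nn_integral_gauss_shift) auto
  also have "\<dots> = (\<integral>\<^sup>+ z. (\<lambda>z. indicator A z * F z) (z(k := z k + e * z j)) \<partial>gauss m)"
    using assms by (simp add: F_def)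
  also have "\<dots> = (\<integral>\<^sup>+ z. indicator A z * F z * ennreal (exp (e * z j * z k - (e * z j)\<^sup>2 / 2)) \<partial>gauss m)"
    using assms by (intro nn_integral_gauss_shift) auto
  also have "\<dots> = (\<integral>\<^sup>+ z. ennreal (?f z) * indicator A z \<partial>gauss m)"
    by (intro nn_integral_cong) (simp add: F_def exp_add ennreal_mult' mult_ac)
  also have "\<dots> = emeasure (density (gauss m) (\<lambda>z. ennreal (?f z))) A"
    by (subst emeasure_density) auto
  finally show "emeasure ?L A = emeasure (density (gauss m) (\<lambda>z. ennreal (?f z))) A" .
qed simp

text \<open>
  The logarithm of the density is the polynomial
  \<open>d z\<^sub>j z\<^sub>i - d\<^sup>2 z\<^sub>j\<^sup>2 / 2 + e z\<^sub>j z\<^sub>k - e\<^sup>2 z\<^sub>j\<^sup>2 / 2\<close>, and its mixed terms have mean zero.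
\<close>

lemma kl_close_shear:
  assumes "i < m" "j < m" "k < m" "i \<noteq> j" "k \<noteq> j" "i \<noteq> k"
    and T[measurable]: "T \<in> measurable (gauss m) N"
  shows "kl_close (gauss m) ((d\<^sup>2 + e\<^sup>2) / 2) (distr (gauss m) N T)
     (distr (gauss m) N (\<lambda>z. T (shear j i k d e z)))"
proof -
  note [measurable] = measurable_shear[OF assms(1-3)]
  have [measurable]: "(\<lambda>z. z j) \<in> borel_measurable (gauss m)" "(\<lambda>z. z i) \<in> borel_measurable (gauss m)"
    "(\<lambda>z. z k) \<in> borel_measurable (gauss m)" using assms by auto
  define f where "f z = exp (d * z j * z i - (d * z j)\<^sup>2 / 2 + (e * z j * z k - (e * z j)\<^sup>2 / 2))" for z :: rvec
  have fm[measurable]: "f \<in> borel_measurable (gauss m)" unfolding f_def by measurable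
  have dens: "distr (gauss m) (gauss m) (shear j i k d e) = density (gauss m) (\<lambda>z. ennreal (f z))"
    unfolding f_def by (rule distr_gauss_shear[OF assms(1-6)])
  have "prob_space (density (gauss m) (\<lambda>z. ennreal (f z)))"
    unfolding dens[symmetric] by (intro prob_space.prob_space_distr prob_space_gauss) simp
  then have "emeasure (density (gauss m) (\<lambda>z. ennreal (f z))) (space (gauss m)) = 1"
    using prob_space.emeasure_space_1 by fastforce
  then have one: "(\<integral>\<^sup>+ z. ennreal (f z) \<partial>gauss m) = 1"
    by (simp add: emeasure_density cong: nn_integral_cong)
  have lnf: "ln (f z) = d * (z j * z i) - d\<^sup>2 / 2 * (z j * z j) + (e * (z j * z k) - e\<^sup>2 / 2 * (z j * z j))" for z
    by (simp add: f_def power2_eq_square algebra_simps)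
  have "has_bochner_integral (gauss m) (\<lambda>z. ln (f z))
      (d * (if j = i then 1 else 0) - d\<^sup>2 / 2 * (if j = j then 1 else 0)
       + (e * (if j = k then 1 else 0) - e\<^sup>2 / 2 * (if j = j then 1 else 0)))"
    unfolding lnf using assms
    by (intro has_bochner_integral_add has_bochner_integral_diff has_bochner_integral_mult_right
        gauss_component_product) auto
  then have I: "has_bochner_integral (gauss m) (\<lambda>z. ln (f z)) (- (d\<^sup>2 + e\<^sup>2) / 2)"
    using assms by (simp add: field_simps)
  show ?thesis unfolding kl_close_def
  proof (intro conjI exI[of _ T] exI[of _ f])
    show "distr (gauss m) N (\<lambda>z. T (shear j i k d e z)) =
        distr (density (gauss m) (\<lambda>x. ennreal (f x))) (distr (gauss m) N T) T"
      unfolding dens[symmetric] by (subst distr_distr) (auto intro!: distr_cong simp: comp_def)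
    show "distr (gauss m) N T = distr (gauss m) (distr (gauss m) N T) T"
      by (rule distr_cong) auto
  qed (use one I in \<open>auto simp: prob_space_gauss f_def has_bochner_integral_iff\<close>)
qed

lemma distr_std_normal_uminus: "distr std_normal borel uminus = std_normal"
proof (rule measure_eqI)
  fix A assume "A \<in> sets (distr std_normal borel uminus)"
  then have [measurable]: "A \<in> sets borel" by simp
  have "emeasure (distr std_normal borel uminus) A = (\<integral>\<^sup>+ x. indicator A (- x) \<partial>std_normal)"
    using nn_integral_distr[of uminus std_normal borel "indicator A"]
    by (simp add: measurable_cong_sets[OF sets_std_normal refl])
  also have "\<dots> = (\<integral>\<^sup>+ x. ennreal (std_normal_density x) * indicator A (- x) \<partial>lborel)"
    unfolding std_normal_def by (subst nn_integral_density) auto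
  also have "\<dots> = (\<integral>\<^sup>+ x. ennreal (std_normal_density x) * indicator A x \<partial>lborel)"
    by (subst nn_integral_real_affine[of "\<lambda>x. ennreal (std_normal_density x) * indicator A (- x)" "-1" 0])
       (auto simp: std_normal_density_def)
  also have "\<dots> = emeasure std_normal A"
    unfolding std_normal_def by (subst emeasure_density) auto
  finally show "emeasure (distr std_normal borel uminus) A = emeasure std_normal A" .
qed simp

lemma measurable_flip[measurable]:
  "j < m \<Longrightarrow> (\<lambda>z. z(j := - z j)) \<in> measurable (gauss m) (gauss m)"
  by (intro measurable_gauss_upd) auto

lemma distr_gauss_flip:
  assumes "j < m"
  shows "distr (gauss m) (gauss m) (\<lambda>z. z(j := - z j)) = gauss m"
proof -
  define T :: "nat \<Rightarrow> real \<Rightarrow> real" where "T i = (if i = j then uminus else (\<lambda>x. x))" for i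
  have [measurable]: "T i \<in> measurable std_normal std_normal" for i by (simp add: T_def)
  have "distr std_normal std_normal (T i) = std_normal" for i
    using distr_std_normal_uminus
    by (auto simp: T_def distr_id2 intro: trans[OF distr_cong])
  then have "gauss m = PiM {..<m} (\<lambda>i. distr std_normal std_normal (T i))" by (simp add: gauss_def)
  also have "\<dots> = distr (gauss m) (gauss m) (\<lambda>x. \<lambda>i\<in>{..<m}. T i (x i))"
    unfolding gauss_def by (rule PiM_distr_family) (auto simp: prob_space_std_normal)
  also have "\<dots> = distr (gauss m) (gauss m) (\<lambda>z. z(j := - z j))"
    using assms
    by (intro distr_cong) (auto simp: T_def space_gauss vec_space_def space_PiM PiE_iff extensional_def fun_eq_iff)
  finally show ?thesis ..
qed

lemma kl_close_refl:
  assumes T[measurable]: "T \<in> measurable (gauss m) N"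
  shows "kl_close (gauss m) 0 (distr (gauss m) N T) (distr (gauss m) N T)"
  unfolding kl_close_def
proof (intro conjI exI[of _ T] exI[of _ "\<lambda>_. 1"])
  interpret prob_space "gauss m" by (rule prob_space_gauss)
  show "(\<integral>\<^sup>+ x. ennreal 1 \<partial>gauss m) = 1" by (simp add: emeasure_space_1)
  show "distr (gauss m) N T = distr (gauss m) (distr (gauss m) N T) T"
    by (rule distr_cong) auto
  show "distr (gauss m) N T = distr (density (gauss m) (\<lambda>x. ennreal 1)) (distr (gauss m) N T) T"
    by (rule distr_cong) (auto simp: density_1)
qed (auto simp: prob_space_gauss)

lemma kl_close_flip:
  assumes "j < m" and T[measurable]: "T \<in> measurable (gauss m) N"
  shows "kl_close (gauss m) 0 (distr (gauss m) N T) (distr (gauss m) N (\<lambda>z. T (z(j := - z j))))"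
proof -
  have "distr (gauss m) N (\<lambda>z. T (z(j := - z j))) = distr (distr (gauss m) (gauss m) (\<lambda>z. z(j := - z j))) N T"
    using assms by (subst distr_distr) (auto simp: comp_def)
  then show ?thesis using kl_close_refl[OF T] distr_gauss_flip[OF assms(1)] by simp
qed

section \<open>Gaussian mechanisms\<close>

text \<open>
  Covariates \<open>X = A z\<close> for a square root \<open>A\<close> of the covariance matrix. The noise uses coordinate \<open>p\<close>
  of the source, which \<open>lin\<close> leaves out.
\<close>

definition lin :: "nat \<Rightarrow> (nat \<Rightarrow> nat \<Rightarrow> real) \<Rightarrow> rvec \<Rightarrow> rvec" where
  "lin p A z = (\<lambda>i\<in>{..<p}. \<Sum>l<p. A i l * z l)"

definition gram :: "nat \<Rightarrow> (nat \<Rightarrow> nat \<Rightarrow> real) \<Rightarrow> nat \<Rightarrow> nat \<Rightarrow> real" where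
  "gram p A i j = (\<Sum>l<p. A i l * A j l)"

definition gauss_mechanism :: "nat \<Rightarrow> (nat \<Rightarrow> nat \<Rightarrow> real) \<Rightarrow> rvec \<Rightarrow> real \<Rightarrow> mechanism" where
  "gauss_mechanism p A b r =
     \<lparr>law = distr (gauss (Suc p)) (Rp p \<Otimes>\<^sub>M borel) (\<lambda>z. (lin p A z, r * z p)),
      beta = b, noise_sd = r\<rparr>"

lemma measurable_lin[measurable]: "lin p A \<in> measurable (gauss (Suc p)) (Rp p)"
  unfolding lin_def[abs_def] vec_space_def
  by (intro measurable_restrict borel_measurable_sum borel_measurable_times borel_measurable_const
      component_measurable_gauss) auto

lemma measurable_noise[measurable]: "(\<lambda>z. r * z p) \<in> borel_measurable (gauss (Suc p))"
  by (intro borel_measurable_times borel_measurable_const component_measurable_gauss) simp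

lemma measurable_lin_noise[measurable]:
  "(\<lambda>z. (lin p A z, r * z p)) \<in> measurable (gauss (Suc p)) (Rp p \<Otimes>\<^sub>M borel)"
  by (intro measurable_Pair) auto

lemma measurable_dot[measurable]: "dot p u \<in> borel_measurable (Rp p)"
  unfolding dot_def[abs_def] vec_space_def
  by (intro borel_measurable_sum borel_measurable_times borel_measurable_const
      measurable_component_singleton) auto

lemma dot_lin: "dot p u (lin p A z) = (\<Sum>l<p. (\<Sum>i<p. u i * A i l) * z l)"
proof -
  have "dot p u (lin p A z) = (\<Sum>i<p. \<Sum>l<p. u i * A i l * z l)"
    by (simp add: dot_def lin_def sum_distrib_left mult.assoc)
  also have "\<dots> = (\<Sum>l<p. \<Sum>i<p. u i * A i l * z l)" by (rule sum.swap)
  finally show ?thesis by (simp add: sum_distrib_right)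
qed

lemma quad_form_gram:
  "quad_form p (mat p p (\<lambda>(i, j). gram p A i j)) u = (\<Sum>l<p. (\<Sum>i<p. u i * A i l)\<^sup>2)"
proof -
  have "(\<Sum>l<p. (\<Sum>i<p. u i * A i l)\<^sup>2) = (\<Sum>l<p. \<Sum>i<p. \<Sum>j<p. u i * A i l * (u j * A j l))"
    by (simp add: power2_eq_square sum_product)
  also have "\<dots> = (\<Sum>i<p. \<Sum>l<p. \<Sum>j<p. u i * A i l * (u j * A j l))" by (rule sum.swap)
  also have "\<dots> = (\<Sum>i<p. \<Sum>j<p. \<Sum>l<p. u i * A i l * (u j * A j l))"
    by (intro sum.cong refl sum.swap)
  also have "\<dots> = (\<Sum>i<p. \<Sum>j<p. u i * gram p A i j * u j)"
    by (simp add: gram_def sum_distrib_left sum_distrib_right mult_ac)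
  finally show ?thesis by (simp add: quad_form_def)
qed

lemma distr_gauss_dot_lin:
  "distr (gauss (Suc p)) borel (\<lambda>z. dot p u (lin p A z))
     = centred_normal (quad_form p (mat p p (\<lambda>(i, j). gram p A i j)) u)"
proof -
  define a where "a l = (if l < p then \<Sum>i<p. u i * A i l else 0)" for l
  have "(\<lambda>z. dot p u (lin p A z)) = (\<lambda>z. \<Sum>l<Suc p. a l * z l)"
    by (simp add: dot_lin a_def fun_eq_iff)
  moreover have "quad_form p (mat p p (\<lambda>(i, j). gram p A i j)) u = (\<Sum>l<Suc p. (a l)\<^sup>2)"
    by (simp add: quad_form_gram a_def)
  ultimately show ?thesis by (simp only: distr_gauss_linear)
qed

lemma distr_gauss_noise:
  assumes "0 \<le> r"
  shows "distr (gauss (Suc p)) borel (\<lambda>z. r * z p) = centred_normal (r\<^sup>2)"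
proof -
  define a where "a l = (if l < p then 0 else r)" for l
  have "(\<lambda>z. r * z p) = (\<lambda>z. \<Sum>l<Suc p. a l * z l)" "r\<^sup>2 = (\<Sum>l<Suc p. (a l)\<^sup>2)"
    by (auto simp: a_def)
  then show ?thesis by (simp only: distr_gauss_linear)
qed

text \<open>
  The two blocks \<open>{..<p}\<close> and \<open>{p}\<close> of the source are independent. Independence of random variables
  requires values of one type, so the noise is first kept as a vector indexed by \<open>{p}\<close>.
\<close>

lemma distr_lin_noise:
  "distr (gauss (Suc p)) (Rp p \<Otimes>\<^sub>M borel) (\<lambda>z. (lin p A z, r * z p))
     = distr (gauss (Suc p)) (Rp p) (lin p A) \<Otimes>\<^sub>M distr (gauss (Suc p)) borel (\<lambda>z. r * z p)"
proof -
  let ?N = "PiM {p} (\<lambda>_. borel) :: rvec measure"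
  let ?R = "\<lambda>z::rvec. restrict z {p}"
  interpret prob_space "gauss (Suc p)" by (rule prob_space_gauss)
  have "indep_var (PiM {..<p} (\<lambda>_. borel)) (\<lambda>z. restrict (\<lambda>i. z i) {..<p})
      ?N (\<lambda>z. restrict (\<lambda>i. z i) {p})"
    by (rule indep_var_restrict[OF indep_vars_gauss]) auto
  moreover have "lin p A \<in> measurable (PiM {..<p} (\<lambda>_. borel)) (Rp p)"
    unfolding lin_def[abs_def] vec_space_def
    by (intro measurable_restrict borel_measurable_sum borel_measurable_times borel_measurable_const
      measurable_component_singleton) auto
  moreover have "(\<lambda>z. z) \<in> measurable ?N ?N" by simp
  ultimately have "indep_var (Rp p) (lin p A \<circ> (\<lambda>z. restrict (\<lambda>i. z i) {..<p}))
      ?N ((\<lambda>z. z) \<circ> (\<lambda>z. restrict (\<lambda>i. z i) {p}))"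
    by (rule indep_var_compose)
  moreover have "lin p A \<circ> (\<lambda>z. restrict (\<lambda>i. z i) {..<p}) = lin p A"
    by (auto simp: lin_def fun_eq_iff)
  ultimately have iv: "indep_var (Rp p) (lin p A) ?N ?R" by (simp add: comp_def)
  then have R[measurable]: "?R \<in> measurable (gauss (Suc p)) ?N" by (rule indep_var_rv2)
  have c[measurable]: "(\<lambda>x. r * x p) \<in> borel_measurable ?N"
    by (intro borel_measurable_times borel_measurable_const measurable_component_singleton) auto
  have D: "distr (gauss (Suc p)) (Rp p) (lin p A) \<Otimes>\<^sub>M distr (gauss (Suc p)) ?N ?R
      = distr (gauss (Suc p)) (Rp p \<Otimes>\<^sub>M ?N) (\<lambda>z. (lin p A z, ?R z))"
    using iv unfolding indep_var_distribution_eq by simp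
  have e: "distr (distr (gauss (Suc p)) ?N ?R) borel (\<lambda>x. r * x p)
      = distr (gauss (Suc p)) borel (\<lambda>z. r * z p)"
    by (subst distr_distr) (auto simp: comp_def)
  have pn: "prob_space (distr (gauss (Suc p)) borel (\<lambda>z. r * z p))" by (rule prob_space_distr) simp
  have "distr (gauss (Suc p)) (Rp p) (lin p A) \<Otimes>\<^sub>M distr (gauss (Suc p)) borel (\<lambda>z. r * z p)
      = distr (distr (gauss (Suc p)) (Rp p) (lin p A)) (Rp p) (\<lambda>x. x) \<Otimes>\<^sub>M distr (distr (gauss (Suc p)) ?N ?R) borel (\<lambda>x. r * x p)"
    unfolding e by (subst distr_id2) auto
  also have "\<dots> = distr (distr (gauss (Suc p)) (Rp p) (lin p A) \<Otimes>\<^sub>M distr (gauss (Suc p)) ?N ?R)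
      (Rp p \<Otimes>\<^sub>M borel) (\<lambda>(x, y). (x, r * y p))"
    by (intro pair_measure_distr) (auto simp: e intro!: prob_space_imp_sigma_finite[OF pn])
  also have "\<dots> = distr (gauss (Suc p)) (Rp p \<Otimes>\<^sub>M borel) (\<lambda>z. (lin p A z, r * z p))"
    unfolding D by (subst distr_distr) (auto simp: comp_def)
  finally show ?thesis ..
qed

context
  fixes p :: nat and A :: "nat \<Rightarrow> nat \<Rightarrow> real" and b :: rvec and r :: real and P :: mechanism
  defines "P \<equiv> gauss_mechanism p A b r"
begin

lemma law_gauss_mechanism:
  "law P = distr (gauss (Suc p)) (Rp p \<Otimes>\<^sub>M borel) (\<lambda>z. (lin p A z, r * z p))"
  by (simp add: P_def gauss_mechanism_def)

lemma prob_space_law: "prob_space (law P)"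
  unfolding law_gauss_mechanism by (intro prob_space.prob_space_distr prob_space_gauss) simp

lemma sets_law[measurable_cong]: "sets (law P) = sets (Rp p \<Otimes>\<^sub>M borel)"
  by (simp add: law_gauss_mechanism)

lemma space_law: "space (law P) = space (Rp p \<Otimes>\<^sub>M borel)"
  by (rule sets_eq_imp_space_eq[OF sets_law])

lemma distr_law_fst: "distr (law P) (Rp p) fst = distr (gauss (Suc p)) (Rp p) (lin p A)"
  unfolding law_gauss_mechanism by (subst distr_distr) (auto simp: comp_def)

lemma distr_law_snd: "distr (law P) borel snd = distr (gauss (Suc p)) borel (\<lambda>z. r * z p)"
  unfolding law_gauss_mechanism by (subst distr_distr) (auto simp: comp_def)

lemma distr_law_dot:
  "distr (law P) borel (\<lambda>w. dot p u (fst w))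
     = centred_normal (quad_form p (mat p p (\<lambda>(i, j). gram p A i j)) u)"
  unfolding distr_gauss_dot_lin[symmetric] law_gauss_mechanism
  by (subst distr_distr) (auto simp: comp_def)

lemma law_eq_pair: "law P = distr (law P) (Rp p) fst \<Otimes>\<^sub>M distr (law P) borel snd"
  unfolding distr_law_fst distr_law_snd unfolding law_gauss_mechanism by (rule distr_lin_noise)

lemma indep_var_law:
  assumes f[measurable]: "f \<in> borel_measurable (Rp p)" and g[measurable]: "g \<in> borel_measurable borel"
  shows "prob_space.indep_var (law P) borel (\<lambda>w. f (fst w) :: real) borel (\<lambda>w. g (snd w) :: real)"
proof -
  interpret L: prob_space "law P" by (rule prob_space_law)
  have [measurable]: "fst \<in> measurable (law P) (Rp p)" "snd \<in> borel_measurable (law P)"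
    by (simp_all add: measurable_cong_sets[OF sets_law refl])
  have d1: "distr (distr (law P) (Rp p) fst) borel f = distr (law P) borel (\<lambda>w. f (fst w))"
    by (subst distr_distr) (auto simp: comp_def)
  have d2: "distr (distr (law P) borel snd) borel g = distr (law P) borel (\<lambda>w. g (snd w))"
    by (subst distr_distr) (auto simp: comp_def)
  have pn: "prob_space (distr (law P) borel (\<lambda>w. g (snd w)))" by (rule L.prob_space_distr) simp
  have "distr (distr (law P) (Rp p) fst) borel f \<Otimes>\<^sub>M distr (distr (law P) borel snd) borel g
      = distr (distr (law P) (Rp p) fst \<Otimes>\<^sub>M distr (law P) borel snd) (borel \<Otimes>\<^sub>M borel) (\<lambda>(x, y). (f x, g y))"
    by (intro pair_measure_distr) (auto simp: d2 intro!: prob_space_imp_sigma_finite[OF pn])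
  also have "\<dots> = distr (law P) (borel \<Otimes>\<^sub>M borel) (\<lambda>w. (f (fst w), g (snd w)))"
    unfolding law_eq_pair[symmetric] by (simp add: case_prod_beta')
  finally show ?thesis unfolding L.indep_var_distribution_eq d1 d2 by simp
qed

lemma indep_set_law:
  "prob_space.indep_set (law P) (sets (sigma_X p P)) (sets (vimage_algebra (space (law P)) snd borel))"
proof -
  interpret L: prob_space "law P" by (rule prob_space_law)
  have fm[measurable]: "fst \<in> measurable (law P) (Rp p)" and sm[measurable]: "snd \<in> borel_measurable (law P)"
    by (simp_all add: measurable_cong_sets[OF sets_law refl])
  have fsp: "fst \<in> space (law P) \<rightarrow> space (Rp p)" by (auto simp: space_law space_pair_measure)
  have ssp: "snd \<in> space (law P) \<rightarrow> space borel" by simp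
  show ?thesis
    unfolding L.indep_sets2_eq sigma_X_def sets_vimage_algebra2[OF fsp] sets_vimage_algebra2[OF ssp]
  proof (intro conjI ballI)
    show "{fst -` A \<inter> space (law P) |A. A \<in> sets (Rp p)} \<subseteq> L.events"
      "{snd -` A \<inter> space (law P) |A. A \<in> sets borel} \<subseteq> L.events"
      using measurable_sets[OF fm] measurable_sets[OF sm] by auto
    fix a b assume "a \<in> {fst -` A \<inter> space (law P) |A. A \<in> sets (Rp p)}"
      and "b \<in> {snd -` A \<inter> space (law P) |A. A \<in> sets (borel::real measure)}"
    then obtain D E where DE[measurable]: "D \<in> sets (Rp p)" "E \<in> sets borel"
      and a: "a = fst -` D \<inter> space (law P)" and b: "b = snd -` E \<inter> space (law P)" by auto
    have 1: "{1::real} \<in> sets borel" by simp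
    have "L.indep_var borel (\<lambda>w. indicator D (fst w) :: real) borel (\<lambda>w. indicator E (snd w) :: real)"
      by (rule indep_var_law) auto
    from L.indep_varD[OF this 1 1]
    have "L.prob ((\<lambda>w. (indicator D (fst w) :: real, indicator E (snd w) :: real)) -` ({1} \<times> {1}) \<inter> space (law P))
      = L.prob ((\<lambda>w. indicator D (fst w) :: real) -` {1} \<inter> space (law P))
        * L.prob ((\<lambda>w. indicator E (snd w) :: real) -` {1} \<inter> space (law P))" .
    moreover have "(\<lambda>w. (indicator D (fst w) :: real, indicator E (snd w) :: real)) -` ({1} \<times> {1}) \<inter> space (law P) = a \<inter> b"
      by (auto simp: a b indicator_def split: if_splits)
    moreover have "(\<lambda>w. indicator D (fst w) :: real) -` {1} \<inter> space (law P) = a"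
      by (auto simp: a indicator_def split: if_splits)
    moreover have "(\<lambda>w. indicator E (snd w) :: real) -` {1} \<inter> space (law P) = b"
      by (auto simp: b indicator_def split: if_splits)
    ultimately show "L.prob (a \<inter> b) = L.prob a * L.prob b" by simp
  qed
qed

lemma Sigma_mat_gauss_mechanism: "Sigma_mat p P = mat p p (\<lambda>(i, j). gram p A i j)"
proof -
  have "(\<integral> w. fst w i * fst w j \<partial>law P) = gram p A i j" if ij: "i < p" "j < p" for i j
  proof -
    define a where "a k l = (if l < p then A k l else 0)" for k l
    have m: "(\<lambda>x. x k) \<in> borel_measurable (Rp p)" if "k < p" for k
      unfolding vec_space_def using that by (intro measurable_component_singleton) simp
    have "(\<integral> w. fst w i * fst w j \<partial>law P) = (\<integral> z. lin p A z i * lin p A z j \<partial>gauss (Suc p))"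
      unfolding law_gauss_mechanism using m[OF ij(1)] m[OF ij(2)]
      by (subst integral_distr) (auto intro!: borel_measurable_times measurable_compose[OF measurable_fst])
    also have "\<dots> = (\<integral> z. (\<Sum>l<Suc p. a i l * z l) * (\<Sum>l<Suc p. a j l * z l) \<partial>gauss (Suc p))"
      using ij by (simp add: lin_def a_def)
    also have "\<dots> = (\<Sum>l<Suc p. a i l * a j l)"
      by (rule has_bochner_integral_integral_eq[OF gauss_linear_product])
    finally show ?thesis by (simp add: a_def gram_def)
  qed
  then show ?thesis unfolding Sigma_mat_def by (intro eq_matI) auto
qed

text \<open>
  Conditioning on the covariates averages out every function of the noise. Both moment conditions
  on the noise are instances.
\<close>

lemma cond_mean_indep:
  assumes g[measurable]: "g \<in> borel_measurable borel"
    and int: "has_bochner_integral (law P) (\<lambda>w. g (snd w)) c"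
  shows "AE w in law P. cond_mean_X p P (\<lambda>w. g (snd w)) w = c"
proof -
  interpret L: prob_space "law P" by (rule prob_space_law)
  have fsp: "fst \<in> space (law P) \<rightarrow> space (Rp p)"
    by (auto simp: space_law space_pair_measure)
  have fm[measurable]: "fst \<in> measurable (law P) (Rp p)" by (simp add: measurable_cong_sets[OF sets_law refl])
  have sm[measurable]: "snd \<in> borel_measurable (law P)" by (simp add: measurable_cong_sets[OF sets_law refl])
  have sub: "subalgebra (law P) (sigma_X p P)"
    unfolding subalgebra_def sigma_X_def
    using measurable_sets[OF fm] by (auto simp: sets_vimage_algebra2[OF fsp])
  interpret finite_measure_subalgebra "law P" "sigma_X p P"
    using sub by unfold_locales auto
  show ?thesis unfolding cond_mean_X_def
  proof (rule real_cond_exp_charact)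
    show "integrable (law P) (\<lambda>w. g (snd w))" "integrable (law P) (\<lambda>_. c)"
      using int by (auto simp: has_bochner_integral_iff)
    show "(\<lambda>_. c) \<in> borel_measurable (sigma_X p P)" by simp
    fix B assume "B \<in> sets (sigma_X p P)"
    then obtain D where D[measurable]: "D \<in> sets (Rp p)" and B: "B = fst -` D \<inter> space (law P)"
      unfolding sigma_X_def by (auto simp: sets_vimage_algebra2[OF fsp])
    have "L.indep_var borel (\<lambda>w. indicator D (fst w) :: real) borel (\<lambda>w. g (snd w))"
      by (rule indep_var_law) auto
    moreover have iD: "integrable (law P) (\<lambda>w. indicator D (fst w) :: real)"
      by (rule L.integrable_const_bound[where B=1]) (auto simp: indicator_def comp_def)
    ultimately have "(\<integral>w. indicator D (fst w) * g (snd w) \<partial>law P)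
        = (\<integral>w. indicator D (fst w) \<partial>law P) * (\<integral>w. g (snd w) \<partial>law P)"
      using int by (intro L.indep_var_lebesgue_integral) (auto simp: has_bochner_integral_iff comp_def)
    moreover have "(\<integral>w. g (snd w) \<partial>law P) = c" using int by (simp add: has_bochner_integral_iff)
    moreover have "(\<integral>w\<in>B. g (snd w) \<partial>law P) = (\<integral>w. indicator D (fst w) * g (snd w) \<partial>law P)"
      unfolding set_lebesgue_integral_def
      by (intro Bochner_Integration.integral_cong) (auto simp: B indicator_def)
    moreover have "(\<integral>w\<in>B. c \<partial>law P) = (\<integral>w. indicator D (fst w) * c \<partial>law P)"
      unfolding set_lebesgue_integral_def
      by (intro Bochner_Integration.integral_cong) (auto simp: B indicator_def)
    moreover have "(\<integral>w. indicator D (fst w) * c \<partial>law P) = (\<integral>w. indicator D (fst w) \<partial>law P) * c"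
      by simp
    ultimately show "(\<integral>w\<in>B. g (snd w) \<partial>law P) = (\<integral>w\<in>B. c \<partial>law P)" by simp
  qed
qed

lemma noise_power:
  assumes "has_bochner_integral std_normal (\<lambda>x. x ^ k) c"
  shows "has_bochner_integral (law P) (\<lambda>w. snd w ^ k) (r ^ k * c)"
proof -
  have "has_bochner_integral std_normal (\<lambda>x. (r * x) ^ k) (r ^ k * c)"
    using has_bochner_integral_mult_right[OF assms, of "r ^ k"] by (simp add: power_mult_distrib)
  then have "has_bochner_integral (distr (gauss (Suc p)) std_normal (\<lambda>z. z p)) (\<lambda>x. (r * x) ^ k) (r ^ k * c)"
    by (simp add: gauss_component)
  moreover have "(\<lambda>z. z p) \<in> measurable (gauss (Suc p)) std_normal"
    by (subst measurable_cong_sets[OF refl sets_std_normal]) (rule component_measurable_gauss, simp)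
  moreover have "(\<lambda>x. (r * x) ^ k) \<in> borel_measurable std_normal"
    by (subst measurable_cong_sets[OF sets_std_normal refl]) measurable
  ultimately have "has_bochner_integral (gauss (Suc p)) (\<lambda>z. (r * z p) ^ k) (r ^ k * c)"
    unfolding has_bochner_integral_iff by (simp add: integrable_distr_eq integral_distr)
  then show ?thesis
    unfolding law_gauss_mechanism by (intro has_bochner_integral_distr) auto
qed

lemma noise_cond_mean: "AE w in law P. cond_mean_X p P snd w = 0"
proof -
  have "has_bochner_integral std_normal (\<lambda>x. x ^ 1) 0" using has_integral_std_normal_1 by simp
  from noise_power[OF this] have "has_bochner_integral (law P) (\<lambda>w. snd w) 0"
    by (simp only: power_one_right mult_zero_right)
  then show ?thesis by (rule cond_mean_indep[of "\<lambda>x. x", rotated]) simp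
qed

lemma noise_cond_var: "AE w in law P. cond_var_X p P snd w = r\<^sup>2"
proof -
  interpret L: prob_space "law P" by (rule prob_space_law)
  have fsp: "fst \<in> space (law P) \<rightarrow> space (Rp p)"
    by (auto simp: space_law space_pair_measure)
  have fm: "fst \<in> measurable (law P) (Rp p)" by (simp add: measurable_cong_sets[OF sets_law refl])
  have sm[measurable]: "snd \<in> borel_measurable (law P)" by (simp add: measurable_cong_sets[OF sets_law refl])
  have sub: "subalgebra (law P) (sigma_X p P)"
    unfolding subalgebra_def sigma_X_def
    using measurable_sets[OF fm] by (auto simp: sets_vimage_algebra2[OF fsp])
  interpret finite_measure_subalgebra "law P" "sigma_X p P"
    using sub by unfold_locales auto
  have [measurable]: "cond_mean_X p P snd \<in> borel_measurable (law P)"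
    unfolding cond_mean_X_def by (rule borel_measurable_cond_exp2)
  have "AE w in law P. cond_var_X p P snd w = cond_mean_X p P (\<lambda>w. (snd w)\<^sup>2) w"
    unfolding cond_var_X_def cond_mean_X_def[of p P "\<lambda>w. (snd w - cond_mean_X p P snd w)\<^sup>2"]
      cond_mean_X_def[of p P "\<lambda>w. (snd w)\<^sup>2"]
    using noise_cond_mean by (intro real_cond_exp_cong) auto
  moreover have "AE w in law P. cond_mean_X p P (\<lambda>w. (snd w)\<^sup>2) w = r\<^sup>2"
  proof -
    have "has_bochner_integral std_normal (\<lambda>x. x ^ 2) 1" using has_integral_std_normal_even[of 1] by simp
    from noise_power[OF this] have "has_bochner_integral (law P) (\<lambda>w. (snd w)\<^sup>2) (r\<^sup>2)"
      by (simp only: mult_1_right)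
    then show ?thesis by (rule cond_mean_indep[of "\<lambda>x. x\<^sup>2", rotated]) simp
  qed
  ultimately show ?thesis by eventually_elim simp
qed

end

text \<open>
  The standard normal density is at most \<open>1 / 2\<close>, and the interval has length \<open>2 t\<close> after scaling.
\<close>

lemma centred_normal_small_ball:
  assumes "0 < v" "0 < t"
  shows "measure (centred_normal v) {x. \<bar>x\<bar> \<le> t * sqrt v} \<le> t"
proof -
  have half: "std_normal_density x \<le> 1 / 2" for x
  proof -
    have "sqrt (2 * pi) \<ge> sqrt 4" using pi_gt3 by (intro real_sqrt_le_mono) simp
    then have s: "2 \<le> sqrt (2 * pi)" by simp
    have "exp (- x\<^sup>2 / 2) / sqrt (2 * pi) \<le> 1 / 2"
      using s by (intro frac_le) auto
    then show ?thesis by (simp add: std_normal_density_def)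
  qed
  have [measurable]: "{x::real. \<bar>x\<bar> \<le> t} \<in> sets borel" by measurable
  have "emeasure std_normal {x. \<bar>x\<bar> \<le> t} = (\<integral>\<^sup>+ x. ennreal (std_normal_density x) * indicator {x. \<bar>x\<bar> \<le> t} x \<partial>lborel)"
    unfolding std_normal_def by (subst emeasure_density) auto
  also have "\<dots> \<le> (\<integral>\<^sup>+ x. ennreal (1 / 2) * indicator {-t..t} x \<partial>lborel)"
  proof (intro nn_integral_mono)
    fix x :: real
    have "ennreal (std_normal_density x) \<le> ennreal (1 / 2)" by (intro ennreal_leI half)
    then show "ennreal (std_normal_density x) * indicator {x. \<bar>x\<bar> \<le> t} x \<le> ennreal (1 / 2) * indicator {-t..t} x"
      by (auto simp: indicator_def)
  qed
  also have "\<dots> = ennreal (1 / 2) * ennreal (2 * t)"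
    using assms by (subst nn_integral_cmult_indicator) auto
  also have "\<dots> = ennreal t" using assms by (subst ennreal_mult[symmetric]) auto
  finally have le: "measure std_normal {x. \<bar>x\<bar> \<le> t} \<le> t"
    using assms by (simp add: measure_def enn2real_leI)
  have "measure (centred_normal v) {x. \<bar>x\<bar> \<le> t * sqrt v} = measure std_normal ((\<lambda>x. sqrt v * x) -` {x. \<bar>x\<bar> \<le> t * sqrt v} \<inter> space std_normal)"
  proof -
    have "(\<lambda>x. sqrt v * x) \<in> borel_measurable std_normal"
      unfolding measurable_cong_sets[OF sets_std_normal refl] by measurable
    then show ?thesis
      unfolding centred_normal_eq_distr[OF less_imp_le[OF assms(1)]]
      by (rule measure_distr) measurable
  qed
  also have "(\<lambda>x. sqrt v * x) -` {x. \<bar>x\<bar> \<le> t * sqrt v} \<inter> space std_normal = {x. \<bar>x\<bar> \<le> t}"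
    using assms by (auto simp: abs_mult)
  finally show ?thesis using le by simp
qed

text \<open>
  In the extreme case \<open>c\<^sup>2 = 8 v / 3\<close>, the integrand as a function of the standardised variable, times
  the standard normal density, is twice the density of \<open>N(0, 4)\<close>. So the bound \<open>2\<close> is attained.
\<close>

lemma centred_normal_exp_moment:
  assumes "0 \<le> v" "0 < c" "8 * v / 3 \<le> c\<^sup>2"
  shows "(\<integral>\<^sup>+ x. ennreal (exp (x\<^sup>2 / c\<^sup>2)) \<partial>centred_normal v) \<le> 2"
proof -
  have "(\<integral>\<^sup>+ x. ennreal (exp (x\<^sup>2 / c\<^sup>2)) \<partial>centred_normal v)
      = (\<integral>\<^sup>+ x. ennreal (exp ((sqrt v * x)\<^sup>2 / c\<^sup>2)) \<partial>std_normal)"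
    using assms by (subst centred_normal_eq_distr) (auto simp: nn_integral_distr measurable_cong_sets[OF sets_std_normal refl])
  also have "\<dots> \<le> (\<integral>\<^sup>+ x. ennreal (exp (3 / 8 * x\<^sup>2)) \<partial>std_normal)"
  proof (intro nn_integral_mono ennreal_leI)
    fix x
    have "v / c\<^sup>2 \<le> 3 / 8" using assms by (simp add: field_simps)
    then have "v / c\<^sup>2 * x\<^sup>2 \<le> 3 / 8 * x\<^sup>2" by (intro mult_right_mono) auto
    then show "exp ((sqrt v * x)\<^sup>2 / c\<^sup>2) \<le> exp (3 / 8 * x\<^sup>2)"
      using assms by (simp add: power_mult_distrib)
  qed
  also have "\<dots> = (\<integral>\<^sup>+ x. ennreal (std_normal_density x) * ennreal (exp (3 / 8 * x\<^sup>2)) \<partial>lborel)"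
    unfolding std_normal_def by (subst nn_integral_density) auto
  also have "\<dots> = (\<integral>\<^sup>+ x. 2 * ennreal (normal_density 0 2 x) \<partial>lborel)"
  proof (intro nn_integral_cong)
    fix x :: real
    have "sqrt (2 * pi * 2\<^sup>2) = 2 * sqrt (2 * pi)"
      unfolding real_sqrt_mult[of "2 * pi" "2\<^sup>2"] by simp
    then have "2 * normal_density 0 2 x = exp (- x\<^sup>2 / 8) / sqrt (2 * pi)"
      unfolding normal_density_def by simp
    moreover have "std_normal_density x * exp (3 / 8 * x\<^sup>2) = exp (- x\<^sup>2 / 8) / sqrt (2 * pi)"
      by (simp add: std_normal_density_def exp_add[symmetric] field_simps)
    ultimately have "std_normal_density x * exp (3 / 8 * x\<^sup>2) = 2 * normal_density 0 2 x" by simp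
    then show "ennreal (std_normal_density x) * ennreal (exp (3 / 8 * x\<^sup>2)) = 2 * ennreal (normal_density 0 2 x)"
      by (simp add: ennreal_mult'[symmetric] ennreal_mult''[symmetric] flip: ennreal_numeral)
  qed
  also have "\<dots> = 2 * emeasure (density lborel (normal_density 0 2)) UNIV"
    by (subst nn_integral_cmult) (auto simp: emeasure_density)
  also have "\<dots> = 2"
    using prob_space.emeasure_space_1[OF prob_space_normal_density[of 2 0]] by simp
  finally show ?thesis .
qed

text \<open>
  The bounds on the quadratic form control the eigenvalues. The eigenvector \<open>e\<close> is there to show
  that the spectrum is not empty, without which \<open>Min\<close> and \<open>Max\<close> would be unspecified.
\<close>

lemma gram_spectrum:
  assumes p: "0 < p" and lo: "\<And>u. lm * (\<Sum>i<p. (u i)\<^sup>2) \<le> (\<Sum>l<p. (\<Sum>i<p. u i * A i l)\<^sup>2)"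
    and hi: "\<And>u. (\<Sum>l<p. (\<Sum>i<p. u i * A i l)\<^sup>2) \<le> lp * (\<Sum>i<p. (u i)\<^sup>2)"
    and ev: "\<exists>i<p. e i \<noteq> 0" "\<And>i. i < p \<Longrightarrow> (\<Sum>j<p. gram p A i j * e j) = k * e i"
  defines "S \<equiv> mat p p (\<lambda>(i, j). gram p A i j)"
  shows "lm \<le> lambda_min S" "lambda_min S \<le> lambda_max S" "lambda_max S \<le> lp"
proof -
  have S: "S \<in> carrier_mat p p" by (simp add: S_def)
  have fin: "finite (spectrum S)" by (rule card_finite_spectrum[OF S])
  have "eigenvector S (vec p e) k"
    unfolding eigenvector_def using ev
    by (auto simp: S_def scalar_prod_def vec_eq_iff lessThan_atLeast0 intro!: eq_vecI)
  then have ne: "spectrum S \<noteq> {}" by (auto simp: spectrum_def eigenvalue_def)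
  have bd: "lm \<le> x \<and> x \<le> lp" if "x \<in> spectrum S" for x
  proof -
    from that obtain v where v: "v \<in> carrier_vec p" "v \<noteq> 0\<^sub>v p" "S *\<^sub>v v = x \<cdot>\<^sub>v v"
      using S by (auto simp: spectrum_def eigenvalue_def eigenvector_def)
    define u where "u i = v $ i" for i
    have row: "(\<Sum>j<p. S $$ (i, j) * u j) = x * u i" if "i < p" for i
    proof -
      have "(S *\<^sub>v v) $ i = x * u i" using v(1) that by (simp add: u_def v(3))
      moreover have "(S *\<^sub>v v) $ i = (\<Sum>j<p. S $$ (i, j) * u j)"
        using v(1) S that by (auto simp: scalar_prod_def u_def lessThan_atLeast0 intro!: sum.cong)
      ultimately show ?thesis by simp
    qed
    have "quad_form p S u = (\<Sum>i<p. u i * (\<Sum>j<p. S $$ (i, j) * u j))"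
      by (simp add: quad_form_def sum_distrib_left mult.assoc)
    also have "\<dots> = (\<Sum>i<p. x * (u i)\<^sup>2)"
      by (intro sum.cong) (auto simp: row power2_eq_square)
    finally have q: "(\<Sum>l<p. (\<Sum>i<p. u i * A i l)\<^sup>2) = x * (\<Sum>i<p. (u i)\<^sup>2)"
      by (simp add: S_def quad_form_gram sum_distrib_left)
    have "\<exists>i<p. u i \<noteq> 0" using v by (auto simp: u_def intro: eq_vecI)
    then have pos: "0 < (\<Sum>i<p. (u i)\<^sup>2)" by (auto intro!: sum_pos2)
    from lo[of u] hi[of u] q pos show ?thesis by simp
  qed
  show "lm \<le> lambda_min S" "lambda_max S \<le> lp"
    using fin ne bd by (auto simp: lambda_min_def lambda_max_def)
  show "lambda_min S \<le> lambda_max S"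
    using fin ne by (auto simp: lambda_min_def lambda_max_def intro: Min.coboundedI Max_ge order_trans[OF Min_le Max_ge])
qed

text \<open>
  The constants of the class are those of the normal law: its eighth moment is \<open>105 r\<^sup>8\<close>, and its
  sub-Gaussian norm is \<open>\<surd>(8 / 3)\<close> times the standard deviation.
\<close>

lemma gauss_mechanism_in_class:
  assumes p: "0 < p" and lm: "0 < lm" and r: "0 < r"
    and lo: "\<And>u. lm * (\<Sum>i<p. (u i)\<^sup>2) \<le> (\<Sum>l<p. (\<Sum>i<p. u i * A i l)\<^sup>2)"
    and hi: "\<And>u. (\<Sum>l<p. (\<Sum>i<p. u i * A i l)\<^sup>2) \<le> lp * (\<Sum>i<p. (u i)\<^sup>2)"
    and ev: "\<exists>i<p. e i \<noteq> 0" "\<And>i. i < p \<Longrightarrow> (\<Sum>j<p. gram p A i j * e j) = k * e i"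
    and b: "b \<in> space (Rp p)" "norm2 p b \<le> B"
    and par: "0 < chi" "chi \<le> 1" "1 \<le> C" "root 4 105 \<le> kappa" "sqrt (8 * lp / 3) \<le> CX" "0 < lp"
  shows "gauss_mechanism p A b r \<in> P_OSS_Gauss p r B lm lp chi C kappa CX"
proof -
  define P where "P = gauss_mechanism p A b r"
  interpret L: prob_space "law P" unfolding P_def by (rule prob_space_law)
  note sets_law[of p A b r, folded P_def, measurable_cong]
  define S where "S = mat p p (\<lambda>(i, j). gram p A i j)"
  have S: "Sigma_mat p P = S" unfolding P_def S_def by (rule Sigma_mat_gauss_mechanism)
  have q: "quad_form p S u = (\<Sum>l<p. (\<Sum>i<p. u i * A i l)\<^sup>2)" for u
    unfolding S_def by (rule quad_form_gram)
  have dd: "distr (law P) borel (\<lambda>w. dot p u (fst w)) = centred_normal (quad_form p S u)" for u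
    unfolding P_def S_def by (rule distr_law_dot)
  have [simp]: "beta P = b" "noise_sd P = r" by (simp_all add: P_def gauss_mechanism_def)
  have dm[measurable]: "(\<lambda>w. dot p u (fst w)) \<in> borel_measurable (law P)" for u
    by measurable
  have m8: "has_bochner_integral (law P) (\<lambda>w. snd w ^ 8) (r ^ 8 * 105)"
    unfolding P_def using has_integral_std_normal_even[of 4]
    by (intro noise_power) (simp add: fact_numeral)
  have small: "measure (law P) {w \<in> space (law P). \<bar>dot p (fst w) u\<bar> \<le> t * sqrt (quad_form p S u)} \<le> (C * t) powr chi"
    if "0 < t" "\<exists>i<p. u i \<noteq> 0" for u t
  proof -
    have "0 < (\<Sum>i<p. (u i)\<^sup>2)" using that by (auto intro!: sum_pos2)
    then have qp: "0 < quad_form p S u" using lo[of u] lm mult_pos_pos[of lm "\<Sum>i<p. (u i)\<^sup>2"] unfolding q by linarith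
    have comm: "dot p (fst w) u = dot p u (fst w)" for w :: "rvec \<times> real"
      by (simp add: dot_def mult.commute)
    have "measure (law P) {w \<in> space (law P). \<bar>dot p (fst w) u\<bar> \<le> t * sqrt (quad_form p S u)}
        = measure (distr (law P) borel (\<lambda>w. dot p u (fst w))) {x. \<bar>x\<bar> \<le> t * sqrt (quad_form p S u)}"
      by (subst measure_distr) (auto intro!: arg_cong2[where f=measure] simp: comm)
    also have "\<dots> \<le> t" unfolding dd using qp that by (intro centred_normal_small_ball)
    finally have le_t: "measure (law P) {w \<in> space (law P). \<bar>dot p (fst w) u\<bar> \<le> t * sqrt (quad_form p S u)} \<le> t" .
    \<comment> \<open>The linear bound implies the one with exponent \<open>chi \<le> 1\<close>, as probabilities are at most one.\<close>
    show ?thesis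
    proof (cases "1 \<le> C * t")
      case True
      then have "1 \<le> (C * t) powr chi" using par by (intro ge_one_powr_ge_zero) auto
      then show ?thesis by (rule order_trans[OF L.prob_le_1])
    next
      case False
      have "t \<le> C * t" using par that by simp
      also have "\<dots> = (C * t) powr 1" using par that by simp
      also have "\<dots> \<le> (C * t) powr chi" using par that False by (intro powr_mono') auto
      finally show ?thesis using le_t by simp
    qed
  qed
  have psi: "psi2_norm_vec p (law P) fst \<le> ennreal CX"
    unfolding psi2_norm_vec_def
  proof (rule SUP_least)
    fix u assume "u \<in> {u \<in> space (Rp p). norm2 p u = 1}"
    then have "(\<Sum>i<p. (u i)\<^sup>2) = 1" by (simp add: norm2_def L2_set_def)
    then have v: "0 \<le> quad_form p S u" "quad_form p S u \<le> lp"
      using hi[of u] by (simp_all add: q sum_nonneg)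
    define c where "c = sqrt (8 * lp / 3)"
    have c: "0 < c" "c\<^sup>2 = 8 * lp / 3" using par by (simp_all add: c_def)
    have "(\<integral>\<^sup>+ w. ennreal (exp ((dot p u (fst w))\<^sup>2 / c\<^sup>2)) \<partial>law P)
        = (\<integral>\<^sup>+ x. ennreal (exp (x\<^sup>2 / c\<^sup>2)) \<partial>distr (law P) borel (\<lambda>w. dot p u (fst w)))"
      by (subst nn_integral_distr) auto
    also have "\<dots> \<le> 2" unfolding dd using c v by (intro centred_normal_exp_moment) auto
    finally have "c \<in> {c. 0 < c \<and> (\<integral>\<^sup>+ w. ennreal (exp ((dot p u (fst w))\<^sup>2 / c\<^sup>2)) \<partial>law P) \<le> 2}"
      using c(1) by blast
    then have "psi2_norm (law P) (\<lambda>w. dot p u (fst w)) \<le> ennreal c"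
      unfolding psi2_norm_def by (rule INF_lower)
    also have "\<dots> \<le> ennreal CX" using par by (intro ennreal_leI) (simp add: c_def)
    finally show "psi2_norm (law P) (\<lambda>w. dot p u (fst w)) \<le> ennreal CX" .
  qed
  have root8: "root 4 (\<integral> w. snd w ^ 8 \<partial>law P) \<le> kappa * r\<^sup>2"
  proof -
    have "(\<integral> w. snd w ^ 8 \<partial>law P) = 105 * (r\<^sup>2) ^ 4"
      using m8 by (simp add: has_bochner_integral_iff)
    moreover have "root 4 ((r\<^sup>2) ^ 4) = r\<^sup>2" by (rule real_root_power_cancel) auto
    ultimately have "root 4 (\<integral> w. snd w ^ 8 \<partial>law P) = root 4 105 * r\<^sup>2"
      by (simp only: real_root_mult)
    then show ?thesis using par by (simp add: mult_right_mono)
  qed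
  have spec: "lm \<le> lambda_min S" "lambda_min S \<le> lambda_max S" "lambda_max S \<le> lp"
    unfolding S_def using gram_spectrum[OF p lo hi ev] by auto
  have "P \<in> P_OSS_Gauss p r B lm lp chi C kappa CX"
    unfolding P_OSS_Gauss_def P_OSS_def mem_Collect_eq S
  proof (intro conjI)
    show "sets (law P) = sets (Rp p \<Otimes>\<^sub>M borel)" unfolding P_def by (rule sets_law)
    show "integrable (law P) (\<lambda>w. snd w ^ 8)" using m8 by (simp add: has_bochner_integral_iff)
    show "AE w in law P. cond_mean_X p P snd w = 0" unfolding P_def by (rule noise_cond_mean)
    show "AE w in law P. cond_var_X p P snd w = (noise_sd P)\<^sup>2"
      using noise_cond_var[of p A b r, folded P_def] by simp
    show "centred_normal_vec p S (law P) fst" unfolding centred_normal_vec_def using dd by simp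
    show "distr (law P) borel snd = centred_normal ((noise_sd P)\<^sup>2)"
      using distr_law_snd[of p A b r, folded P_def] distr_gauss_noise[of r p] r by simp
    show "L.indep_set (sets (sigma_X p P)) (sets (vimage_algebra (space (law P)) snd borel))"
      unfolding P_def by (rule indep_set_law)
    show "prob_space (law P)" by (rule L.prob_space_axioms)
    show "\<forall>u\<in>space (Rp p). \<forall>t>0. (\<exists>i<p. u i \<noteq> 0) \<longrightarrow>
        measure (law P) {w \<in> space (law P). \<bar>dot p (fst w) u\<bar> \<le> t * sqrt (quad_form p S u)}
          \<le> (C * t) powr chi"
      using small by blast
    show "psi2_norm_vec p (law P) fst \<le> ennreal CX" by (rule psi)
    show "root 4 (\<integral> w. snd w ^ 8 \<partial>law P) \<le> kappa * (noise_sd P)\<^sup>2" using root8 by simp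
    show "lm \<le> lambda_min S" "lambda_min S \<le> lambda_max S" "lambda_max S \<le> lp" by (rule spec)+
  qed (use b r in simp_all)
  then show ?thesis by (simp add: P_def)
qed

section \<open>Assouad's lemma for regression data\<close>

lemma kl_close_mono:
  assumes "kl_close M \<kappa> \<mu> \<nu>" "\<kappa> \<le> \<kappa>'"
  shows "kl_close M \<kappa>' \<mu> \<nu>"
proof -
  have "x \<le> \<kappa>'" if "x \<le> \<kappa>" for x using assms(2) that by simp
  with assms(1) show ?thesis unfolding kl_close_def by blast
qed

lemma sets_data_law: "sets (data_law p K Obs n N P) = sets (data_space p K Obs n N)"
  unfolding data_law_def data_space_def labelled_law_def unlabelled_law_def
  by (intro sets_pair_measure_cong sets_PiM_cong refl) simp_all

lemma kl_close_data_law: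
  assumes lab: "\<And>k. kl_close M (\<kappa> k) (labelled_law p (Obs k) P) (labelled_law p (Obs k) Q)"
    and unl: "kl_close M \<kappa>' (unlabelled_law p P) (unlabelled_law p Q)"
    and le: "(\<Sum>k<K. real (n k) * \<kappa> k) + real N * \<kappa>' \<le> \<kappa>''"
  shows "kl_close (PiM {..<K} (\<lambda>k. PiM {..<n k} (\<lambda>_. M)) \<Otimes>\<^sub>M PiM {..<N} (\<lambda>_. M)) \<kappa>''
     (data_law p K Obs n N P) (data_law p K Obs n N Q)"
proof -
  have "kl_close (PiM {..<n k} (\<lambda>_. M)) (\<Sum>i<n k. \<kappa> k)
      (PiM {..<n k} (\<lambda>_. labelled_law p (Obs k) P)) (PiM {..<n k} (\<lambda>_. labelled_law p (Obs k) Q))" for k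
    by (rule kl_close_PiM) (auto intro: lab)
  then have 1: "kl_close (PiM {..<K} (\<lambda>k. PiM {..<n k} (\<lambda>_. M))) (\<Sum>k<K. \<Sum>i<n k. \<kappa> k)
      (PiM {..<K} (\<lambda>k. PiM {..<n k} (\<lambda>_. labelled_law p (Obs k) P)))
      (PiM {..<K} (\<lambda>k. PiM {..<n k} (\<lambda>_. labelled_law p (Obs k) Q)))"
    by (rule kl_close_PiM[rotated]) simp
  have 2: "kl_close (PiM {..<N} (\<lambda>_. M)) (\<Sum>i<N. \<kappa>')
      (PiM {..<N} (\<lambda>_. unlabelled_law p P)) (PiM {..<N} (\<lambda>_. unlabelled_law p Q))"
    by (rule kl_close_PiM) (auto intro: unl)
  show ?thesis
    unfolding data_law_def
    by (rule kl_close_mono[OF kl_close_pair[OF 1 2]]) (use le in simp)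
qed

text \<open>Pairs each vertex of the cube with its neighbour in direction \<open>j\<close>.\<close>

lemma sum_Pow_split:
  fixes f :: "'a set \<Rightarrow> ennreal"
  assumes "finite J" "j \<in> J"
  shows "(\<Sum>S\<in>Pow J. f S) = (\<Sum>S\<in>Pow (J - {j}). f S + f (insert j S))"
proof -
  have J: "Pow J = Pow (J - {j}) \<union> insert j ` Pow (J - {j})"
    using Pow_insert[of j "J - {j}"] assms(2) by (simp add: insert_absorb)
  have "(\<Sum>S\<in>Pow J. f S) = (\<Sum>S\<in>Pow (J - {j}). f S) + (\<Sum>S\<in>insert j ` Pow (J - {j}). f S)"
    unfolding J using assms(1) by (intro sum.union_disjoint) auto
  also have "(\<Sum>S\<in>insert j ` Pow (J - {j}). f S) = (\<Sum>S\<in>Pow (J - {j}). f (insert j S))"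
    by (subst sum.reindex) (auto intro!: inj_onI)
  finally show ?thesis by (simp add: sum.distrib)
qed

text \<open>
  The supremum of the risks is at least their average over the cube. The squared loss is a sum over
  coordinates, and for each coordinate the vertices are paired along the edges in that direction;
  each edge is a testing problem between \<open>d\<close> and \<open>-d\<close>.
\<close>

lemma assouad:
  fixes Pm :: "nat set \<Rightarrow> mechanism" and M :: "nat set \<Rightarrow> nat \<Rightarrow> 'm measure"
  assumes J: "J \<subseteq> {..<p}"
    and G: "\<G> \<subseteq> \<P>" "\<And>S. S \<subseteq> J \<Longrightarrow> Pm S \<in> \<G>"
    and b: "b \<in> estimators p K Obs n N \<P>"
    and betaJ: "\<And>S j. S \<subseteq> J \<Longrightarrow> j \<in> J \<Longrightarrow> beta (Pm S) j = (if j \<in> S then d else - d)"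
    and beta_out: "\<And>S i. S \<subseteq> J \<Longrightarrow> i < p \<Longrightarrow> i \<notin> J \<Longrightarrow> beta (Pm S) i = c i"
    and kl: "\<And>S j. S \<subseteq> J \<Longrightarrow> j \<in> J \<Longrightarrow> j \<notin> S \<Longrightarrow>
      kl_close (M S j) \<kappa> (data_law p K Obs n N (Pm S)) (data_law p K Obs n N (Pm (insert j S)))"
  shows "ennreal (real (card J) * d\<^sup>2 * exp (- \<kappa>) / 2) \<le> (SUP P\<in>\<G>. risk p K Obs n N b P)"
proof (cases "d = 0")
  case True
  then show ?thesis by simp
next
  case False
  let ?D = "data_space p K Obs n N"
  let ?\<mu> = "\<lambda>S. data_law p K Obs n N (Pm S)"
  have fJ: "finite J" using J finite_subset by blast
  have loss2: "(loss p v w)\<^sup>2 = (\<Sum>i<p. (v i - w i)\<^sup>2)" for v w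
    by (simp add: loss_def norm2_def L2_set_def sum_nonneg)
  have lm: "(\<lambda>x. loss p (b x) (beta (Pm S))) \<in> borel_measurable ?D" if "S \<subseteq> J" for S
  proof -
    have "Pm S \<in> \<P>" using G that by blast
    then show ?thesis using b by (simp add: estimators_def)
  qed
  \<comment> \<open>Estimators are only known to have measurable losses. The coordinate is recovered from the losses
    against two parameters that differ in coordinate \<open>j\<close> alone.\<close>
  have bm: "(\<lambda>x. b x j) \<in> borel_measurable ?D" if j: "j \<in> J" for j
  proof -
    have jp: "j \<in> {..<p}" using j J by auto
    have "b x j = ((loss p (b x) (beta (Pm {})))\<^sup>2 - (loss p (b x) (beta (Pm {j})))\<^sup>2) / (4 * d)" for x
    proof -
      have "(\<Sum>i\<in>{..<p}-{j}. (b x i - beta (Pm {}) i)\<^sup>2) = (\<Sum>i\<in>{..<p}-{j}. (b x i - beta (Pm {j}) i)\<^sup>2)"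
      proof (rule sum.cong)
        fix i assume i: "i \<in> {..<p} - {j}"
        have "beta (Pm {}) i = beta (Pm {j}) i"
          using i j betaJ[of "{}" i] betaJ[of "{j}" i] beta_out[of "{}" i] beta_out[of "{j}" i]
          by (cases "i \<in> J") auto
        then show "(b x i - beta (Pm {}) i)\<^sup>2 = (b x i - beta (Pm {j}) i)\<^sup>2" by simp
      qed simp
      then have "(loss p (b x) (beta (Pm {})))\<^sup>2 - (loss p (b x) (beta (Pm {j})))\<^sup>2
          = (b x j - beta (Pm {}) j)\<^sup>2 - (b x j - beta (Pm {j}) j)\<^sup>2"
        unfolding loss2 by (simp add: sum.remove[OF _ jp])
      also have "\<dots> = 4 * d * b x j"
        using betaJ[of "{}" j] betaJ[of "{j}" j] j by (simp add: power2_eq_square algebra_simps)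
      finally show ?thesis using False by simp
    qed
    then have "(\<lambda>x. b x j) = (\<lambda>x. ((loss p (b x) (beta (Pm {})))\<^sup>2 - (loss p (b x) (beta (Pm {j})))\<^sup>2) / (4 * d))"
      by (rule ext)
    also have "\<dots> \<in> borel_measurable ?D"
      using lm[of "{}"] lm[of "{j}"] j
      by (intro borel_measurable_divide borel_measurable_diff borel_measurable_power borel_measurable_const) auto
    finally show ?thesis .
  qed
  have bm': "(\<lambda>x. (b x j - e)\<^sup>2) \<in> borel_measurable (?\<mu> S)" if "j \<in> J" for j e S
    unfolding measurable_cong_sets[OF sets_data_law refl]
    by (intro borel_measurable_power borel_measurable_diff borel_measurable_const bm that)
  define r where "r S j = (\<integral>\<^sup>+ x. ennreal ((b x j - (if j \<in> S then d else - d))\<^sup>2) \<partial>?\<mu> S)" for S j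
  have risk_ge: "(\<Sum>j\<in>J. r S j) \<le> risk p K Obs n N b (Pm S)" if S: "S \<subseteq> J" for S
  proof -
    have "(\<Sum>j\<in>J. r S j) = (\<integral>\<^sup>+ x. (\<Sum>j\<in>J. ennreal ((b x j - (if j \<in> S then d else - d))\<^sup>2)) \<partial>?\<mu> S)"
      unfolding r_def using bm' by (subst nn_integral_sum) auto
    also have "\<dots> \<le> risk p K Obs n N b (Pm S)"
      unfolding risk_def
    proof (intro nn_integral_mono)
      fix x
      have "(\<Sum>j\<in>J. (b x j - (if j \<in> S then d else - d))\<^sup>2) = (\<Sum>j\<in>J. (b x j - beta (Pm S) j)\<^sup>2)"
        using betaJ[OF S] by (intro sum.cong) auto
      also have "\<dots> \<le> (\<Sum>j<p. (b x j - beta (Pm S) j)\<^sup>2)"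
        using J by (intro sum_mono2) auto
      finally show "(\<Sum>j\<in>J. ennreal ((b x j - (if j \<in> S then d else - d))\<^sup>2))
          \<le> ennreal ((loss p (b x) (beta (Pm S)))\<^sup>2)"
        unfolding loss2 by (subst sum_ennreal) (auto intro: ennreal_leI)
    qed
    finally show ?thesis .
  qed
  have pair: "ennreal (d\<^sup>2 * exp (- \<kappa>)) \<le> r S j + r (insert j S) j" if S: "S \<subseteq> J" and j: "j \<in> J" "j \<notin> S" for S j
  proof -
    have "ennreal (2 * d\<^sup>2 / 2 * exp (- \<kappa>))
        \<le> (\<integral>\<^sup>+ x. ennreal ((b x j - (- d))\<^sup>2) \<partial>?\<mu> S) + (\<integral>\<^sup>+ x. ennreal ((b x j - d)\<^sup>2) \<partial>?\<mu> (insert j S))"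
    proof (rule kl_close_two_point[OF kl[OF S j]])
      fix x
      have "(b x j - (- d))\<^sup>2 + (b x j - d)\<^sup>2 = 2 * d\<^sup>2 + 2 * (b x j)\<^sup>2"
        by (simp add: power2_eq_square algebra_simps)
      then show "2 * d\<^sup>2 \<le> (b x j - (- d))\<^sup>2 + (b x j - d)\<^sup>2" by simp
      show "(\<lambda>x. (b x j - (- d))\<^sup>2) \<in> borel_measurable (?\<mu> S)"
        "(\<lambda>x. (b x j - d)\<^sup>2) \<in> borel_measurable (?\<mu> S)" by (rule bm'[OF j(1)])+
    qed auto
    then show ?thesis using j by (simp add: r_def)
  qed
  let ?s = "SUP P\<in>\<G>. risk p K Obs n N b P"
  have "ennreal (real (card J) * (2 ^ (card J - 1) * (d\<^sup>2 * exp (- \<kappa>))))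
      = (\<Sum>j\<in>J. \<Sum>S\<in>Pow (J - {j}). ennreal (d\<^sup>2 * exp (- \<kappa>)))"
    using fJ by (simp add: card_Pow ennreal_mult' ennreal_of_nat_eq_real_of_nat ennreal_power[symmetric] del: ennreal_power)
  also have "\<dots> \<le> (\<Sum>j\<in>J. \<Sum>S\<in>Pow (J - {j}). r S j + r (insert j S) j)"
    by (intro sum_mono pair) auto
  also have "\<dots> = (\<Sum>j\<in>J. \<Sum>S\<in>Pow J. r S j)"
    using fJ by (intro sum.cong refl sum_Pow_split[symmetric])
  also have "\<dots> = (\<Sum>S\<in>Pow J. \<Sum>j\<in>J. r S j)" by (rule sum.swap)
  also have "\<dots> \<le> (\<Sum>S\<in>Pow J. ?s)"
  proof (intro sum_mono)
    fix S assume "S \<in> Pow J"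
    then have S: "S \<subseteq> J" by simp
    show "(\<Sum>j\<in>J. r S j) \<le> ?s" by (rule order_trans[OF risk_ge[OF S]]) (rule SUP_upper[OF G(2)[OF S]])
  qed
  also have "\<dots> = ennreal (2 ^ card J) * ?s"
    using fJ by (simp add: card_Pow ennreal_of_nat_eq_real_of_nat ennreal_power[symmetric] del: ennreal_power)
  finally have main: "ennreal (real (card J) * (2 ^ (card J - 1) * (d\<^sup>2 * exp (- \<kappa>)))) \<le> ennreal (2 ^ card J) * ?s" .
  show ?thesis
  proof (cases "?s = \<top>")
    case True then show ?thesis by (simp only: top_greatest)
  next
    case fin: False
    then obtain s where s: "?s = ennreal s" "0 \<le> s" by (cases ?s rule: ennreal_cases) blast+
    have le: "real (card J) * (2 ^ (card J - 1) * (d\<^sup>2 * exp (- \<kappa>))) \<le> 2 ^ card J * s"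
      using main s(2) unfolding s(1) by (simp add: ennreal_mult[symmetric])
    have "real (card J) * d\<^sup>2 * exp (- \<kappa>) / 2 \<le> s"
    proof (cases "card J = 0")
      case True then show ?thesis using s by simp
    next
      case False
      then have "(2::real) ^ card J = 2 * 2 ^ (card J - 1)" by (cases "card J") auto
      with le have "2 ^ (card J - 1) * (real (card J) * d\<^sup>2 * exp (- \<kappa>)) \<le> 2 ^ (card J - 1) * (2 * s)"
        by (simp add: mult_ac)
      then show ?thesis by simp
    qed
    then show ?thesis unfolding s(1) by (rule ennreal_leI)
  qed
qed

definition obs_map :: "nat \<Rightarrow> (nat \<Rightarrow> nat \<Rightarrow> real) \<Rightarrow> rvec \<Rightarrow> real \<Rightarrow> nat set \<Rightarrow> rvec \<Rightarrow> rvec \<times> real" where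
  "obs_map p A b r V z = (restrict (lin p A z) V, dot p (lin p A z) b + r * z p)"

lemma dot_commute: "dot p u v = dot p v u"
  by (simp add: dot_def mult.commute)

lemma measurable_observe:
  assumes "V \<subseteq> {..<p}"
  shows "(\<lambda>(x, e). (restrict x V, dot p x b + e)) \<in> measurable (Rp p \<Otimes>\<^sub>M borel) (vec_space V \<Otimes>\<^sub>M borel)"
proof -
  have [measurable]: "(\<lambda>x. restrict x V) \<in> measurable (Rp p) (vec_space V)"
    unfolding vec_space_def using assms by (rule measurable_restrict_subset)
  show ?thesis unfolding case_prod_beta' by (subst dot_commute) measurable
qed

lemma labelled_law_gauss_mechanism:
  assumes "V \<subseteq> {..<p}"
  shows "labelled_law p V (gauss_mechanism p A b r)
    = distr (gauss (Suc p)) (vec_space V \<Otimes>\<^sub>M borel) (obs_map p A b r V)"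
  unfolding labelled_law_def law_gauss_mechanism
  by (subst distr_distr[OF measurable_observe[OF assms]])
     (auto simp: comp_def gauss_mechanism_def obs_map_def[abs_def])

lemma measurable_obs_map[measurable]:
  assumes "V \<subseteq> {..<p}"
  shows "obs_map p A b r V \<in> measurable (gauss (Suc p)) (vec_space V \<Otimes>\<^sub>M borel)"
  using measurable_compose[OF measurable_lin_noise measurable_observe[OF assms]]
  by (simp add: obs_map_def[abs_def])

lemma unlabelled_law_gauss_mechanism:
  "unlabelled_law p (gauss_mechanism p A b r) = distr (gauss (Suc p)) (Rp p) (lin p A)"
  unfolding unlabelled_law_def by (rule distr_law_fst)

text \<open>
  Observed sets of indices \<open>k \<ge> K\<close> are arbitrary. After the restriction, closeness can be stated for
  all \<open>k\<close>, as the closure under products asks for.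
\<close>

lemma data_law_restrict_Obs:
  assumes "\<And>k. k < K \<Longrightarrow> Obs k \<subseteq> {..<p}"
  shows "data_law p K Obs n N P = data_law p K (\<lambda>k. Obs k \<inter> {..<p}) n N P"
proof -
  have "Obs k \<inter> {..<p} = Obs k" if "k < K" for k using assms[OF that] by auto
  then have "PiM {..<K} (\<lambda>k. PiM {..<n k} (\<lambda>_. labelled_law p (Obs k) P))
    = PiM {..<K} (\<lambda>k. PiM {..<n k} (\<lambda>_. labelled_law p (Obs k \<inter> {..<p}) P))"
    by (intro PiM_cong) auto
  then show ?thesis by (simp add: data_law_def)
qed

lemma gram_row:
  "(\<Sum>j<p. gram p A i j * e j) = (\<Sum>l<p. A i l * (\<Sum>j<p. e j * A j l))"
proof -
  have "(\<Sum>j<p. gram p A i j * e j) = (\<Sum>j<p. \<Sum>l<p. A i l * (e j * A j l))"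
    by (simp add: gram_def sum_distrib_right sum_distrib_left mult_ac)
  also have "\<dots> = (\<Sum>l<p. \<Sum>j<p. A i l * (e j * A j l))" by (rule sum.swap)
  finally show ?thesis by (simp add: sum_distrib_left)
qed

definition sgn_in :: "nat set \<Rightarrow> nat \<Rightarrow> real" where
  "sgn_in S j = (if j \<in> S then 1 else - 1)"

lemma sgn_in_square[simp]: "sgn_in S j * sgn_in S j = 1" "(sgn_in S j)\<^sup>2 = 1"
  by (simp_all add: sgn_in_def)

lemma sgn_in_insert: "sgn_in (insert j S) i = (if i = j then 1 else sgn_in S i)"
  by (simp add: sgn_in_def)

lemma norm2_le_iff: "0 \<le> B \<Longrightarrow> norm2 p v \<le> B \<longleftrightarrow> (\<Sum>i<p. (v i)\<^sup>2) \<le> B\<^sup>2"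
  by (simp add: norm2_def L2_set_def real_sqrt_le_iff' real_le_lsqrt sum_nonneg)

section \<open>Isotropic covariates\<close>

definition iso_root :: "real \<Rightarrow> nat \<Rightarrow> nat \<Rightarrow> real" where
  "iso_root v i l = (if i = l then sqrt v else 0)"

definition cube_beta :: "nat \<Rightarrow> real \<Rightarrow> nat set \<Rightarrow> rvec" where
  "cube_beta p d S = (\<lambda>i\<in>{..<p}. sgn_in S i * d)"

lemma lin_iso: "i < p \<Longrightarrow> lin p (iso_root v) z i = sqrt v * z i"
  by (simp add: lin_def iso_root_def if_distrib[of "\<lambda>x. x * _"] cong: if_cong)

lemma iso_column: "l < p \<Longrightarrow> (\<Sum>i<p. u i * iso_root v i l) = sqrt v * u l"
  by (simp add: iso_root_def if_distrib[of "\<lambda>x. _ * x"] mult.commute cong: if_cong)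

lemma response_iso:
  "dot p (lin p (iso_root v) z) (cube_beta p d S) = (\<Sum>i<p. sqrt v * z i * (sgn_in S i * d))"
  unfolding dot_def by (intro sum.cong) (auto simp: lin_iso cube_beta_def)

lemma iso_mechanism_in_class:
  assumes p: "0 < p" and lm: "0 < lm" "lm \<le> lp" and r: "0 < r" and B: "0 \<le> B" "real p * d\<^sup>2 \<le> B\<^sup>2"
    and par: "0 < chi" "chi \<le> 1" "1 \<le> C" "root 4 105 \<le> kappa" "sqrt (8 * lp / 3) \<le> CX"
  shows "gauss_mechanism p (iso_root lm) (cube_beta p d S) r \<in> P_OSS_Gauss p r B lm lp chi C kappa CX"
proof (rule gauss_mechanism_in_class[OF p lm(1) r])
  have q: "(\<Sum>l<p. (\<Sum>i<p. u i * iso_root lm i l)\<^sup>2) = lm * (\<Sum>i<p. (u i)\<^sup>2)" for u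
    using lm by (simp add: iso_column power_mult_distrib sum_distrib_left)
  show "lm * (\<Sum>i<p. (u i)\<^sup>2) \<le> (\<Sum>l<p. (\<Sum>i<p. u i * iso_root lm i l)\<^sup>2)" for u
    by (simp add: q)
  show "(\<Sum>l<p. (\<Sum>i<p. u i * iso_root lm i l)\<^sup>2) \<le> lp * (\<Sum>i<p. (u i)\<^sup>2)" for u
    unfolding q using lm by (intro mult_right_mono sum_nonneg) auto
  show "\<exists>i<p. (\<lambda>_. 1::real) i \<noteq> 0" using p by auto
  show "(\<Sum>j<p. gram p (iso_root lm) i j * 1) = lm * 1" if "i < p" for i
  proof -
    have "(\<Sum>j<p. gram p (iso_root lm) i j * 1) = (\<Sum>l<p. iso_root lm i l * sqrt lm)"
      unfolding gram_row by (intro sum.cong refl) (simp only: iso_column lessThan_iff mult_1_right)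
    also have "\<dots> = lm" using that lm
      by (simp add: iso_root_def if_distrib[of "\<lambda>x. x * _"] cong: if_cong)
    finally show ?thesis by simp
  qed
  show "cube_beta p d S \<in> space (Rp p)"
    by (simp add: cube_beta_def vec_space_def space_PiM)
  show "norm2 p (cube_beta p d S) \<le> B"
    using B by (simp add: norm2_le_iff cube_beta_def power_mult_distrib)
qed (use par lm in auto)

text \<open>
  If \<open>j\<close> is missing, then \<open>z\<^sub>j\<close> enters the response only, and replacing it by \<open>- z\<^sub>j\<close> undoes the change
  of sign. If \<open>j\<close> is observed, then the noise has to absorb the change \<open>2 d \<surd>v z\<^sub>j\<close> of the response.
\<close>

lemma iso_labelled_close:
  assumes V: "V \<subseteq> {..<p}" and p: "2 \<le> p" and j: "j < p" "j \<notin> S" and r: "0 < r" and v: "0 \<le> v"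
  shows "kl_close (gauss (Suc p)) (if j \<in> V then 2 * d\<^sup>2 * v / r\<^sup>2 else 0)
     (labelled_law p V (gauss_mechanism p (iso_root v) (cube_beta p d S) r))
     (labelled_law p V (gauss_mechanism p (iso_root v) (cube_beta p d (insert j S)) r))"
proof -
  let ?T = "\<lambda>S. obs_map p (iso_root v) (cube_beta p d S) r V"
  have split: "(\<Sum>i<p. f i) = f j + (\<Sum>i\<in>{..<p}-{j}. f i)" for f :: "nat \<Rightarrow> real"
    using j by (intro sum.remove) auto
  have rest: "(\<Sum>i\<in>{..<p}-{j}. sqrt v * z' i * (sgn_in S i * d)) = (\<Sum>i\<in>{..<p}-{j}. sqrt v * z i * (sgn_in (insert j S) i * d))"
    if "\<And>i. i < p \<Longrightarrow> i \<noteq> j \<Longrightarrow> z' i = z i" for z z' :: rvec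
    using that by (intro sum.cong) (auto simp: sgn_in_insert)
  show ?thesis
  proof (cases "j \<in> V")
    case False
    have "?T (insert j S) z = ?T S (z(j := - z j))" for z
    proof -
      have "restrict (lin p (iso_root v) z) V = restrict (lin p (iso_root v) (z(j := - z j))) V"
        using V False by (auto simp: fun_eq_iff restrict_def lin_iso subset_iff)
      moreover have "dot p (lin p (iso_root v) z) (cube_beta p d (insert j S))
          = dot p (lin p (iso_root v) (z(j := - z j))) (cube_beta p d S)"
        using j rest[of "z(j := - z j)" z] unfolding response_iso split
        by (simp add: sgn_in_def)
      ultimately show ?thesis using j by (simp add: obs_map_def)
    qed
    then have "?T (insert j S) = (\<lambda>z. ?T S (z(j := - z j)))" by (rule ext)
    then show ?thesis
      unfolding labelled_law_gauss_mechanism[OF V]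
      using kl_close_flip[of j "Suc p", OF _ measurable_obs_map[OF V]] j False by simp
  next
    case True
    \<comment> \<open>Any index other than \<open>j\<close> serves, since it is moved by the factor \<open>0\<close>.\<close>
    define i where "i = (if j = 0 then 1 else 0 :: nat)"
    have i: "i < p" "i \<noteq> j" using p by (auto simp: i_def)
    define e where "e = 2 * d * sqrt v / r"
    have "?T (insert j S) z = ?T S (shear j i p 0 e z)" for z
    proof -
      define z' where "z' = shear j i p 0 e z"
      have z': "z' l = z l" if "l < p" for l using that by (auto simp: z'_def shear_def)
      have z'p: "z' p = z p + e * z j" using i by (simp add: z'_def shear_def)
      have "restrict (lin p (iso_root v) z) V = restrict (lin p (iso_root v) z') V"
        using V z' by (auto simp: fun_eq_iff restrict_def lin_iso subset_iff)
      moreover have "dot p (lin p (iso_root v) z) (cube_beta p d (insert j S)) + r * z p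
          = dot p (lin p (iso_root v) z') (cube_beta p d S) + r * z' p"
        using j rest[of z' z] r unfolding response_iso split
        by (simp add: sgn_in_def z' z'p e_def field_simps)
      ultimately show ?thesis by (simp add: obs_map_def z'_def)
    qed
    then have eq: "?T (insert j S) = (\<lambda>z. ?T S (shear j i p 0 e z))" by (rule ext)
    have "kl_close (gauss (Suc p)) ((0\<^sup>2 + e\<^sup>2) / 2)
        (distr (gauss (Suc p)) (vec_space V \<Otimes>\<^sub>M borel) (?T S))
        (distr (gauss (Suc p)) (vec_space V \<Otimes>\<^sub>M borel) (\<lambda>z. ?T S (shear j i p 0 e z)))"
      using i j by (intro kl_close_shear measurable_obs_map V) auto
    moreover have "(0\<^sup>2 + e\<^sup>2) / 2 = 2 * d\<^sup>2 * v / r\<^sup>2"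
      using v by (simp add: e_def power_divide power_mult_distrib)
    ultimately show ?thesis
      unfolding labelled_law_gauss_mechanism[OF V] eq by (simp only: True if_True)
  qed
qed

lemma complete_case_lower_bound:
  assumes p: "2 \<le> p" and Obs: "\<And>k. k < K \<Longrightarrow> Obs k \<subseteq> {..<p}"
    and lm: "0 < lm" "lm \<le> lp" and r: "0 < r" and B: "0 \<le> B" "real p * d\<^sup>2 \<le> B\<^sup>2"
    and par: "0 < chi" "chi \<le> 1" "1 \<le> C" "root 4 105 \<le> kappa" "sqrt (8 * lp / 3) \<le> CX"
    and H: "\<And>j. j < p \<Longrightarrow> real (\<Sum>k<K. if j \<in> Obs k then n k else 0) \<le> H"
    and \<kappa>: "2 * d\<^sup>2 * lm / r\<^sup>2 * H \<le> \<kappa>"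
    and b: "b \<in> estimators p K Obs n N (P_OSS p r B lm lp chi C kappa CX)"
  shows "ennreal (real p * d\<^sup>2 * exp (- \<kappa>) / 2)
    \<le> (SUP P\<in>P_OSS_Gauss p r B lm lp chi C kappa CX. risk p K Obs n N b P)"
proof -
  let ?P = "\<lambda>S. gauss_mechanism p (iso_root lm) (cube_beta p d S) r"
  let ?M = "PiM {..<K} (\<lambda>k. PiM {..<n k} (\<lambda>_. gauss (Suc p))) \<Otimes>\<^sub>M PiM {..<N} (\<lambda>_. gauss (Suc p))"
  have "ennreal (real (card {..<p}) * d\<^sup>2 * exp (- \<kappa>) / 2)
    \<le> (SUP P\<in>P_OSS_Gauss p r B lm lp chi C kappa CX. risk p K Obs n N b P)"
  proof (rule assouad[where Pm = ?P and M = "\<lambda>_ _. ?M" and c = "\<lambda>_. 0"])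
    show "P_OSS_Gauss p r B lm lp chi C kappa CX \<subseteq> P_OSS p r B lm lp chi C kappa CX"
      by (auto simp: P_OSS_Gauss_def)
    show "?P S \<in> P_OSS_Gauss p r B lm lp chi C kappa CX" for S
      using p by (intro iso_mechanism_in_class lm r B par) auto
    show "beta (?P S) j = (if j \<in> S then d else - d)" if "j \<in> {..<p}" for S j
      using that by (simp add: gauss_mechanism_def cube_beta_def sgn_in_def)
    fix S j assume j: "j \<in> {..<p}" "j \<notin> S"
    let ?\<kappa> = "\<lambda>k. if j \<in> Obs k \<inter> {..<p} then 2 * d\<^sup>2 * lm / r\<^sup>2 else 0"
    have "kl_close ?M \<kappa> (data_law p K (\<lambda>k. Obs k \<inter> {..<p}) n N (?P S))
        (data_law p K (\<lambda>k. Obs k \<inter> {..<p}) n N (?P (insert j S)))"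
    proof (rule kl_close_data_law)
      show "kl_close (gauss (Suc p)) (?\<kappa> k) (labelled_law p (Obs k \<inter> {..<p}) (?P S))
          (labelled_law p (Obs k \<inter> {..<p}) (?P (insert j S)))" for k
        using j p r lm by (intro iso_labelled_close) auto
      show "kl_close (gauss (Suc p)) 0 (unlabelled_law p (?P S)) (unlabelled_law p (?P (insert j S)))"
        unfolding unlabelled_law_gauss_mechanism by (intro kl_close_refl measurable_lin)
      have "(\<Sum>k<K. real (n k) * ?\<kappa> k) = (\<Sum>k<K. 2 * d\<^sup>2 * lm / r\<^sup>2 * real (if j \<in> Obs k then n k else 0))"
        using j by (intro sum.cong) auto
      also have "\<dots> = 2 * d\<^sup>2 * lm / r\<^sup>2 * real (\<Sum>k<K. if j \<in> Obs k then n k else 0)"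
        by (simp only: of_nat_sum sum_distrib_left)
      also have "\<dots> \<le> 2 * d\<^sup>2 * lm / r\<^sup>2 * H"
        using H[of j] j lm by (intro mult_left_mono) auto
      finally show "(\<Sum>k<K. real (n k) * ?\<kappa> k) + real N * 0 \<le> \<kappa>" using \<kappa> by simp
    qed
    then show "kl_close ?M \<kappa> (data_law p K Obs n N (?P S)) (data_law p K Obs n N (?P (insert j S)))"
      by (simp only: data_law_restrict_Obs[OF Obs])
  qed (use b in auto)
  then show ?thesis by simp
qed

section \<open>Cross-covariances hidden from incomplete samples\<close>

text \<open>
  A square root of \<open>v I - t \<Sum>\<^sub>j s\<^sub>j (e\<^sub>i\<^sub>0 e\<^sub>j\<^sup>T + e\<^sub>j e\<^sub>i\<^sub>0\<^sup>T)\<close> with signs \<open>s\<^sub>j\<close>: all covariates but \<open>X\<^sub>i\<^sub>0\<close> are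
  independent, and \<open>X\<^sub>i\<^sub>0\<close> is regressed on them with residual variance \<open>a\<close>. The variance \<open>v\<close> of \<open>X\<^sub>i\<^sub>0\<close>
  fixes \<open>a = v - card J t\<^sup>2 / v\<close>.
\<close>

definition cross_root :: "nat \<Rightarrow> nat set \<Rightarrow> real \<Rightarrow> real \<Rightarrow> real \<Rightarrow> nat set \<Rightarrow> nat \<Rightarrow> nat \<Rightarrow> real" where
  "cross_root i0 J v a t S i l =
     (if i = i0 then if l = i0 then sqrt a else if l \<in> J then - (t / sqrt v) * sgn_in S l else 0
      else if l = i then sqrt v else 0)"

text \<open>
  The entries with indices in \<open>J\<close> solve \<open>Cov(X\<^sub>j, Y) = 0\<close>.
\<close>

definition cross_beta :: "nat \<Rightarrow> nat \<Rightarrow> nat set \<Rightarrow> real \<Rightarrow> real \<Rightarrow> real \<Rightarrow> nat set \<Rightarrow> rvec" where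
  "cross_beta p i0 J v t c S =
     (\<lambda>i\<in>{..<p}. if i = i0 then c else if i \<in> J then sgn_in S i * (t * c / v) else 0)"

context
  fixes p i0 :: nat and J :: "nat set" and v a t :: real
  assumes i0: "i0 < p" and J: "J \<subseteq> {..<p} - {i0}" and v: "0 < v" and a: "0 < a"
    and av: "a = v - real (card J) * t\<^sup>2 / v"
begin

lemma finite_J: "finite J"
  using J by (meson finite_Diff finite_lessThan finite_subset)

lemma sum_split_i0: "(\<Sum>i<p. f i) = f i0 + (\<Sum>i\<in>{..<p}-{i0}. f i)" for f :: "nat \<Rightarrow> real"
  using i0 by (intro sum.remove) auto

lemma sum_J: "(\<Sum>i\<in>{..<p}-{i0}. if i \<in> J then f i else 0) = (\<Sum>i\<in>J. f i)" for f :: "nat \<Rightarrow> real"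
  using J by (simp add: sum.If_cases Int_absorb1)

lemma lin_cross_i0:
  "lin p (cross_root i0 J v a t S) z i0 = sqrt a * z i0 - t / sqrt v * (\<Sum>l\<in>J. sgn_in S l * z l)"
proof -
  have "lin p (cross_root i0 J v a t S) z i0 = (\<Sum>l<p. cross_root i0 J v a t S i0 l * z l)"
    using i0 by (simp add: lin_def)
  also have "\<dots> = cross_root i0 J v a t S i0 i0 * z i0 + (\<Sum>l\<in>{..<p}-{i0}. cross_root i0 J v a t S i0 l * z l)"
    by (rule sum_split_i0)
  also have "(\<Sum>l\<in>{..<p}-{i0}. cross_root i0 J v a t S i0 l * z l)
      = (\<Sum>l\<in>{..<p}-{i0}. if l \<in> J then - (t / sqrt v) * (sgn_in S l * z l) else 0)"
    by (intro sum.cong) (auto simp: cross_root_def)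
  also have "\<dots> = - (t / sqrt v) * (\<Sum>l\<in>J. sgn_in S l * z l)"
    unfolding sum_J sum_distrib_left ..
  also have "cross_root i0 J v a t S i0 i0 = sqrt a" by (simp add: cross_root_def)
  finally show ?thesis by simp
qed

lemma lin_cross_other:
  assumes "i < p" "i \<noteq> i0"
  shows "lin p (cross_root i0 J v a t S) z i = sqrt v * z i"
  using assms by (simp add: lin_def cross_root_def if_distrib[of "\<lambda>x. x * _"] cong: if_cong)

lemma cross_column:
  assumes l: "l < p"
  shows "(\<Sum>i<p. u i * cross_root i0 J v a t S i l)
    = (if l = i0 then sqrt a * u i0 else sqrt v * u l - (if l \<in> J then t / sqrt v * sgn_in S l * u i0 else 0))"
proof -
  have "(\<Sum>i\<in>{..<p}-{i0}. u i * cross_root i0 J v a t S i l)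
      = (\<Sum>i\<in>{..<p}-{i0}. if i = l then sqrt v * u i else 0)"
    by (intro sum.cong) (auto simp: cross_root_def)
  also have "\<dots> = (if l = i0 then 0 else sqrt v * u l)"
    using l by (auto simp: sum.delta)
  finally show ?thesis unfolding sum_split_i0 by (simp add: cross_root_def)
qed

text \<open>
  The signal contains \<open>X\<^sub>i\<^sub>0\<close> only through its residual \<open>\<surd>a z\<^sub>i\<^sub>0\<close>; hence it does not depend on \<open>S\<close>.
\<close>

lemma response_cross:
  "dot p (lin p (cross_root i0 J v a t S) z) (cross_beta p i0 J v t c S) = c * sqrt a * z i0"
proof -
  have "(\<Sum>i\<in>{..<p}-{i0}. lin p (cross_root i0 J v a t S) z i * cross_beta p i0 J v t c S i)
      = (\<Sum>i\<in>{..<p}-{i0}. if i \<in> J then c * (t / sqrt v) * (sgn_in S i * z i) else 0)"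
  proof (intro sum.cong refl)
    fix i assume i: "i \<in> {..<p}-{i0}"
    have "sqrt v / v = 1 / sqrt v" using v by (simp add: field_simps)
    then have "sqrt v * z i * (sgn_in S i * (t * c / v)) = c * (t / sqrt v) * (sgn_in S i * z i)"
      using v by (simp add: field_simps)
    then show "lin p (cross_root i0 J v a t S) z i * cross_beta p i0 J v t c S i
        = (if i \<in> J then c * (t / sqrt v) * (sgn_in S i * z i) else 0)"
      using i by (simp add: lin_cross_other cross_beta_def)
  qed
  also have "\<dots> = c * (t / sqrt v) * (\<Sum>i\<in>J. sgn_in S i * z i)"
    unfolding sum_J by (simp add: sum_distrib_left)
  finally show ?thesis
    unfolding dot_def sum_split_i0 using i0
    by (simp add: lin_cross_i0 cross_beta_def algebra_simps)
qed

lemma cross_form: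
  "(\<Sum>l<p. (\<Sum>i<p. u i * cross_root i0 J v a t S i l)\<^sup>2)
    = v * (\<Sum>i<p. (u i)\<^sup>2) - 2 * t * u i0 * (\<Sum>l\<in>J. sgn_in S l * u l)"
proof -
  have "(\<Sum>l\<in>{..<p}-{i0}. (\<Sum>i<p. u i * cross_root i0 J v a t S i l)\<^sup>2)
      = (\<Sum>l\<in>{..<p}-{i0}. v * (u l)\<^sup>2 + (if l \<in> J then - (2 * t * u i0) * (sgn_in S l * u l) + t\<^sup>2 / v * (u i0)\<^sup>2 else 0))"
  proof (intro sum.cong refl)
    fix l assume l: "l \<in> {..<p}-{i0}"
    have "(sqrt v * u l - t / sqrt v * sgn_in S l * u i0)\<^sup>2
        = v * (u l)\<^sup>2 - 2 * t * u i0 * (sgn_in S l * u l) + t\<^sup>2 / v * (u i0)\<^sup>2"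
      using v by (simp add: power2_diff power_mult_distrib power_divide)
    then show "(\<Sum>i<p. u i * cross_root i0 J v a t S i l)\<^sup>2
        = v * (u l)\<^sup>2 + (if l \<in> J then - (2 * t * u i0) * (sgn_in S l * u l) + t\<^sup>2 / v * (u i0)\<^sup>2 else 0)"
      using l v by (simp add: cross_column power_mult_distrib)
  qed
  also have "\<dots> = v * (\<Sum>l\<in>{..<p}-{i0}. (u l)\<^sup>2) - 2 * t * u i0 * (\<Sum>l\<in>J. sgn_in S l * u l)
      + real (card J) * (t\<^sup>2 / v * (u i0)\<^sup>2)"
    unfolding sum.distrib sum_J by (simp add: sum_distrib_left sum_negf)
  finally show ?thesis
    unfolding sum_split_i0[of "\<lambda>l. (\<Sum>i<p. u i * cross_root i0 J v a t S i l)\<^sup>2"] sum_split_i0[of "\<lambda>i. (u i)\<^sup>2"]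
    using i0 a by (simp add: cross_column power_mult_distrib) (simp add: av algebra_simps)
qed

text \<open>
  The Cauchy-Schwarz inequality over \<open>J\<close>, followed by the arithmetic-geometric mean inequality for
  \<open>(u i0)\<^sup>2\<close> and the sum of the squares over \<open>J\<close>.
\<close>

lemma cross_term_le:
  assumes h: "0 \<le> h" "real (card J) * t\<^sup>2 \<le> h\<^sup>2"
  shows "\<bar>2 * t * u i0 * (\<Sum>l\<in>J. sgn_in S l * u l)\<bar> \<le> h * (\<Sum>i<p. (u i)\<^sup>2)"
proof -
  define y where "y = (\<Sum>l\<in>J. sgn_in S l * u l)"
  define U where "U = (\<Sum>l\<in>J. (u l)\<^sup>2)"
  have U0: "0 \<le> U" by (simp add: U_def sum_nonneg)
  have "y\<^sup>2 \<le> (\<Sum>l\<in>J. (sgn_in S l)\<^sup>2) * (\<Sum>l\<in>J. (u l)\<^sup>2)"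
    unfolding y_def by (rule Cauchy_Schwarz_ineq_sum)
  then have y: "y\<^sup>2 \<le> real (card J) * U" by (simp add: U_def)
  have "(2 * t * u i0 * y)\<^sup>2 = 4 * (u i0)\<^sup>2 * t\<^sup>2 * y\<^sup>2" by (simp add: power_mult_distrib)
  also have "\<dots> \<le> 4 * (u i0)\<^sup>2 * t\<^sup>2 * (real (card J) * U)" using y by (intro mult_left_mono) auto
  also have "\<dots> = 4 * (u i0)\<^sup>2 * U * (real (card J) * t\<^sup>2)" by simp
  also have "\<dots> \<le> 4 * (u i0)\<^sup>2 * U * h\<^sup>2" using h U0 by (intro mult_left_mono) auto
  also have "\<dots> \<le> (h * ((u i0)\<^sup>2 + U))\<^sup>2"
  proof -
    have "4 * x * y \<le> (x + y)\<^sup>2" for x y :: real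
      using zero_le_power2[of "x - y"] by (simp add: power2_sum power2_diff)
    then have "4 * (u i0)\<^sup>2 * U \<le> ((u i0)\<^sup>2 + U)\<^sup>2" .
    then have "4 * (u i0)\<^sup>2 * U * h\<^sup>2 \<le> ((u i0)\<^sup>2 + U)\<^sup>2 * h\<^sup>2" by (intro mult_right_mono) auto
    then show ?thesis by (simp add: power_mult_distrib mult.commute)
  qed
  finally have "\<bar>2 * t * u i0 * y\<bar> \<le> h * ((u i0)\<^sup>2 + U)"
    using h U0 by (intro power2_le_imp_le[of "\<bar>2 * t * u i0 * y\<bar>"]) auto
  also have "\<dots> \<le> h * (\<Sum>i<p. (u i)\<^sup>2)"
  proof (intro mult_left_mono h(1))
    have "U \<le> (\<Sum>i\<in>{..<p}-{i0}. (u i)\<^sup>2)" unfolding U_def using J by (intro sum_mono2) auto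
    then show "(u i0)\<^sup>2 + U \<le> (\<Sum>i<p. (u i)\<^sup>2)" unfolding sum_split_i0 by simp
  qed
  finally show ?thesis by (simp add: y_def)
qed

lemma cross_eigenvector:
  fixes S defines "e \<equiv> \<lambda>i. if i = i0 then sqrt (real (card J)) else if i \<in> J then - sgn_in S i else 0"
  assumes i: "i < p"
  shows "(\<Sum>j<p. gram p (cross_root i0 J v a t S) i j * e j) = (v + t * sqrt (real (card J))) * e i"
proof -
  let ?q = "sqrt (real (card J))"
  let ?A = "cross_root i0 J v a t S"
  define w where "w l = (\<Sum>j<p. e j * ?A j l)" for l
  have sv: "sqrt v * sqrt v = v" "sqrt a * sqrt a = a" "?q * ?q = real (card J)" "sqrt v \<noteq> 0" using v a by simp_all
  have w0: "w i0 = sqrt a * ?q" using i0 by (simp add: w_def cross_column e_def)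
  have wJ: "w l = - sgn_in S l * (sqrt v + t * ?q / sqrt v)" if "l \<in> J" for l
  proof -
    have "l < p" "l \<noteq> i0" using that J by auto
    then have "w l = sqrt v * e l - t / sqrt v * sgn_in S l * e i0"
      using that unfolding w_def by (simp add: cross_column)
    then show ?thesis using \<open>l \<noteq> i0\<close> that by (simp add: e_def algebra_simps)
  qed
  have wO: "w l = 0" if "l < p" "l \<noteq> i0" "l \<notin> J" for l
    using that by (simp add: w_def cross_column e_def)
  have eq: "(\<Sum>j<p. gram p ?A i j * e j) = (\<Sum>l<p. ?A i l * w l)"
    unfolding gram_row w_def ..
  show ?thesis
  proof (cases "i = i0")
    case True
    have "(\<Sum>l\<in>{..<p}-{i0}. ?A i0 l * w l) = (\<Sum>l\<in>{..<p}-{i0}. if l \<in> J then t / sqrt v * (sqrt v + t * ?q / sqrt v) else 0)"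
    proof (intro sum.cong refl)
      fix l assume "l \<in> {..<p}-{i0}"
      then show "?A i0 l * w l = (if l \<in> J then t / sqrt v * (sqrt v + t * ?q / sqrt v) else 0)"
        using wO[of l] wJ[of l] by (simp add: cross_root_def)
    qed
    also have "\<dots> = real (card J) * (t + t\<^sup>2 * ?q / v)"
      unfolding sum_J using sv by (simp add: distrib_left power2_eq_square) 
    finally have "(\<Sum>l<p. ?A i0 l * w l) = a * ?q + real (card J) * (t + t\<^sup>2 * ?q / v)"
      unfolding sum_split_i0 using w0 sv(2) by (simp add: cross_root_def)
    also have "\<dots> = v * ?q + real (card J) * t" by (simp add: av algebra_simps)
    also have "\<dots> = (v + t * ?q) * ?q" using sv(3) by (simp add: algebra_simps)
    finally show ?thesis using eq True by (simp add: e_def)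
  next
    case False
    have "(\<Sum>l<p. ?A i l * w l) = (\<Sum>l<p. if l = i then sqrt v * w l else 0)"
      using False by (intro sum.cong) (auto simp: cross_root_def)
    also have "\<dots> = sqrt v * w i" using i by simp
    also have "\<dots> = (v + t * ?q) * e i"
    proof (cases "i \<in> J")
      case True
      have sq: "sqrt v * (sqrt v + t * ?q / sqrt v) = v + t * ?q" using v sv by (simp add: distrib_left)
      have "sqrt v * w i = - sgn_in S i * (sqrt v * (sqrt v + t * ?q / sqrt v))"
        unfolding wJ[OF True] by (rule mult.left_commute)
      also have "\<dots> = (v + t * ?q) * e i"
        unfolding sq using True False by (simp add: e_def)
      finally show ?thesis .
    next
      case nJ: False
      then show ?thesis using False i wO[of i] by (simp add: e_def)
    qed
    finally show ?thesis using eq by simp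
  qed
qed

lemma cross_mechanism_in_class:
  assumes h: "0 \<le> h" "real (card J) * t\<^sup>2 \<le> h\<^sup>2" and Jne: "J \<noteq> {}"
    and lm: "0 < lm" "lm = v - h" "lp = v + h" and r: "0 < r"
    and B: "0 \<le> B" "c\<^sup>2 * (1 + real (card J) * t\<^sup>2 / v\<^sup>2) \<le> B\<^sup>2"
    and par: "0 < chi" "chi \<le> 1" "1 \<le> C" "root 4 105 \<le> kappa" "sqrt (8 * lp / 3) \<le> CX"
  shows "gauss_mechanism p (cross_root i0 J v a t S) (cross_beta p i0 J v t c S) r
    \<in> P_OSS_Gauss p r B lm lp chi C kappa CX"
proof (rule gauss_mechanism_in_class)
  show "0 < p" using i0 by simp
  show "lm * (\<Sum>i<p. (u i)\<^sup>2) \<le> (\<Sum>l<p. (\<Sum>i<p. u i * cross_root i0 J v a t S i l)\<^sup>2)"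
    "(\<Sum>l<p. (\<Sum>i<p. u i * cross_root i0 J v a t S i l)\<^sup>2) \<le> lp * (\<Sum>i<p. (u i)\<^sup>2)" for u
    unfolding cross_form lm(2,3) using cross_term_le[OF h, of u S]
    by (auto simp: algebra_simps abs_le_iff)
  define e where "e = (\<lambda>i. if i = i0 then sqrt (real (card J)) else if i \<in> J then - sgn_in S i else 0)"
  show "(\<Sum>j<p. gram p (cross_root i0 J v a t S) i j * e j) = (v + t * sqrt (real (card J))) * e i"
    if "i < p" for i unfolding e_def by (rule cross_eigenvector[OF that])
  have "e i0 \<noteq> 0" using Jne finite_J by (simp add: e_def)
  then show "\<exists>i<p. e i \<noteq> 0" using i0 by blast
  show "cross_beta p i0 J v t c S \<in> space (Rp p)"
    by (simp add: cross_beta_def vec_space_def space_PiM)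
  have "(\<Sum>i\<in>{..<p}-{i0}. (cross_beta p i0 J v t c S i)\<^sup>2) = (\<Sum>i\<in>{..<p}-{i0}. if i \<in> J then (t * c / v)\<^sup>2 else 0)"
    by (intro sum.cong) (auto simp: cross_beta_def power_mult_distrib power_divide)
  also have "\<dots> = real (card J) * (t * c / v)\<^sup>2" unfolding sum_J by simp
  finally have "(\<Sum>i<p. (cross_beta p i0 J v t c S i)\<^sup>2) = c\<^sup>2 * (1 + real (card J) * t\<^sup>2 / v\<^sup>2)"
    unfolding sum_split_i0 using i0
    by (simp add: cross_beta_def power_mult_distrib power_divide algebra_simps)
  then show "norm2 p (cross_beta p i0 J v t c S) \<le> B"
    using B by (simp add: norm2_le_iff)
qed (use par lm h r v in auto)

lemma sum_sgn_insert:
  assumes "j \<in> J" "j \<notin> S"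
  shows "(\<Sum>l\<in>J. sgn_in (insert j S) l * z l) = (\<Sum>l\<in>J. sgn_in S l * z l) + 2 * z j"
proof -
  have "(\<Sum>l\<in>J-{j}. sgn_in (insert j S) l * z l) = (\<Sum>l\<in>J-{j}. sgn_in S l * z l)"
    by (intro sum.cong) (auto simp: sgn_in_insert)
  then show ?thesis
    using assms finite_J by (simp add: sum.remove[of J j] sgn_in_def)
qed

text \<open>
  Moving \<open>j\<close> into \<open>S\<close> changes the covariates only through the regression of \<open>X\<^sub>i\<^sub>0\<close>, and the residual
  can absorb that change.
\<close>

lemma lin_cross_shear:
  assumes j: "j \<in> J" "j \<notin> S"
  shows "lin p (cross_root i0 J v a t (insert j S)) z
    = lin p (cross_root i0 J v a t S) (shear j i0 p (- 2 * t / (sqrt v * sqrt a)) e z)"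
proof
  fix i
  define d where "d = - 2 * t / (sqrt v * sqrt a)"
  define z' where "z' = shear j i0 p d e z"
  have z': "z' l = z l" if "l < p" "l \<noteq> i0" for l using that by (simp add: z'_def shear_def)
  have z'0: "z' i0 = z i0 + d * z j" using i0 by (simp add: z'_def shear_def)
  have ad: "sqrt a * d = - 2 * t / sqrt v" using a by (simp add: d_def)
  have sJ: "(\<Sum>l\<in>J. sgn_in S l * z' l) = (\<Sum>l\<in>J. sgn_in S l * z l)"
    using J by (intro sum.cong) (auto intro: z')
  have "lin p (cross_root i0 J v a t (insert j S)) z i = lin p (cross_root i0 J v a t S) z' i"
  proof (cases "i < p")
    case False then show ?thesis by (simp add: lin_def)
  next
    case ip: True
    show ?thesis
    proof (cases "i = i0")
      case True
      have "sqrt a * z' i0 = sqrt a * z i0 - 2 * t / sqrt v * z j"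
        unfolding z'0 distrib_left mult.assoc[symmetric] ad by simp
      then show ?thesis
        unfolding True lin_cross_i0 sJ sum_sgn_insert[OF j] by (simp add: distrib_left)
    next
      case False then show ?thesis using ip by (simp add: lin_cross_other z')
    qed
  qed
  then show "lin p (cross_root i0 J v a t (insert j S)) z i
    = lin p (cross_root i0 J v a t S) (shear j i0 p (- 2 * t / (sqrt v * sqrt a)) e z) i"
    by (simp add: z'_def d_def)
qed

lemma cross_unlabelled_close:
  assumes j: "j \<in> J" "j \<notin> S"
  shows "kl_close (gauss (Suc p)) (2 * t\<^sup>2 / (v * a))
     (unlabelled_law p (gauss_mechanism p (cross_root i0 J v a t S) b r))
     (unlabelled_law p (gauss_mechanism p (cross_root i0 J v a t (insert j S)) b' r))"
proof -
  define d where "d = - 2 * t / (sqrt v * sqrt a)"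
  have jp: "j < p" "j \<noteq> i0" using j J by auto
  have "kl_close (gauss (Suc p)) ((d\<^sup>2 + 0\<^sup>2) / 2)
      (distr (gauss (Suc p)) (Rp p) (lin p (cross_root i0 J v a t S)))
      (distr (gauss (Suc p)) (Rp p) (\<lambda>z. lin p (cross_root i0 J v a t S) (shear j i0 p d 0 z)))"
    using jp i0 by (intro kl_close_shear measurable_lin) auto
  moreover have "(d\<^sup>2 + 0\<^sup>2) / 2 = 2 * t\<^sup>2 / (v * a)"
    using v a by (simp add: d_def power_divide power_mult_distrib)
  moreover have "lin p (cross_root i0 J v a t (insert j S)) = (\<lambda>z. lin p (cross_root i0 J v a t S) (shear j i0 p d 0 z))"
    using lin_cross_shear[OF j, of _ 0] by (auto simp: d_def)
  ultimately show ?thesis unfolding unlabelled_law_gauss_mechanism by (simp only:)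
qed

text \<open>
  Without \<open>i0\<close> the sample does not depend on \<open>S\<close>. With \<open>i0\<close> but without \<open>j\<close>, the sign of \<open>j\<close> can be
  moved into \<open>z\<^sub>j\<close>, which no other observed variable contains. With both, the shift of \<open>z\<^sub>i\<^sub>0\<close> that
  reproduces \<open>X\<^sub>i\<^sub>0\<close> disturbs the response, which the factor \<open>e\<close> for the noise makes up for.
\<close>

lemma cross_labelled_close:
  assumes V: "V \<subseteq> {..<p}" and j: "j \<in> J" "j \<notin> S" and r: "0 < r"
  shows "kl_close (gauss (Suc p)) (if i0 \<in> V \<and> j \<in> V then 2 * t\<^sup>2 / (v * a) + 2 * t\<^sup>2 * c\<^sup>2 / (v * r\<^sup>2) else 0)
     (labelled_law p V (gauss_mechanism p (cross_root i0 J v a t S) (cross_beta p i0 J v t c S) r))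
     (labelled_law p V (gauss_mechanism p (cross_root i0 J v a t (insert j S)) (cross_beta p i0 J v t c (insert j S)) r))"
proof -
  let ?A = "\<lambda>S. cross_root i0 J v a t S"
  let ?T = "\<lambda>S. obs_map p (?A S) (cross_beta p i0 J v t c S) r V"
  have jp: "j < p" "j \<noteq> i0" using j J by auto
  have T: "?T S z = (restrict (lin p (?A S) z) V, c * sqrt a * z i0 + r * z p)" for S z
    by (simp add: obs_map_def response_cross)
  consider (both) "i0 \<in> V" "j \<in> V" | (no_i0) "i0 \<notin> V" | (no_j) "i0 \<in> V" "j \<notin> V" by blast
  then show ?thesis
  proof cases
    case both
    define d where "d = - 2 * t / (sqrt v * sqrt a)"
    define e where "e = 2 * t * c / (sqrt v * r)"
    have ce: "c * sqrt a * d + r * e = 0" using a r by (simp add: d_def e_def field_simps)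
    have "?T (insert j S) z = ?T S (shear j i0 p d e z)" for z
    proof -
      have "c * sqrt a * (z i0 + d * z j) + r * (z p + e * z j)
          = c * sqrt a * z i0 + r * z p + (c * sqrt a * d + r * e) * z j" by (simp add: algebra_simps)
      moreover have "shear j i0 p d e z i0 = z i0 + d * z j" "shear j i0 p d e z p = z p + e * z j"
        using i0 by (simp_all add: shear_def)
      ultimately have "c * sqrt a * shear j i0 p d e z i0 + r * shear j i0 p d e z p
          = c * sqrt a * z i0 + r * z p" using ce by simp
      then show ?thesis
        unfolding T lin_cross_shear[OF j, of z e, folded d_def] by simp
    qed
    then have eq: "?T (insert j S) = (\<lambda>z. ?T S (shear j i0 p d e z))" by (rule ext)
    have "kl_close (gauss (Suc p)) ((d\<^sup>2 + e\<^sup>2) / 2)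
        (distr (gauss (Suc p)) (vec_space V \<Otimes>\<^sub>M borel) (?T S))
        (distr (gauss (Suc p)) (vec_space V \<Otimes>\<^sub>M borel) (\<lambda>z. ?T S (shear j i0 p d e z)))"
      using jp i0 by (intro kl_close_shear measurable_obs_map V) auto
    moreover have "(d\<^sup>2 + e\<^sup>2) / 2 = 2 * t\<^sup>2 / (v * a) + 2 * t\<^sup>2 * c\<^sup>2 / (v * r\<^sup>2)"
      using v a by (simp add: d_def e_def power_divide power_mult_distrib add_divide_distrib mult_ac)
    ultimately show ?thesis
      unfolding labelled_law_gauss_mechanism[OF V] eq by (simp only: both simp_thms if_True)
  next
    case no_i0
    have "?T (insert j S) z = ?T S z" for z
    proof -
      have "lin p (?A (insert j S)) z l = lin p (?A S) z l" if "l \<in> V" for l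
      proof -
        have "l < p" "l \<noteq> i0" using that V no_i0 by auto
        then show ?thesis by (simp add: lin_cross_other)
      qed
      then show ?thesis unfolding T by (auto simp: fun_eq_iff restrict_def)
    qed
    then have "?T (insert j S) = ?T S" by (rule ext)
    then show ?thesis
      unfolding labelled_law_gauss_mechanism[OF V]
      using kl_close_refl[OF measurable_obs_map[OF V]] no_i0 by simp
  next
    case no_j
    have "?T (insert j S) z = ?T S (z(j := - z j))" for z
    proof -
      define z' where "z' = z(j := - z j)"
      have z': "z' l = z l" if "l \<noteq> j" for l using that by (simp add: z'_def)
      have "(\<Sum>l\<in>J. sgn_in S l * z' l) = (\<Sum>l\<in>J. sgn_in (insert j S) l * z l)"
        using j by (intro sum.cong) (auto simp: z'_def sgn_in_def)
      then have "lin p (?A (insert j S)) z i0 = lin p (?A S) z' i0"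
        using z'[of i0] jp by (simp add: lin_cross_i0)
      moreover have "lin p (?A (insert j S)) z l = lin p (?A S) z' l" if "l \<in> V" "l \<noteq> i0" for l
      proof -
        have "l < p" "l \<noteq> j" using that V no_j by auto
        then show ?thesis using that z' by (simp add: lin_cross_other)
      qed
      ultimately have "lin p (?A (insert j S)) z l = lin p (?A S) z' l" if "l \<in> V" for l
        using that by (cases "l = i0") auto
      then have "restrict (lin p (?A (insert j S)) z) V = restrict (lin p (?A S) z') V"
        by (auto simp: fun_eq_iff restrict_def)
      then show ?thesis unfolding T using jp by (simp add: z'_def)
    qed
    then have "?T (insert j S) = (\<lambda>z. ?T S (z(j := - z j)))" by (rule ext)
    then show ?thesis
      unfolding labelled_law_gauss_mechanism[OF V]
      using kl_close_flip[of j "Suc p", OF _ measurable_obs_map[OF V]] jp no_j by simp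
  qed
qed

lemma cross_covariance_lower_bound:
  assumes Obs: "\<And>k. k < K \<Longrightarrow> Obs k \<subseteq> {..<p}"
    and h: "0 \<le> h" "real (card J) * t\<^sup>2 \<le> h\<^sup>2"
    and lm: "0 < lm" "lm = v - h" "lp = v + h" and r: "0 < r"
    and B: "0 \<le> B" "c\<^sup>2 * (1 + real (card J) * t\<^sup>2 / v\<^sup>2) \<le> B\<^sup>2"
    and par: "0 < chi" "chi \<le> 1" "1 \<le> C" "root 4 105 \<le> kappa" "sqrt (8 * lp / 3) \<le> CX"
    and H: "\<And>j. j \<in> J \<Longrightarrow> real (\<Sum>k<K. if i0 \<in> Obs k \<and> j \<in> Obs k then n k else 0) \<le> H"
    and \<kappa>: "(2 * t\<^sup>2 / (v * a) + 2 * t\<^sup>2 * c\<^sup>2 / (v * r\<^sup>2)) * H + real N * (2 * t\<^sup>2 / (v * a)) \<le> \<kappa>"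
    and b: "b \<in> estimators p K Obs n N (P_OSS p r B lm lp chi C kappa CX)"
  shows "ennreal (real (card J) * (t * c / v)\<^sup>2 * exp (- \<kappa>) / 2)
    \<le> (SUP P\<in>P_OSS_Gauss p r B lm lp chi C kappa CX. risk p K Obs n N b P)"
proof (cases "J = {}")
  case True
  then show ?thesis by simp
next
  case Jne: False
  let ?P = "\<lambda>S. gauss_mechanism p (cross_root i0 J v a t S) (cross_beta p i0 J v t c S) r"
  let ?M = "PiM {..<K} (\<lambda>k. PiM {..<n k} (\<lambda>_. gauss (Suc p))) \<Otimes>\<^sub>M PiM {..<N} (\<lambda>_. gauss (Suc p))"
  show ?thesis
  proof (rule assouad[where Pm = ?P and M = "\<lambda>_ _. ?M" and c = "\<lambda>i. if i = i0 then c else 0"])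
    show "J \<subseteq> {..<p}" using J by auto
    show "P_OSS_Gauss p r B lm lp chi C kappa CX \<subseteq> P_OSS p r B lm lp chi C kappa CX"
      by (auto simp: P_OSS_Gauss_def)
    show "?P S \<in> P_OSS_Gauss p r B lm lp chi C kappa CX" for S
      by (rule cross_mechanism_in_class[OF h Jne lm r B par])
    show "beta (?P S) j = (if j \<in> S then t * c / v else - (t * c / v))" if "j \<in> J" for S j
      using that J by (auto simp: gauss_mechanism_def cross_beta_def sgn_in_def)
    show "beta (?P S) i = (if i = i0 then c else 0)" if "i < p" "i \<notin> J" for S i
      using that by (simp add: gauss_mechanism_def cross_beta_def)
    fix S j assume j: "j \<in> J" "j \<notin> S"
    have jp: "j < p" using j J by auto
    let ?x = "2 * t\<^sup>2 / (v * a) + 2 * t\<^sup>2 * c\<^sup>2 / (v * r\<^sup>2)"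
    let ?\<kappa> = "\<lambda>k. if i0 \<in> Obs k \<inter> {..<p} \<and> j \<in> Obs k \<inter> {..<p} then ?x else 0"
    have "kl_close ?M \<kappa> (data_law p K (\<lambda>k. Obs k \<inter> {..<p}) n N (?P S))
        (data_law p K (\<lambda>k. Obs k \<inter> {..<p}) n N (?P (insert j S)))"
    proof (rule kl_close_data_law)
      show "kl_close (gauss (Suc p)) (?\<kappa> k) (labelled_law p (Obs k \<inter> {..<p}) (?P S))
          (labelled_law p (Obs k \<inter> {..<p}) (?P (insert j S)))" for k
        using j r by (intro cross_labelled_close) auto
      show "kl_close (gauss (Suc p)) (2 * t\<^sup>2 / (v * a)) (unlabelled_law p (?P S)) (unlabelled_law p (?P (insert j S)))"
        by (rule cross_unlabelled_close[OF j])
      have "(\<Sum>k<K. real (n k) * ?\<kappa> k) = (\<Sum>k<K. ?x * real (if i0 \<in> Obs k \<and> j \<in> Obs k then n k else 0))"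
        using jp i0 by (intro sum.cong) auto
      also have "\<dots> = ?x * real (\<Sum>k<K. if i0 \<in> Obs k \<and> j \<in> Obs k then n k else 0)"
        by (simp only: of_nat_sum sum_distrib_left)
      also have "\<dots> \<le> ?x * H"
        using H[OF j(1)] v a by (intro mult_left_mono) auto
      finally show "(\<Sum>k<K. real (n k) * ?\<kappa> k) + real N * (2 * t\<^sup>2 / (v * a)) \<le> \<kappa>" using \<kappa> by linarith
    qed
    then show "kl_close ?M \<kappa> (data_law p K Obs n N (?P S)) (data_law p K Obs n N (?P (insert j S)))"
      by (simp only: data_law_restrict_Obs[OF Obs])
  qed (rule b)
qed

end

section \<open>Counts of modalities\<close>

text \<open>
  Observed sets are unions of modalities, so one coordinate decides whether its modality is observed.
  This turns the two counts into numbers of samples that contain given coordinates.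
\<close>

lemma part_subset_observed_iff:
  assumes part: "compatible_partition p K Obs Ls" and k: "k < K" and G: "G \<in> Ls" "j \<in> G"
  shows "G \<subseteq> Obs k \<longleftrightarrow> j \<in> Obs k"
proof
  assume "j \<in> Obs k"
  from part k obtain Q where Q: "Q \<subseteq> Ls" "Obs k = \<Union>Q" by (auto simp: compatible_partition_def)
  then obtain H where H: "H \<in> Q" "j \<in> H" using \<open>j \<in> Obs k\<close> by auto
  have "partition_on {..<p} Ls" using part by (simp add: compatible_partition_def)
  then have "disjoint Ls" by (rule partition_onD2)
  then have "G = H" using G H Q(1) by (auto simp: disjoint_def)
  then show "G \<subseteq> Obs k" using H Q(2) by auto
qed (use G in auto)

lemma h_count_eq:
  assumes "compatible_partition p K Obs Ls" "G \<in> Ls" "j \<in> G"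
  shows "h_count K Obs n G = (\<Sum>k<K. if j \<in> Obs k then n k else 0)"
  unfolding h_count_def using assms by (intro sum.cong) (auto simp: part_subset_observed_iff)

lemma pair_count_eq:
  assumes "compatible_partition p K Obs Ls" "G \<in> Ls" "i \<in> G" "H \<in> Ls" "j \<in> H"
  shows "pair_count K Obs n G H = (\<Sum>k<K. if i \<in> Obs k \<and> j \<in> Obs k then n k else 0)"
  unfolding pair_count_def using assms by (intro sum.cong) (auto simp: part_subset_observed_iff)

lemma exists_other_part:
  assumes "2 \<le> card Ls"
  shows "\<exists>H\<in>Ls. H \<noteq> G"
proof (rule ccontr)
  assume "\<not> ?thesis"
  then have "Ls \<subseteq> {G}" by auto
  then have "card Ls \<le> card {G}" by (intro card_mono) auto
  then show False using assms by simp
qed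

text \<open>
  The hidden covariances belong to coordinates outside of one modality. Choosing a small modality
  leaves at least half of all coordinates, so the bound keeps the full factor \<open>p\<close>.
\<close>

lemma exists_small_part:
  assumes part: "partition_on {..<p} Ls" and two: "2 \<le> card Ls"
  shows "\<exists>G\<in>Ls. 2 * card G \<le> p"
proof -
  obtain G where G: "G \<in> Ls" using two by (metis card.empty ex_in_conv not_numeral_le_zero)
  obtain H where H: "H \<in> Ls" "H \<noteq> G" using exists_other_part[OF two] by blast
  have un: "\<Union>Ls = {..<p}" using partition_onD1[OF part] by simp
  have sub: "G \<subseteq> {..<p}" "H \<subseteq> {..<p}" using G H(1) un by auto
  have "G \<inter> H = {}" using partition_onD2[OF part] G H by (auto simp: disjoint_def)
  then have "card G + card H = card (G \<union> H)"
    using finite_subset[OF sub(1)] finite_subset[OF sub(2)] by (subst card_Un_disjoint) auto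
  also have "\<dots> \<le> card {..<p}" using sub by (intro card_mono) auto
  finally have "card G + card H \<le> p" by simp
  then have "2 * card G \<le> p \<or> 2 * card H \<le> p" by linarith
  then show ?thesis using G H by blast
qed

section \<open>The minimax lower bound\<close>

text \<open>
  The size \<open>d\<^sup>2 = R\<^sup>2 / (4 C\<^sub>\<rho> \<lambda>\<^sub>- x)\<close> bounds the divergence by \<open>1 / 2\<close>, and the lower bound on \<open>x = \<rho> n\<close> keeps
  the parameter in the ball of radius \<open>B\<close>.
\<close>

lemma complete_case_term:
  fixes R B lm lp x Crho H :: real
  assumes p: "2 \<le> p" and Obs: "\<And>k. k < K \<Longrightarrow> Obs k \<subseteq> {..<p}"
    and pos: "0 < R" "0 < B" "0 < lm" "lm \<le> lp" "0 < x" "1 \<le> Crho"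
    and par: "0 < chi" "chi \<le> 1" "1 \<le> C" "root 4 105 \<le> kappa" "sqrt (8 * lp / 3) \<le> CX"
    and x: "real p * (R\<^sup>2 / (4 * B\<^sup>2 * lm)) \<le> x"
    and H: "\<And>j. j < p \<Longrightarrow> real (\<Sum>k<K. if j \<in> Obs k then n k else 0) \<le> Crho * x"
    and b: "b \<in> estimators p K Obs n N (P_OSS p R B lm lp chi C kappa CX)"
  shows "ennreal ((1 / (Crho * lm) * (R\<^sup>2 * real p / x)) / 16)
    \<le> (SUP P\<in>P_OSS_Gauss p R B lm lp chi C kappa CX. risk p K Obs n N b P)"
proof -
  define d where "d = sqrt (R\<^sup>2 / (4 * Crho * lm * x))"
  have d2: "d\<^sup>2 = R\<^sup>2 / (4 * Crho * lm * x)" using pos by (simp add: d_def)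
  have "real p * d\<^sup>2 \<le> B\<^sup>2"
  proof -
    have "real p * R\<^sup>2 \<le> x * (4 * B\<^sup>2 * lm)" using x pos by (simp add: field_simps)
    also have "\<dots> \<le> x * (4 * B\<^sup>2 * lm) * Crho"
      using pos mult_left_mono[of 1 Crho "x * (4 * B\<^sup>2 * lm)"] by simp
    finally show ?thesis using pos by (simp add: d2 field_simps)
  qed
  moreover have "2 * d\<^sup>2 * lm / R\<^sup>2 * (Crho * x) \<le> 1 / 2" using pos by (simp add: d2 field_simps)
  ultimately have "ennreal (real p * d\<^sup>2 * exp (- (1 / 2)) / 2)
    \<le> (SUP P\<in>P_OSS_Gauss p R B lm lp chi C kappa CX. risk p K Obs n N b P)"
    using pos by (intro complete_case_lower_bound[OF p Obs _ _ _ _ _ par H _ b]) auto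
  moreover have "(1 / (Crho * lm) * (R\<^sup>2 * real p / x)) / 16 \<le> real p * d\<^sup>2 * exp (- (1 / 2)) / 2"
  proof -
    have "1 / 2 \<le> exp (- (1 / 2) :: real)" using exp_ge_add_one_self[of "- (1 / 2) :: real"] by simp
    then have "real p * d\<^sup>2 * (1 / 2) \<le> real p * d\<^sup>2 * exp (- (1 / 2))" by (intro mult_left_mono) auto
    moreover have "(1 / (Crho * lm) * (R\<^sup>2 * real p / x)) / 16 = real p * d\<^sup>2 * (1 / 2) / 2"
      using pos by (simp add: d2 field_simps)
    ultimately show ?thesis by linarith
  qed
  ultimately show ?thesis by (meson ennreal_leI order_trans)
qed

text \<open>
  Here \<open>y = \<rho>\<^sup>2 n\<close>. The divergence has a term of order \<open>t\<^sup>2 / v\<^sup>2\<close> for each of the \<open>N + C\<^sub>\<rho> y\<close> samples that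
  show the covariance and a term of order \<open>t\<^sup>2 B\<^sup>2 / (v R\<^sup>2)\<close> for each of the \<open>C\<^sub>\<rho> y\<close> labelled ones among
  them. With \<open>t\<^sup>2 = \<mu> m / (32 C\<^sub>\<rho>)\<close> both are bounded, because \<open>m\<close> is the smaller of \<open>1 / (N + y)\<close> and
  \<open>R\<^sup>2 / (B\<^sup>2 y)\<close> and because \<open>\<mu> = min 1 \<lambda>\<^sub>+\<^sup>2\<close> is at most \<open>4 v\<^sup>2\<close> and at most \<open>2 v\<close>.
\<close>

lemma cross_covariance_term:
  fixes R B lm lp y Crho :: real
  assumes p: "i0 < p" and J: "J \<subseteq> {..<p} - {i0}" "real p \<le> 2 * real (card J)"
    and Obs: "\<And>k. k < K \<Longrightarrow> Obs k \<subseteq> {..<p}"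
    and pos: "0 < R" "0 < B" "0 < lm" "lm < lp" "0 < y" "1 \<le> Crho"
    and par: "0 < chi" "chi \<le> 1" "1 \<le> C" "root 4 105 \<le> kappa" "sqrt (8 * lp / 3) \<le> CX"
    and y: "real p * (min 1 (lp\<^sup>2) / (2 * B\<^sup>2 * (lp - lm)\<^sup>2)) \<le> max ((real N + y) / B\<^sup>2) (y / R\<^sup>2)"
    and H: "\<And>j. j \<in> J \<Longrightarrow> real (\<Sum>k<K. if i0 \<in> Obs k \<and> j \<in> Obs k then n k else 0) \<le> Crho * y"
    and b: "b \<in> estimators p K Obs n N (P_OSS p R B lm lp chi C kappa CX)"
  shows "ennreal ((min (1 / lp\<^sup>2) 1 / Crho * min (B\<^sup>2 * real p / (real N + y)) (R\<^sup>2 * real p / y)) / 768)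
    \<le> (SUP P\<in>P_OSS_Gauss p R B lm lp chi C kappa CX. risk p K Obs n N b P)"
proof -
  define D where "D = lp - lm"
  define \<mu> where "\<mu> = min 1 (lp\<^sup>2)"
  define m where "m = min (1 / (real N + y)) (R\<^sup>2 / (B\<^sup>2 * y))"
  define t where "t = sqrt (\<mu> * m / (32 * Crho))"
  \<comment> \<open>The midpoint leaves the same room \<open>h\<close> for the eigenvalues on both sides.\<close>
  define v where "v = (lm + lp) / 2"
  define h where "h = D / 2"
  define a where "a = v - real (card J) * t\<^sup>2 / v"
  define c where "c = B / sqrt 2"
  have lp: "0 < lp" and D: "0 < D" and v: "0 < v" and Ny: "0 < real N + y" using pos by (simp_all add: D_def v_def)
  have \<mu>0: "0 < \<mu>" "\<mu> \<le> 1" "\<mu> \<le> lp\<^sup>2" using lp by (auto simp: \<mu>_def)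
  have \<mu>lp: "\<mu> \<le> lp"
  proof (cases "lp \<le> 1")
    case True
    then have "lp\<^sup>2 \<le> lp" using lp by (simp add: power2_eq_square mult_left_le)
    then show ?thesis using \<mu>0 by linarith
  qed (use \<mu>0 in linarith)
  have m0: "0 < m" and m1: "m * (real N + y) \<le> 1" and m2: "m * (B\<^sup>2 * y) \<le> R\<^sup>2"
  proof -
    show "0 < m" using pos Ny by (simp add: m_def)
    have "m \<le> 1 / (real N + y)" "m \<le> R\<^sup>2 / (B\<^sup>2 * y)" by (simp_all add: m_def)
    then show "m * (real N + y) \<le> 1" "m * (B\<^sup>2 * y) \<le> R\<^sup>2" using Ny pos by (simp_all add: pos_le_divide_eq)
  qed
  have t2: "t\<^sup>2 = \<mu> * m / (32 * Crho)" using \<mu>0 m0 pos by (simp add: t_def)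
  have c2: "c\<^sup>2 = B\<^sup>2 / 2" by (simp add: c_def power_divide)
  \<comment> \<open>The two alternatives of the hypothesis on \<open>N\<close> and \<open>y\<close> match the two bounds on \<open>m\<close>.\<close>
  have pm: "real p * \<mu> * m \<le> 2 * D\<^sup>2"
  proof -
    have "real p * (\<mu> / (2 * B\<^sup>2 * D\<^sup>2)) \<le> (real N + y) / B\<^sup>2 \<or> real p * (\<mu> / (2 * B\<^sup>2 * D\<^sup>2)) \<le> y / R\<^sup>2"
      using y unfolding \<mu>_def D_def le_max_iff_disj by simp
    then show ?thesis
    proof
      assume "real p * (\<mu> / (2 * B\<^sup>2 * D\<^sup>2)) \<le> (real N + y) / B\<^sup>2"
      then have "real p * \<mu> \<le> 2 * D\<^sup>2 * (real N + y)" using pos D by (simp add: field_simps)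
      then have "real p * \<mu> * m \<le> 2 * D\<^sup>2 * (real N + y) * m" using m0 by (intro mult_right_mono) auto
      also have "\<dots> = 2 * D\<^sup>2 * (m * (real N + y))" by simp
      also have "\<dots> \<le> 2 * D\<^sup>2 * 1" using m1 by (intro mult_left_mono) auto
      finally show ?thesis by simp
    next
      assume "real p * (\<mu> / (2 * B\<^sup>2 * D\<^sup>2)) \<le> y / R\<^sup>2"
      then have "real p * \<mu> * R\<^sup>2 \<le> 2 * D\<^sup>2 * (B\<^sup>2 * y)" using pos D by (simp add: field_simps)
      then have "real p * \<mu> * R\<^sup>2 * m \<le> 2 * D\<^sup>2 * (B\<^sup>2 * y) * m" using m0 by (intro mult_right_mono) auto
      also have "\<dots> = 2 * D\<^sup>2 * (m * (B\<^sup>2 * y))" by simp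
      also have "\<dots> \<le> 2 * D\<^sup>2 * R\<^sup>2" using m2 by (intro mult_left_mono) auto
      finally have "R\<^sup>2 * (real p * \<mu> * m) \<le> R\<^sup>2 * (2 * D\<^sup>2)" by (simp add: mult_ac)
      then show ?thesis using pos by simp
    qed
  qed
  have qp: "real (card J) \<le> real p"
  proof -
    have "card J \<le> card {..<p}" using J(1) by (intro card_mono) auto
    then show ?thesis by simp
  qed
  have qt: "real (card J) * t\<^sup>2 \<le> D\<^sup>2 / 16"
  proof -
    have "real (card J) * t\<^sup>2 \<le> real p * t\<^sup>2" using qp by (intro mult_right_mono) auto
    also have "\<dots> = real p * \<mu> * m / (32 * Crho)" by (simp add: t2)
    also have "\<dots> \<le> 2 * D\<^sup>2 / (32 * Crho)" using pm pos by (intro divide_right_mono) auto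
    also have "\<dots> \<le> 2 * D\<^sup>2 / 32" using pos by (intro divide_left_mono) auto
    finally show ?thesis by simp
  qed
  have Dv: "D\<^sup>2 \<le> 4 * v\<^sup>2"
  proof -
    have "D \<le> 2 * v" using pos by (simp add: D_def v_def)
    then have "D\<^sup>2 \<le> (2 * v)\<^sup>2" using D by (intro power_mono) auto
    then show ?thesis by (simp add: power_mult_distrib)
  qed
  have qt': "real (card J) * t\<^sup>2 \<le> v\<^sup>2 / 4" using qt Dv by linarith
  have a: "v / 2 \<le> a"
  proof -
    have "real (card J) * t\<^sup>2 / v \<le> v\<^sup>2 / 4 / v" using qt' v by (intro divide_right_mono) auto
    also have "\<dots> = v / 4" using v by (simp add: power2_eq_square)
    finally show ?thesis unfolding a_def using v by linarith
  qed
  have a0: "0 < a" using a v by linarith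
  have h: "0 \<le> h" "real (card J) * t\<^sup>2 \<le> h\<^sup>2" using qt D zero_le_power2[of D] unfolding h_def power_divide by (simp_all, linarith)
  have lmv: "lm = v - h" "lp = v + h" by (simp_all add: v_def h_def D_def field_simps)
  have Bc: "c\<^sup>2 * (1 + real (card J) * t\<^sup>2 / v\<^sup>2) \<le> B\<^sup>2"
  proof -
    have "real (card J) * t\<^sup>2 / v\<^sup>2 \<le> 1 / 4" using qt' v by (simp add: field_simps)
    then have "1 + real (card J) * t\<^sup>2 / v\<^sup>2 \<le> 2" by linarith
    then have "c\<^sup>2 * (1 + real (card J) * t\<^sup>2 / v\<^sup>2) \<le> c\<^sup>2 * 2" by (rule mult_left_mono) simp
    then show ?thesis by (simp add: c2)
  qed
  have k1: "2 * t\<^sup>2 / (v * a) * (Crho * y + real N) \<le> 1 / 2"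
  proof -
    have "2 * t\<^sup>2 / (v * a) \<le> 2 * t\<^sup>2 / (v * (v / 2))"
      using a v a0 by (intro divide_left_mono mult_left_mono mult_pos_pos) auto
    then have "2 * t\<^sup>2 / (v * a) * (Crho * y + real N) \<le> 2 * t\<^sup>2 / (v * (v / 2)) * (Crho * (real N + y))"
      using pos v by (intro mult_mono) (auto simp: distrib_left mult_right_mono[of 1 Crho, simplified])
    also have "\<dots> = \<mu> / v\<^sup>2 * (m * (real N + y)) / 8"
      unfolding t2 using pos v by (simp add: power2_eq_square field_simps)
    also have "\<dots> \<le> \<mu> / v\<^sup>2 * 1 / 8" using m1 \<mu>0 by (intro divide_right_mono mult_left_mono) auto
    also have "\<mu> / v\<^sup>2 \<le> 4"
    proof -
      have "lp\<^sup>2 \<le> (2 * v)\<^sup>2" using lp pos by (intro power_mono) (auto simp: v_def)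
      then have "\<mu> \<le> 4 * v\<^sup>2" using \<mu>0 by (simp add: power_mult_distrib)
      then show ?thesis using v by (simp add: divide_le_eq)
    qed
    finally show ?thesis by simp
  qed
  have k2: "2 * t\<^sup>2 * c\<^sup>2 / (v * R\<^sup>2) * (Crho * y) \<le> 1 / 2"
  proof -
    have "2 * t\<^sup>2 * c\<^sup>2 / (v * R\<^sup>2) * (Crho * y) = \<mu> / v * (m * (B\<^sup>2 * y) / R\<^sup>2) / 32"
      unfolding t2 c2 using pos v by (simp add: field_simps)
    also have "\<dots> \<le> \<mu> / v * 1 / 32"
      using m2 \<mu>0 v pos by (intro divide_right_mono mult_left_mono) auto
    also have "\<mu> / v \<le> 2"
    proof -
      have "\<mu> \<le> 2 * v" using \<mu>lp pos by (simp add: v_def)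
      then show ?thesis using v by (simp add: divide_le_eq)
    qed
    finally show ?thesis by simp
  qed
  have \<kappa>: "(2 * t\<^sup>2 / (v * a) + 2 * t\<^sup>2 * c\<^sup>2 / (v * R\<^sup>2)) * (Crho * y) + real N * (2 * t\<^sup>2 / (v * a)) \<le> 1"
  proof -
    have "(q + q') * z + w * q = q * (z + w) + q' * z" for q q' z w :: real
      by (simp add: algebra_simps)
    then show ?thesis by (simp only:) (rule order_trans[OF add_mono[OF k1 k2]], simp)
  qed
  have B0: "0 \<le> B" using pos by simp
  have "ennreal (real (card J) * (t * c / v)\<^sup>2 * exp (- 1) / 2)
    \<le> (SUP P\<in>P_OSS_Gauss p R B lm lp chi C kappa CX. risk p K Obs n N b P)"
    by (rule cross_covariance_lower_bound[OF p J(1) v a0 a_def Obs h pos(3) lmv pos(1) B0 Bc par H \<kappa> b])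
  moreover have "(min (1 / lp\<^sup>2) 1 / Crho * min (B\<^sup>2 * real p / (real N + y)) (R\<^sup>2 * real p / y)) / 768
      \<le> real (card J) * (t * c / v)\<^sup>2 * exp (- 1) / 2"
  proof -
    have "min (B\<^sup>2 * real p / (real N + y)) (R\<^sup>2 * real p / y) = B\<^sup>2 * real p * m"
      using pos Ny by (simp add: m_def min_mult_distrib_left) (simp add: field_simps)
    moreover have "min (1 / lp\<^sup>2) 1 = \<mu> / lp\<^sup>2"
      using lp by (simp add: \<mu>_def min_divide_distrib_right)
    ultimately have "(min (1 / lp\<^sup>2) 1 / Crho * min (B\<^sup>2 * real p / (real N + y)) (R\<^sup>2 * real p / y)) / 768
        = (real p / 2) * (t\<^sup>2 * c\<^sup>2 / lp\<^sup>2) * (1 / 3) / 2"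
      unfolding t2 c2 using pos lp by (simp add: field_simps)
    also have "\<dots> \<le> real (card J) * (t\<^sup>2 * c\<^sup>2 / v\<^sup>2) * exp (- 1) / 2"
    proof (intro divide_right_mono mult_mono)
      show "real p / 2 \<le> real (card J)" using J(2) by simp
      have "v \<le> lp" using pos by (simp add: v_def)
      then have "v\<^sup>2 \<le> lp\<^sup>2" using v by (intro power_mono) auto
      then show "t\<^sup>2 * c\<^sup>2 / lp\<^sup>2 \<le> t\<^sup>2 * c\<^sup>2 / v\<^sup>2" using v lp by (intro divide_left_mono mult_pos_pos) auto
      show "1 / 3 \<le> exp (- 1 :: real)" using exp_le by (simp add: exp_minus field_simps)
    qed auto
    also have "\<dots> = real (card J) * (t * c / v)\<^sup>2 * exp (- 1) / 2"
      by (simp add: power_mult_distrib power_divide)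
    finally show ?thesis .
  qed
  ultimately show ?thesis by (meson ennreal_leI order_trans)
qed

theorem theorem5:
  shows "\<exists>c::real. 0 < c \<and>
    (\<forall>(p::nat) (K::nat) (Obs :: nat \<Rightarrow> nat set) (n :: nat \<Rightarrow> nat) (N::nat) (Ls :: nat set set)
      (R::real) (B::real) (lm::real) (lp::real) (chi::real) (C::real) (kappa::real) (CX::real)
      (rho::real) (Crho::real).
      2 \<le> p \<and>
      (\<forall>k<K. Obs k \<subseteq> {..<p}) \<and> (\<Union>k<K. Obs k) = {..<p} \<and>
      modalities p K Obs Ls \<and> 2 \<le> card Ls \<and>
      0 < R \<and> 0 < B \<and> 0 < lm \<and> lm < lp \<and> 0 < chi \<and> chi \<le> 1 \<and> 1 \<le> C \<and>
      1 \<le> kappa \<and> root 4 105 \<le> kappa \<and> 0 < CX \<and> sqrt (8 * lp / 3) \<le> CX \<and>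
      0 < rho \<and> rho < 1 \<and> 0 < Crho \<and>
      (\<forall>G\<in>Ls. \<forall>H\<in>Ls. G \<noteq> H \<longrightarrow>
         rho * real (n_lab K n) \<le> real (h_count K Obs n G) \<and>
         real (h_count K Obs n G) \<le> Crho * rho * real (n_lab K n) \<and>
         rho\<^sup>2 * real (n_lab K n) \<le> real (pair_count K Obs n G H) \<and>
         real (pair_count K Obs n G H) \<le> Crho * rho\<^sup>2 * real (n_lab K n)) \<and>
      rho * real (n_lab K n) \<ge> real p * max (1 / 2) (R\<^sup>2 / (4 * B\<^sup>2 * lm)) \<and>
      max ((real N + rho\<^sup>2 * real (n_lab K n)) / B\<^sup>2) (rho\<^sup>2 * real (n_lab K n) / R\<^sup>2)
        \<ge> real p * (min 1 (lp\<^sup>2) / (2 * B\<^sup>2 * (lp - lm)\<^sup>2))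
      \<longrightarrow>
      (INF b \<in> estimators p K Obs n N (P_OSS p R B lm lp chi C kappa CX).
         SUP P \<in> P_OSS_Gauss p R B lm lp chi C kappa CX. risk p K Obs n N b P)
      \<ge> ennreal (c *
          (1 / (Crho * lm) * (R\<^sup>2 * real p / (rho * real (n_lab K n)))
           + min (1 / lp\<^sup>2) 1 / Crho
             * min (B\<^sup>2 * real p / (real N + rho\<^sup>2 * real (n_lab K n)))
                   (R\<^sup>2 * real p / (rho\<^sup>2 * real (n_lab K n))))))"
proof (intro exI[of _ "1 / 1536"] conjI allI impI, goal_cases)
  case 1
  show ?case by simp
next
  case (2 p K Obs n N Ls R B lm lp chi C kappa CX rho Crho)
  then have p: "2 \<le> p" and Obs: "\<And>k. k < K \<Longrightarrow> Obs k \<subseteq> {..<p}"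
    and mod: "modalities p K Obs Ls" and L2: "2 \<le> card Ls"
    and pos: "0 < R" "0 < B" "0 < lm" "lm < lp"
    and par: "0 < chi" "chi \<le> 1" "1 \<le> C" "root 4 105 \<le> kappa" "sqrt (8 * lp / 3) \<le> CX"
    and rho: "0 < rho"
    and counts: "\<And>G H. G \<in> Ls \<Longrightarrow> H \<in> Ls \<Longrightarrow> G \<noteq> H \<Longrightarrow>
         rho * real (n_lab K n) \<le> real (h_count K Obs n G) \<and>
         real (h_count K Obs n G) \<le> Crho * rho * real (n_lab K n) \<and>
         rho\<^sup>2 * real (n_lab K n) \<le> real (pair_count K Obs n G H) \<and>
         real (pair_count K Obs n G H) \<le> Crho * rho\<^sup>2 * real (n_lab K n)"
    and c1: "real p * max (1 / 2) (R\<^sup>2 / (4 * B\<^sup>2 * lm)) \<le> rho * real (n_lab K n)"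
    and c2: "real p * (min 1 (lp\<^sup>2) / (2 * B\<^sup>2 * (lp - lm)\<^sup>2))
        \<le> max ((real N + rho\<^sup>2 * real (n_lab K n)) / B\<^sup>2) (rho\<^sup>2 * real (n_lab K n) / R\<^sup>2)"
    by auto
  define x where "x = rho * real (n_lab K n)"
  define y where "y = rho\<^sup>2 * real (n_lab K n)"
  have cp: "compatible_partition p K Obs Ls" using mod by (simp add: modalities_def)
  then have part: "partition_on {..<p} Ls" by (simp add: compatible_partition_def)
  have x: "real p * (R\<^sup>2 / (4 * B\<^sup>2 * lm)) \<le> x" "real p * (1 / 2) \<le> x"
    using c1 unfolding x_def by (meson max.cobounded1 max.cobounded2 mult_left_mono of_nat_0_le_iff order_trans)+
  then have x0: "0 < x" using p by simp
  have y0: "0 < y"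
  proof -
    have "y = rho * x" by (simp add: x_def y_def power2_eq_square)
    then show ?thesis using rho x0 by simp
  qed
  obtain G where G: "G \<in> Ls" "2 * card G \<le> p" using exists_small_part[OF part L2] by blast
  obtain H where "H \<in> Ls" "H \<noteq> G" using exists_other_part[OF L2] by blast
  then have "x \<le> Crho * x" using counts[of G H] G by (auto simp: x_def)
  then have Crho: "1 \<le> Crho" using x0 by simp
  have "G \<noteq> {}" using partition_onD3[OF part] G by auto
  then obtain i0 where i0: "i0 \<in> G" by blast
  have Gp: "G \<subseteq> {..<p}" using partition_onD1[OF part] G by auto
  have of_part: "\<exists>H\<in>Ls. j \<in> H" if "j < p" for j using partition_onD1[OF part] that by auto
  define J where "J = {..<p} - G"
  have cardJ: "real p \<le> 2 * real (card J)"
  proof -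
    have "card J = p - card G" using Gp by (simp add: J_def card_Diff_subset finite_subset)
    then show ?thesis using G(2) by linarith
  qed
  have h: "real (\<Sum>k<K. if j \<in> Obs k then n k else 0) \<le> Crho * x" if j: "j < p" for j
  proof -
    obtain H where H: "H \<in> Ls" "j \<in> H" using of_part[OF j] by blast
    obtain H' where "H' \<in> Ls" "H' \<noteq> H" using exists_other_part[OF L2] by blast
    then show ?thesis
      using counts[OF H(1), of H'] by (simp add: h_count_eq[OF cp H] x_def mult.assoc)
  qed
  have pr: "real (\<Sum>k<K. if i0 \<in> Obs k \<and> j \<in> Obs k then n k else 0) \<le> Crho * y" if j: "j \<in> J" for j
  proof -
    obtain H where H: "H \<in> Ls" "j \<in> H" using of_part[of j] j by (auto simp: J_def)
    then have "G \<noteq> H" using j by (auto simp: J_def)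
    then show ?thesis
      using counts[OF G(1) H(1)] by (simp add: pair_count_eq[OF cp G(1) i0 H] y_def mult.assoc)
  qed
  define T1 where "T1 = 1 / (Crho * lm) * (R\<^sup>2 * real p / x)"
  define T2 where "T2 = min (1 / lp\<^sup>2) 1 / Crho * min (B\<^sup>2 * real p / (real N + y)) (R\<^sup>2 * real p / y)"
  have T0: "0 \<le> T1" "0 \<le> T2" using pos x0 y0 Crho by (auto simp: T1_def T2_def)
  have "ennreal (1 / 1536 * (T1 + T2))
      \<le> (INF b \<in> estimators p K Obs n N (P_OSS p R B lm lp chi C kappa CX).
         SUP P \<in> P_OSS_Gauss p R B lm lp chi C kappa CX. risk p K Obs n N b P)"
  proof (rule INF_greatest)
    fix b assume b: "b \<in> estimators p K Obs n N (P_OSS p R B lm lp chi C kappa CX)"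
    let ?s = "SUP P \<in> P_OSS_Gauss p R B lm lp chi C kappa CX. risk p K Obs n N b P"
    have 1: "ennreal (T1 / 16) \<le> ?s"
      unfolding T1_def
      using complete_case_term[OF p Obs pos(1-3) less_imp_le[OF pos(4)] x0 Crho par x(1) h b] .
    have 2: "ennreal (T2 / 768) \<le> ?s"
      unfolding T2_def
    proof (rule cross_covariance_term[OF _ _ cardJ Obs pos y0 Crho par _ pr b])
      show "i0 < p" "J \<subseteq> {..<p} - {i0}" using i0 Gp by (auto simp: J_def)
      show "real p * (min 1 (lp\<^sup>2) / (2 * B\<^sup>2 * (lp - lm)\<^sup>2)) \<le> max ((real N + y) / B\<^sup>2) (y / R\<^sup>2)"
        using c2 by (simp add: y_def)
    qed
    \<comment> \<open>The larger of two numbers is at least their mean, and \<open>2 * 768 = 1536\<close>.\<close>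
    have "1 / 1536 * (T1 + T2) \<le> max (T1 / 16) (T2 / 768)" using T0 by (auto simp: max_def)
    then have "ennreal (1 / 1536 * (T1 + T2)) \<le> ennreal (max (T1 / 16) (T2 / 768))" by (rule ennreal_leI)
    also have "\<dots> \<le> ?s" using 1 2 by (simp add: max_def)
    finally show "ennreal (1 / 1536 * (T1 + T2)) \<le> ?s" .
  qed
  then show ?case by (simp only: T1_def T2_def x_def y_def)
qed

end
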